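(* There is an absolute constant $\varepsilon>0$ such that the following holds. Suppose that for every $n$ there is a degree-$d(n)$, $q(n)$-query OV algorithm which, for every game with $n$ strategies per player and all payoffs in $[-1,1]$ and every degree-$d(n)$ pseudo-equilibrium of that game given to it as input, outputs an $\varepsilon$-NE of the game (with probability at least $2/3$). Then there is a constant $c>0$ such that for all sufficiently large $n$, either $d(n)\ge c\log n$ or $q(n)\ge n^{c\log n}$. The same conclusion holds for OV algorithms that use the partial verification oracle instead of the verification oracle.
   Context: A two-player game with $n$ strategies is a pair $(R,C)$ of matrices in $\mathbb{R}^{n\times n}$. Mixed strategies are elements of $\Delta_n=\{x\in[0,1]^n:\sum_ix_i=1\}$; $e_i$ is the $i$-th pure strategy; payoffs at $(x,y)$ are $x^\top Ry$ and $x^\top Cy$. $(x,y)$ is an $\varepsilon$-NE if $x^\top Ry\ge e_i^\top Ry-\varepsilon$ and $x^\top Cy\ge x^\top Ce_j-\varepsilon$ for all $i,j$. A degree-$d$ pseudo-distribution on $\mathbb{R}^m$ is a finitely supported signed measure $\tilde\mu$ whose functional $\tilde{\mathbb E}[f]=\sum_z\tilde\mu(z)f(z)$ satisfies $\tilde{\mathbb E}[1]=1$ and $\tilde{\mathbb E}[q^2]\ge0$ for all polynomials $q$ of degree $\le d/2$; it satisfies $h\ge0$ if $\tilde{\mathbb E}[p^2h]\ge0$ for all polynomials $p$ with $\deg(p^2h)\le d$ ($h=0$ means $h\ge0$ and $-h\ge0$). A degree-$d$ pseudo-equilibrium of $(R,C)$ is a degree-$d$ pseudo-distribution over $(x,y)\in\mathbb{R}^{2n}$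 satisfying $x_i,y_i\ge0$, $\sum_ix_i=\sum_iy_i=1$, $x^\top Ry-e_i^\top Ry\ge0$ and $x^\top Cy-x^\top Ce_j\ge0$ for all $i,j$. A degree-$d$, $q$-query OV algorithm for computing $\varepsilon$-NE is a (possibly randomized, computationally unbounded) procedure whose only input is a degree-$d$ pseudo-equilibrium of the unknown input game $G$ (it does not see $G$), which may adaptively make at most $q$ queries to an oracle for $G$, and which outputs a strategy profile. The verification oracle takes a profile $(x,y)$ and answers whether it is an $\varepsilon$-NE of $G$; the partial verification oracle takes a single strategy of one player and answers whether some $\varepsilon$-NE of $G$ has that strategy for that player. *)

theory Defs
  imports "HOL-Probability.Probability" "HOL-Library.Poly_Mapping" "Jordan_Normal_Form.Matrix"
begin

unbundle no inner_syntax
unbundle no vec_syntax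

section \<open>Two-player games\<close>

text \<open>
  A strategy is a vector of unconstrained dimension; the number \<open>n\<close> of strategies per player
  is always passed explicitly, because the statement quantifies over it.
\<close>

type_synonym game = "real mat \<times> real mat"
type_synonym profile = "real vec \<times> real vec"

definition games :: "nat \<Rightarrow> game set" where
  "games n = {(R, C). R \<in> carrier_mat n n \<and> C \<in> carrier_mat n n}"

definition payoffs_in :: "nat \<Rightarrow> real set \<Rightarrow> game \<Rightarrow> bool" where
  "payoffs_in n S = (\<lambda>(R, C). \<forall>i<n. \<forall>j<n. R $$ (i, j) \<in> S \<and> C $$ (i, j) \<in> S)"

definition mixed_strategies :: "nat \<Rightarrow> real vec set" where
  "mixed_strategies n = {x \<in> carrier_vec n. (\<forall>i<n. x $ i \<in> {0..1}) \<and> (\<Sum>i<n. x $ i) = 1}"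

definition profiles :: "nat \<Rightarrow> profile set" where
  "profiles n = mixed_strategies n \<times> mixed_strategies n"

definition payoff :: "real vec \<Rightarrow> real mat \<Rightarrow> real vec \<Rightarrow> real" where
  "payoff x M y = x \<bullet> (M *\<^sub>v y)"

definition approx_NE :: "real \<Rightarrow> nat \<Rightarrow> game \<Rightarrow> profile \<Rightarrow> bool" where
  "approx_NE \<epsilon> n = (\<lambda>(R, C) (x, y).
     (x, y) \<in> profiles n \<and>
     (\<forall>i<n. payoff x R y \<ge> payoff (unit_vec n i) R y - \<epsilon>) \<and>
     (\<forall>j<n. payoff x C y \<ge> payoff x C (unit_vec n j) - \<epsilon>))"

section \<open>Real multivariate polynomials\<close>

text \<open>
  A monomial is a finitely supported exponent function, a polynomial a finitely supported
  coefficient function on monomials; the ring structure is the convolution product of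
  \<open>Poly_Mapping\<close>.
\<close>

type_synonym mono = "nat \<Rightarrow>\<^sub>0 nat"
type_synonym mpoly = "mono \<Rightarrow>\<^sub>0 real"

definition mpoly_const :: "real \<Rightarrow> mpoly" where
  "mpoly_const c = Poly_Mapping.single 0 c"

definition mpoly_var :: "nat \<Rightarrow> mpoly" where
  "mpoly_var i = Poly_Mapping.single (Poly_Mapping.single i 1) 1"

definition mpolys :: "nat \<Rightarrow> mpoly set" where
  "mpolys m = {p. \<forall>\<alpha>\<in>Poly_Mapping.keys p. Poly_Mapping.keys \<alpha> \<subseteq> {..<m}}"

definition mono_degree :: "mono \<Rightarrow> nat" where
  "mono_degree \<alpha> = (\<Sum>i\<in>Poly_Mapping.keys \<alpha>. Poly_Mapping.lookup \<alpha> i)"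

text \<open>The zero polynomial gets total degree 0.\<close>

definition total_degree :: "mpoly \<Rightarrow> nat" where
  "total_degree p = Max (insert 0 (mono_degree ` Poly_Mapping.keys p))"

definition mpoly_eval :: "mpoly \<Rightarrow> real vec \<Rightarrow> real" where
  "mpoly_eval p z =
     (\<Sum>\<alpha>\<in>Poly_Mapping.keys p. Poly_Mapping.lookup p \<alpha> *
        (\<Prod>i\<in>Poly_Mapping.keys \<alpha>. (z $ i) ^ Poly_Mapping.lookup \<alpha> i))"

section \<open>Pseudo-distributions and pseudo-equilibria\<close>

text \<open>A finitely supported signed measure is given by its finitely supported mass function.\<close>

type_synonym signed_measure = "real vec \<Rightarrow>\<^sub>0 real"

definition pseudo_expectation :: "signed_measure \<Rightarrow> mpoly \<Rightarrow> real" where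
  "pseudo_expectation \<mu> f =
     (\<Sum>z\<in>Poly_Mapping.keys \<mu>. Poly_Mapping.lookup \<mu> z * mpoly_eval f z)"

definition pseudo_distribution :: "nat \<Rightarrow> nat \<Rightarrow> signed_measure \<Rightarrow> bool" where
  "pseudo_distribution d m \<mu> \<longleftrightarrow>
     Poly_Mapping.keys \<mu> \<subseteq> carrier_vec m \<and>
     pseudo_expectation \<mu> 1 = 1 \<and>
     (\<forall>q\<in>mpolys m. real (total_degree q) \<le> real d / 2 \<longrightarrow> pseudo_expectation \<mu> (q ^ 2) \<ge> 0)"

definition satisfies_nonneg :: "nat \<Rightarrow> nat \<Rightarrow> signed_measure \<Rightarrow> mpoly \<Rightarrow> bool" where
  "satisfies_nonneg d m \<mu> h \<longleftrightarrow>
     (\<forall>p\<in>mpolys m. total_degree (p ^ 2 * h) \<le> d \<longrightarrow> pseudo_expectation \<mu> (p ^ 2 * h) \<ge> 0)"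

definition satisfies_zero :: "nat \<Rightarrow> nat \<Rightarrow> signed_measure \<Rightarrow> mpoly \<Rightarrow> bool" where
  "satisfies_zero d m \<mu> h \<longleftrightarrow> satisfies_nonneg d m \<mu> h \<and> satisfies_nonneg d m \<mu> (- h)"

text \<open>
  A point \<open>(x, y)\<close> with \<open>x\<close> and \<open>y\<close> of dimension \<open>n\<close> is the concatenated vector of dimension
  \<open>2 * n\<close>: the coordinate \<open>x\<^sub>i\<close> has index \<open>i\<close> and \<open>y\<^sub>j\<close> has index \<open>n + j\<close>.
\<close>

definition x_var :: "nat \<Rightarrow> mpoly" where
  "x_var i = mpoly_var i"

definition y_var :: "nat \<Rightarrow> nat \<Rightarrow> mpoly" where
  "y_var n j = mpoly_var (n + j)"

definition payoff_poly :: "nat \<Rightarrow> real mat \<Rightarrow> mpoly" where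
  "payoff_poly n M = (\<Sum>i<n. \<Sum>j<n. mpoly_const (M $$ (i, j)) * x_var i * y_var n j)"

definition row_payoff_poly :: "nat \<Rightarrow> real mat \<Rightarrow> nat \<Rightarrow> mpoly" where
  "row_payoff_poly n M i = (\<Sum>j<n. mpoly_const (M $$ (i, j)) * y_var n j)"

definition col_payoff_poly :: "nat \<Rightarrow> real mat \<Rightarrow> nat \<Rightarrow> mpoly" where
  "col_payoff_poly n M j = (\<Sum>i<n. mpoly_const (M $$ (i, j)) * x_var i)"

definition pseudo_equilibrium :: "nat \<Rightarrow> nat \<Rightarrow> game \<Rightarrow> signed_measure \<Rightarrow> bool" where
  "pseudo_equilibrium d n = (\<lambda>(R, C) \<mu>.
     pseudo_distribution d (2 * n) \<mu> \<and>
     (\<forall>i<n. satisfies_nonneg d (2 * n) \<mu> (x_var i)) \<and>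
     (\<forall>j<n. satisfies_nonneg d (2 * n) \<mu> (y_var n j)) \<and>
     satisfies_zero d (2 * n) \<mu> ((\<Sum>i<n. x_var i) - 1) \<and>
     satisfies_zero d (2 * n) \<mu> ((\<Sum>j<n. y_var n j) - 1) \<and>
     (\<forall>i<n. satisfies_nonneg d (2 * n) \<mu> (payoff_poly n R - row_payoff_poly n R i)) \<and>
     (\<forall>j<n. satisfies_nonneg d (2 * n) \<mu> (payoff_poly n C - col_payoff_poly n C j)))"

section \<open>Oblivious algorithms with a verification oracle\<close>

text \<open>
  A deterministic adaptive procedure with access to a yes/no oracle is a decision tree. The
  first subtree of a query is taken on the answer yes.
\<close>

datatype (queries: 'q, outputs: 'o) query_tree =
  Output 'o
| Query 'q "('q, 'o) query_tree" "('q, 'o) query_tree"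

fun run_tree :: "('q \<Rightarrow> bool) \<Rightarrow> ('q, 'o) query_tree \<Rightarrow> 'o" where
  "run_tree orc (Output r) = r"
| "run_tree orc (Query a t u) = (if orc a then run_tree orc t else run_tree orc u)"

fun max_queries :: "('q, 'o) query_tree \<Rightarrow> nat" where
  "max_queries (Output r) = 0"
| "max_queries (Query a t u) = Suc (max (max_queries t) (max_queries u))"

text \<open>
  A randomized algorithm maps its input to a probability measure on decision trees, i.e. all
  its random bits are drawn in advance. An arbitrary source of randomness is covered by
  pushing it forward to the trees, and a deterministic algorithm is a point mass. The
  \<open>\<sigma>\<close>-algebra on the trees is part of the algorithm.
\<close>

type_synonym 'q OV_alg = "signed_measure \<Rightarrow> ('q, profile) query_tree measure"

definition OV_algorithm :: "'q set \<Rightarrow> nat \<Rightarrow> nat \<Rightarrow> 'q OV_alg \<Rightarrow> bool" where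
  "OV_algorithm Q n q A \<longleftrightarrow>
     (\<forall>\<mu>. prob_space (A \<mu>) \<and>
       (\<forall>t\<in>space (A \<mu>). max_queries t \<le> q \<and> queries t \<subseteq> Q \<and> outputs t \<subseteq> profiles n))"

text \<open>
  A non-measurable set has measure 0 in the library, so the bound below includes
  measurability of the success event.
\<close>

definition computes_approx_NE ::
    "(game \<Rightarrow> 'q \<Rightarrow> bool) \<Rightarrow> real \<Rightarrow> nat \<Rightarrow> nat \<Rightarrow> 'q OV_alg \<Rightarrow> bool" where
  "computes_approx_NE orc \<epsilon> d n A \<longleftrightarrow>
     (\<forall>G\<in>games n. \<forall>\<mu>. payoffs_in n {-1..1} G \<longrightarrow> pseudo_equilibrium d n G \<mu> \<longrightarrow>
        measure (A \<mu>) {t \<in> space (A \<mu>). approx_NE \<epsilon> n G (run_tree (orc G) t)} \<ge> 2 / 3)"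

definition verification_oracle :: "real \<Rightarrow> nat \<Rightarrow> game \<Rightarrow> profile \<Rightarrow> bool" where
  "verification_oracle \<epsilon> n G p \<longleftrightarrow> approx_NE \<epsilon> n G p"

datatype single_strategy = Row_Strategy "real vec" | Col_Strategy "real vec"

definition single_strategies :: "nat \<Rightarrow> single_strategy set" where
  "single_strategies n = Row_Strategy ` mixed_strategies n \<union> Col_Strategy ` mixed_strategies n"

fun partial_verification_oracle :: "real \<Rightarrow> nat \<Rightarrow> game \<Rightarrow> single_strategy \<Rightarrow> bool" where
  "partial_verification_oracle \<epsilon> n G (Row_Strategy x) \<longleftrightarrow> (\<exists>y. approx_NE \<epsilon> n G (x, y))"
| "partial_verification_oracle \<epsilon> n G (Col_Strategy y) \<longleftrightarrow> (\<exists>x. approx_NE \<epsilon> n G (x, y))"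

definition OV_solvable :: "real \<Rightarrow> nat \<Rightarrow> nat \<Rightarrow> nat \<Rightarrow> bool" where
  "OV_solvable \<epsilon> d q n \<longleftrightarrow>
     (\<exists>A. OV_algorithm (profiles n) n q A \<and>
          computes_approx_NE (verification_oracle \<epsilon> n) \<epsilon> d n A)"

definition partial_OV_solvable :: "real \<Rightarrow> nat \<Rightarrow> nat \<Rightarrow> nat \<Rightarrow> bool" where
  "partial_OV_solvable \<epsilon> d q n \<longleftrightarrow>
     (\<exists>A. OV_algorithm (single_strategies n) n q A \<and>
          computes_approx_NE (partial_verification_oracle \<epsilon> n) \<epsilon> d n A)"

end

theory Submission
  imports Defs
begin

text \<open>
  Take a cooperative game in which both players receive a question and answer it by a label in
  \<open>{0, 1}\<^sup>l\<close>; they win on questions \<open>(u, v)\<close> with labels \<open>(\<alpha>, \<beta>)\<close> iff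
  \<open>\<langle>a\<^sub>v, \<alpha>\<rangle> + \<langle>a\<^sub>u, \<beta>\<rangle> = c\<^sub>u\<^sub>v\<close>. For a suitable \<open>c\<close> every strategy fails on a constant fraction of
  the question pairs. If any few of the vectors \<open>a\<^sub>v\<close> are independent, then the equations among few
  questions are independent, and declaring them satisfied and all other characters unbiased is a
  positive functional on functions of few labels.

  Every player may bet on a set containing the question of the opponent, which forces the questions to
  be uniform, and may switch to a second game that pays slightly less than perfect cooperation.
  Hence the pseudo-distribution is a pseudo-equilibrium, while all approximate equilibria live in the
  second game, which the pseudo-equilibrium does not see. There the players must hide on the graph of
  a function; approximate equilibria for two different functions share a strategy only if the functions
  agree on half of the arguments, so that a query excludes only few functions.
\<close>

section \<open>Multivariate polynomials\<close>

text \<open>All parameters are multiples of one \<open>r\<close> of order log n: 64 * r questions,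
  labels of 10 * r bits, \<open>2 ^ (8 * r)\<close> values of the hidden function. Bets on arbitrary
  sets of questions cost \<open>2 ^ (64 * r)\<close> strategies, which is polynomial in n only
  because the number of questions is logarithmic. A bimatrix game imposes an equation on every pair
  of questions, 4096 * r^2 equations on 1280 * r^2 label bits. This excess makes some right-hand
  side far from all assignments, but it also threatens to make inconsistency easy to derive. The
  crossing of the vectors prevents that: in a combination of equations the label of u is tested by
  the sum of \<open>a v\<close> over the partners v of u, so independence keeps every touched
  question alive. Real cooperation on uniform questions earns at most 15/16 of the perfect payoff
  1/2; the second game pays 159/320 against a cooperator, strictly in between. This number does not
  depend on the hidden function, so one pseudo-equilibrium serves all \<open>2 ^ (512 * r^2)\<close>
  functions, while a single query or output fits at most \<open>2 ^ (64 * r + 256 * r^2)\<close> of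
  them.\<close>

lemma poly_mapping_additive_induct [case_names zero single add]:
  fixes p :: "'a \<Rightarrow>\<^sub>0 'b::comm_monoid_add"
  assumes "P 0" "\<And>a c. P (Poly_Mapping.single a c)" "\<And>p q. P p \<Longrightarrow> P q \<Longrightarrow> P (p + q)"
  shows "P p"
proof (rule update_induct[of P])
  show "P 0" by (fact assms(1))
  fix f :: "'a \<Rightarrow>\<^sub>0 'b" and a b
  assume 2: "a \<notin> Poly_Mapping.keys f" "P f"
  have "Poly_Mapping.update a b f = Poly_Mapping.single a b + f"
    using 2(1)
    by (intro poly_mapping_eqI)
      (auto simp: lookup_update lookup_add lookup_single in_keys_iff)
  thus "P (Poly_Mapping.update a b f)" using assms(2,3) 2 by simp
qed

text \<open>Evaluation of polynomials, homogenization and pseudo-expectation (a sum over the support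
  of the measure) all have this form; the last one is only additive, hence the two locales.\<close>

definition pm_lift :: "('c::zero \<Rightarrow> 'r::comm_semiring_1) \<Rightarrow> ('a \<Rightarrow> 'r) \<Rightarrow> ('a \<Rightarrow>\<^sub>0 'c) \<Rightarrow> 'r" where
  "pm_lift \<iota> M p = (\<Sum>\<alpha>\<in>Poly_Mapping.keys p. \<iota> (Poly_Mapping.lookup p \<alpha>) * M \<alpha>)"

locale pm_linear =
  fixes \<iota> :: "'c::comm_semiring_1 \<Rightarrow> 'r::comm_semiring_1" and M :: "'a \<Rightarrow> 'r"
  assumes \<iota>_zero: "\<iota> 0 = 0" and \<iota>_add: "\<iota> (a + b) = \<iota> a + \<iota> b"
begin

lemma pm_lift_superset:
  assumes "finite S" "Poly_Mapping.keys p \<subseteq> S"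
  shows "pm_lift \<iota> M p = (\<Sum>\<alpha>\<in>S. \<iota> (Poly_Mapping.lookup p \<alpha>) * M \<alpha>)"
  unfolding pm_lift_def using assms
  by (intro sum.mono_neutral_left) (auto simp: in_keys_iff \<iota>_zero)

lemma pm_lift_0: "pm_lift \<iota> M 0 = 0"
  by (simp add: pm_lift_def)

lemma pm_lift_single: "pm_lift \<iota> M (Poly_Mapping.single \<alpha> c) = \<iota> c * M \<alpha>"
  by (subst pm_lift_superset[of "{\<alpha>}"]) auto

lemma pm_lift_add: "pm_lift \<iota> M (p + q) = pm_lift \<iota> M p + pm_lift \<iota> M q"
proof -
  let ?S = "Poly_Mapping.keys p \<union> Poly_Mapping.keys q"
  have "Poly_Mapping.keys (p + q) \<subseteq> ?S" by (rule keys_add)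
  thus ?thesis
    by (simp add: pm_lift_superset[of ?S] lookup_add \<iota>_add distrib_right sum.distrib)
qed

lemma pm_lift_sum: "pm_lift \<iota> M (\<Sum>i\<in>I. p i) = (\<Sum>i\<in>I. pm_lift \<iota> M (p i))"
  by (induction I rule: infinite_finite_induct) (simp_all add: pm_lift_0 pm_lift_add)

end

locale pm_lifting = pm_linear \<iota> M
  for \<iota> :: "'c::comm_semiring_1 \<Rightarrow> 'r::comm_semiring_1" and M :: "'a::comm_monoid_add \<Rightarrow> 'r" +
  assumes \<iota>_mult: "\<iota> (a * b) = \<iota> a * \<iota> b" and M_add: "M (\<alpha> + \<beta>) = M \<alpha> * M \<beta>"
begin

lemma pm_lift_mult: "pm_lift \<iota> M (p * q) = pm_lift \<iota> M p * pm_lift \<iota> M q"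
proof (induction p rule: poly_mapping_additive_induct)
  case (single a c)
  show ?case
  proof (induction q rule: poly_mapping_additive_induct)
    case (single b d)
    show ?case
      by (simp add: mult_single pm_lift_single \<iota>_mult M_add mult_ac)
  qed (simp_all add: pm_lift_0 pm_lift_add distrib_left)
qed (simp_all add: pm_lift_0 pm_lift_add distrib_right)

end

lemma prod_power_keys_add:
  fixes f :: "nat \<Rightarrow> 'r::comm_semiring_1"
  shows "(\<Prod>i\<in>Poly_Mapping.keys (\<alpha> + \<beta>). f i ^ Poly_Mapping.lookup (\<alpha> + \<beta>) i) =
    (\<Prod>i\<in>Poly_Mapping.keys \<alpha>. f i ^ Poly_Mapping.lookup \<alpha> i) *
    (\<Prod>i\<in>Poly_Mapping.keys \<beta>. f i ^ Poly_Mapping.lookup \<beta> i)"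
proof -
  let ?S = "Poly_Mapping.keys \<alpha> \<union> Poly_Mapping.keys \<beta>"
  have *: "(\<Prod>i\<in>Poly_Mapping.keys \<gamma>. f i ^ Poly_Mapping.lookup \<gamma> i) = (\<Prod>i\<in>?S. f i ^ Poly_Mapping.lookup \<gamma> i)"
    if "Poly_Mapping.keys \<gamma> \<subseteq> ?S" for \<gamma>
    using that by (intro prod.mono_neutral_left) (auto simp: in_keys_iff)
  show ?thesis
    unfolding *[OF keys_add] *[OF Un_upper1] *[OF Un_upper2]
    by (simp add: lookup_add power_add prod.distrib)
qed

lemma mono_degree_add: "mono_degree (\<alpha> + \<beta>) = mono_degree \<alpha> + mono_degree \<beta>"
proof -
  let ?S = "Poly_Mapping.keys \<alpha> \<union> Poly_Mapping.keys \<beta>"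
  have *: "mono_degree \<gamma> = (\<Sum>i\<in>?S. Poly_Mapping.lookup \<gamma> i)"
    if "Poly_Mapping.keys \<gamma> \<subseteq> ?S" for \<gamma>
    using that unfolding mono_degree_def by (intro sum.mono_neutral_left) (auto simp: in_keys_iff)
  show ?thesis
    unfolding *[OF keys_add] *[OF Un_upper1] *[OF Un_upper2]
    by (simp add: lookup_add sum.distrib)
qed

lemma pm_lifting_eval:
  "pm_lifting (\<lambda>c::real. c) (\<lambda>\<alpha>. \<Prod>i\<in>Poly_Mapping.keys \<alpha>. (z $ i) ^ Poly_Mapping.lookup \<alpha> i)"
  by standard (simp_all add: prod_power_keys_add)

lemma mpoly_eval_conv_pm_lift:
  "mpoly_eval p z = pm_lift (\<lambda>c. c) (\<lambda>\<alpha>. \<Prod>i\<in>Poly_Mapping.keys \<alpha>. (z $ i) ^ Poly_Mapping.lookup \<alpha> i) p"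
  by (simp add: mpoly_eval_def pm_lift_def)

lemma mpoly_eval_add [simp]: "mpoly_eval (p + q) z = mpoly_eval p z + mpoly_eval q z"
  unfolding mpoly_eval_conv_pm_lift by (rule pm_linear.pm_lift_add[OF pm_lifting.axioms(1)[OF pm_lifting_eval]])

lemma mpoly_eval_mult [simp]: "mpoly_eval (p * q) z = mpoly_eval p z * mpoly_eval q z"
  unfolding mpoly_eval_conv_pm_lift by (rule pm_lifting.pm_lift_mult[OF pm_lifting_eval])

lemma mpoly_eval_0 [simp]: "mpoly_eval 0 z = 0"
  by (simp add: mpoly_eval_def)

lemma mpoly_eval_const [simp]: "mpoly_eval (mpoly_const c) z = c"
  unfolding mpoly_eval_conv_pm_lift mpoly_const_def
  by (simp add: pm_linear.pm_lift_single[OF pm_lifting.axioms(1)[OF pm_lifting_eval]])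

lemma mpoly_eval_var [simp]: "mpoly_eval (mpoly_var i) z = z $ i"
  unfolding mpoly_eval_conv_pm_lift mpoly_var_def
  by (simp add: pm_linear.pm_lift_single[OF pm_lifting.axioms(1)[OF pm_lifting_eval]])

lemma mpoly_eval_1 [simp]: "mpoly_eval 1 z = 1"
  using mpoly_eval_const[of 1 z] by (simp add: mpoly_const_def)

lemma mpoly_eval_uminus [simp]: "mpoly_eval (- p) z = - mpoly_eval p z"
  using mpoly_eval_add[of p "- p" z] by simp

lemma mpoly_eval_diff [simp]: "mpoly_eval (p - q) z = mpoly_eval p z - mpoly_eval q z"
  using mpoly_eval_add[of p "- q" z] by simp

lemma mpoly_eval_power [simp]: "mpoly_eval (p ^ k) z = mpoly_eval p z ^ k"
  by (induction k) simp_all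

lemma mpoly_eval_sum [simp]: "mpoly_eval (\<Sum>i\<in>I. f i) z = (\<Sum>i\<in>I. mpoly_eval (f i) z)"
  by (induction I rule: infinite_finite_induct) simp_all

section \<open>Total degree of a product\<close>

lemma mono_degree_le_total_degree:
  "\<alpha> \<in> Poly_Mapping.keys p \<Longrightarrow> mono_degree \<alpha> \<le> total_degree p"
  unfolding total_degree_def by (intro Max_ge) auto

text \<open>Grading by an extra variable: the coefficient of X^k is the part of degree k. Total
  degree becomes the degree of a univariate polynomial over an integral domain, where degrees add
  under multiplication.\<close>

definition homogenize :: "mpoly \<Rightarrow> mpoly poly" where
  "homogenize = pm_lift (\<lambda>c. [:mpoly_const c:]) (\<lambda>\<alpha>. Polynomial.monom (Poly_Mapping.single \<alpha> 1) (mono_degree \<alpha>))"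

lemma pm_lifting_homogenize:
  "pm_lifting (\<lambda>c. [:mpoly_const c:]) (\<lambda>\<alpha>. Polynomial.monom (Poly_Mapping.single \<alpha> (1::real)) (mono_degree \<alpha>))"
  by standard (simp_all add: mpoly_const_def single_add mult_single mono_degree_add Polynomial.mult_monom mult_ac)

lemma homogenize_mult: "homogenize (p * q) = homogenize p * homogenize q"
  unfolding homogenize_def by (rule pm_lifting.pm_lift_mult[OF pm_lifting_homogenize])

lemma coeff_homogenize:
  "Poly_Mapping.lookup (Polynomial.coeff (homogenize p) k) \<alpha> =
     (if mono_degree \<alpha> = k then Poly_Mapping.lookup p \<alpha> else 0)"
proof -
  have monom_eq: "[:mpoly_const c:] * Polynomial.monom (Poly_Mapping.single \<beta> 1) m
      = Polynomial.monom (Poly_Mapping.single \<beta> c) m" for c \<beta> m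
    by (simp add: mpoly_const_def Polynomial.smult_monom mult_single)
  have "Poly_Mapping.lookup (Polynomial.coeff (homogenize p) k) \<alpha> =
    (\<Sum>\<beta>\<in>Poly_Mapping.keys p. if \<beta> = \<alpha> \<and> mono_degree \<beta> = k then Poly_Mapping.lookup p \<beta> else 0)"
    unfolding homogenize_def pm_lift_def monom_eq
    by (simp add: Polynomial.coeff_sum lookup_sum) (intro sum.cong, auto simp: lookup_single when_def)
  also have "\<dots> = (\<Sum>\<beta>\<in>Poly_Mapping.keys p. if \<beta> = \<alpha> then (if mono_degree \<alpha> = k then Poly_Mapping.lookup p \<alpha> else 0) else 0)"
    by (intro sum.cong) auto
  also have "\<dots> = (if mono_degree \<alpha> = k then Poly_Mapping.lookup p \<alpha> else 0)"
    by (auto simp: in_keys_iff)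
  finally show ?thesis .
qed

lemma degree_homogenize: "Polynomial.degree (homogenize p) = total_degree p"
proof (rule antisym)
  show "Polynomial.degree (homogenize p) \<le> total_degree p"
  proof (rule Polynomial.degree_le, intro allI impI poly_mapping_eqI)
    fix k \<alpha> assume "total_degree p < k"
    thus "Poly_Mapping.lookup (Polynomial.coeff (homogenize p) k) \<alpha> = Poly_Mapping.lookup 0 \<alpha>"
      using mono_degree_le_total_degree[of \<alpha> p] by (fastforce simp: coeff_homogenize in_keys_iff)
  qed
  have "mono_degree \<alpha> \<le> Polynomial.degree (homogenize p)" if "\<alpha> \<in> Poly_Mapping.keys p" for \<alpha>
  proof (rule Polynomial.le_degree)
    show "Polynomial.coeff (homogenize p) (mono_degree \<alpha>) \<noteq> 0"
      using that coeff_homogenize[of p "mono_degree \<alpha>" \<alpha>] by (auto simp: in_keys_iff)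
  qed
  thus "total_degree p \<le> Polynomial.degree (homogenize p)"
    unfolding total_degree_def by (intro Max.boundedI) auto
qed

lemma homogenize_eq_0_iff: "homogenize p = 0 \<longleftrightarrow> p = 0"
proof
  assume "homogenize p = 0"
  hence "Poly_Mapping.lookup p \<alpha> = 0" for \<alpha>
    using coeff_homogenize[of p "mono_degree \<alpha>" \<alpha>] by simp
  thus "p = 0" by (intro poly_mapping_eqI) simp
qed (simp add: homogenize_def pm_lift_def)

lemma total_degree_mult:
  "p \<noteq> 0 \<Longrightarrow> q \<noteq> 0 \<Longrightarrow> total_degree (p * q) = total_degree p + total_degree q"
  by (simp add: degree_homogenize[symmetric] homogenize_mult homogenize_eq_0_iff Polynomial.degree_mult_eq)

text \<open>Constraints restrict only the degree of \<open>p ^ 2 * h\<close>. Since degrees add, no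
  cancellation can hide a test polynomial \<open>p\<close> of large degree.\<close>

lemma total_degree_square_mult_ge:
  assumes "p \<noteq> 0" "h \<noteq> 0"
  shows "total_degree p \<le> total_degree (p ^ 2 * h)"
proof -
  have "p ^ 2 \<noteq> 0" using assms by simp
  thus ?thesis using assms by (simp add: total_degree_mult power2_eq_square)
qed

section \<open>Characters of the group of finite sets under symmetric difference\<close>

text \<open>Sets stand for vectors over the field with two elements, with symmetric difference as
  addition; for finite \<open>A\<close> this is the sign of the inner product, a Walsh
  character.\<close>

definition chi :: "'a set \<Rightarrow> 'a set \<Rightarrow> real" where
  "chi A z = (\<Prod>a\<in>A. if a \<in> z then -1 else 1)"

lemma chi_empty [simp]: "chi {} z = 1"
  by (simp add: chi_def)

lemma chi_cases: "chi A z = 1 \<or> chi A z = -1"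
  unfolding chi_def by (induction A rule: infinite_finite_induct) auto

lemma chi_square [simp]: "chi A z * chi A z = 1"
  using chi_cases[of A z] by auto

lemma chi_conv_card: "finite A \<Longrightarrow> chi A z = (-1) ^ card (A \<inter> z)"
  unfolding chi_def by (subst prod.If_cases) (auto simp: Int_def)

lemma chi_commute: "finite A \<Longrightarrow> finite B \<Longrightarrow> chi A B = chi B A"
  by (simp add: chi_conv_card Int_commute)

lemma chi_Un_disjoint: "finite A \<Longrightarrow> finite B \<Longrightarrow> A \<inter> B = {} \<Longrightarrow> chi (A \<union> B) z = chi A z * chi B z"
  unfolding chi_def by (rule prod.union_disjoint)

lemma chi_sym_diff:
  assumes "finite A" "finite B"
  shows "chi (sym_diff A B) z = chi A z * chi B z"
proof -
  have split: "chi A z = chi (A - B) z * chi (A \<inter> B) z" if "finite A" for A B :: "'a set"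
    using that chi_Un_disjoint[of "A - B" "A \<inter> B" z] by (auto simp: Un_Diff_Int)
  have "chi A z = chi (A - B) z * chi (A \<inter> B) z" "chi B z = chi (B - A) z * chi (A \<inter> B) z"
    using split[of A B] split[of B A] assms by (auto simp: Int_commute)
  moreover have "chi (sym_diff A B) z = chi (A - B) z * chi (B - A) z"
    using assms by (intro chi_Un_disjoint) auto
  moreover have "chi (A - B) z * chi (A \<inter> B) z * (chi (B - A) z * chi (A \<inter> B) z)
    = chi (A - B) z * chi (B - A) z * (chi (A \<inter> B) z * chi (A \<inter> B) z)"
    by (simp only: mult_ac)
  ultimately show ?thesis by simp
qed

text \<open>Toggling a fixed element of \<open>A\<close> is an involution of \<open>Pow Z\<close>
  that reverses the sign of the character.\<close>

lemma sum_chi: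
  assumes "finite Z" "A \<subseteq> Z"
  shows "(\<Sum>z\<in>Pow Z. chi A z) = (if A = {} then 2 ^ card Z else 0)"
proof (cases "A = {}")
  case True
  thus ?thesis using assms by (simp add: card_Pow)
next
  case False
  then obtain a where a: "a \<in> A" by auto
  have fin: "finite A" using assms by (rule finite_subset[rotated])
  let ?f = "\<lambda>z. sym_diff z {a}"
  have flip: "chi A (?f z) = - chi A z" for z
  proof -
    have "chi A w = (if a \<in> w then -1 else 1) * (\<Prod>b\<in>A - {a}. if b \<in> w then -1 else 1)" for w
      unfolding chi_def using a fin by (rule prod.remove[rotated])
    moreover have "(\<Prod>b\<in>A - {a}. if b \<in> ?f z then -1 else 1 :: real) = (\<Prod>b\<in>A - {a}. if b \<in> z then -1 else 1)"
      by (intro prod.cong) auto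
    ultimately show ?thesis by auto
  qed
  have "(\<Sum>z\<in>Pow Z. chi A z) = (\<Sum>z\<in>Pow Z. chi A (?f z))"
  proof (intro sum.reindex_bij_witness[of _ ?f ?f])
    show "chi A (?f (?f z)) = chi A z" for z
      by (intro arg_cong[where f = "chi A"]) auto
  qed (use a assms in auto)
  also have "\<dots> = - (\<Sum>z\<in>Pow Z. chi A z)"
    by (simp only: flip sum_negf)
  finally show ?thesis using False by simp
qed

text \<open>Sum of the family over the two-element field, defined pointwise by parity so that no
  order of summation has to be chosen.\<close>

definition xorsum :: "('b \<Rightarrow> 'a set) \<Rightarrow> 'b set \<Rightarrow> 'a set" where
  "xorsum A E = {z. odd (card {e\<in>E. z \<in> A e})}"

lemma odd_card_sym_diff:
  assumes "finite X" "finite Y"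
  shows "odd (card (sym_diff X Y)) \<longleftrightarrow> (odd (card X) \<noteq> odd (card Y))"
proof -
  have split: "card X = card (X - Y) + card (X \<inter> Y)" if "finite X" for X Y :: "'a set"
    using that card_Un_disjoint[of "X - Y" "X \<inter> Y"] by (auto simp: Un_Diff_Int)
  have "card X = card (X - Y) + card (X \<inter> Y)" "card Y = card (Y - X) + card (X \<inter> Y)"
    using split[of X Y] split[of Y X] assms by (auto simp: Int_commute)
  moreover have "card (sym_diff X Y) = card (X - Y) + card (Y - X)"
    using assms by (intro card_Un_disjoint) auto
  ultimately show ?thesis by presburger
qed

lemma xorsum_empty [simp]: "xorsum A {} = {}"
  by (simp add: xorsum_def)

lemma xorsum_singleton [simp]: "xorsum A {e} = A e"
proof -
  have "{x \<in> {e}. z \<in> A x} = (if z \<in> A e then {e} else {})" for z by auto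
  thus ?thesis by (auto simp: xorsum_def)
qed

lemma xorsum_sym_diff:
  assumes "finite E" "finite E'"
  shows "xorsum A (sym_diff E E') = sym_diff (xorsum A E) (xorsum A E')"
proof -
  have "{e\<in>sym_diff E E'. z \<in> A e} = sym_diff {e\<in>E. z \<in> A e} {e\<in>E'. z \<in> A e}" for z
    by auto
  thus ?thesis using assms by (auto simp: xorsum_def odd_card_sym_diff)
qed

lemma xorsum_insert:
  assumes "finite E" "e \<notin> E"
  shows "xorsum A (insert e E) = sym_diff (A e) (xorsum A E)"
proof -
  have "insert e E = sym_diff {e} E" using assms by auto
  thus ?thesis using xorsum_sym_diff[of "{e}" E A] assms by simp
qed

lemma xorsum_cong: "E = E' \<Longrightarrow> (\<And>e. e \<in> E' \<Longrightarrow> A e = B e) \<Longrightarrow> xorsum A E = xorsum B E'"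
  unfolding xorsum_def by (metis (mono_tags, lifting) Collect_cong)

lemma xorsum_subset_UN: "xorsum A E \<subseteq> (\<Union>e\<in>E. A e)"
proof
  fix z assume "z \<in> xorsum A E"
  hence "{e\<in>E. z \<in> A e} \<noteq> {}" by (auto simp: xorsum_def simp del: Collect_empty_eq)
  thus "z \<in> (\<Union>e\<in>E. A e)" by auto
qed

section \<open>Counting\<close>

lemma sum_power_card_Pow:
  assumes "finite A"
  shows "(\<Sum>W\<in>Pow A. x ^ card W) = (1 + x :: real) ^ card A"
  using assms
proof (induction A)
  case (insert a A)
  have "(\<Sum>W\<in>insert a ` Pow A. x ^ card W) = (\<Sum>W\<in>Pow A. x ^ card (insert a W))"
    using insert by (intro sum.reindex_cong[of "insert a"]) (auto simp: inj_on_def)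
  also have "\<dots> = (\<Sum>W\<in>Pow A. x * x ^ card W)"
    using insert by (intro sum.cong refl) (auto simp: card_insert_if finite_subset)
  finally have "(\<Sum>W\<in>insert a ` Pow A. x ^ card W) = x * (1 + x) ^ card A"
    using insert by (simp add: sum_distrib_left[symmetric])
  thus ?case using insert
    by (simp add: Pow_insert, subst sum.union_disjoint) (auto simp: algebra_simps)
qed simp

text \<open>Each subset gets the weight \<open>x ^ card W\<close>. A small set weighs at least
  \<open>x ^ D\<close> because \<open>x\<close> is at most 1, while the total weight factors over
  the elements of \<open>A\<close>.\<close>

lemma card_small_subsets:
  fixes x :: real
  assumes "finite A" "0 < x" "x \<le> 1"
  shows "real (card {W. W \<subseteq> A \<and> card W \<le> D}) * x ^ D \<le> (1 + x) ^ card A"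
proof -
  have "real (card {W. W \<subseteq> A \<and> card W \<le> D}) * x ^ D = (\<Sum>W\<in>{W. W \<subseteq> A \<and> card W \<le> D}. x ^ D)"
    by simp
  also have "\<dots> \<le> (\<Sum>W\<in>{W. W \<subseteq> A \<and> card W \<le> D}. x ^ card W)"
    using assms by (intro sum_mono power_decreasing) auto
  also have "\<dots> \<le> (\<Sum>W\<in>Pow A. x ^ card W)"
    using assms by (intro sum_mono2) auto
  finally show ?thesis using assms by (simp add: sum_power_card_Pow)
qed

text \<open>Greedy choice of the columns of a parity check matrix, as in the Gilbert-Varshamov
  bound: the next vector avoids all sums of at most \<open>D\<close> earlier ones, and these are too
  few to exhaust the \<open>2 ^ l\<close> vectors.\<close>

lemma ex_independent_sets:
  fixes t l D :: nat
  assumes "card {W. W \<subseteq> {..<t} \<and> card W \<le> D} < 2 ^ l"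
  shows "\<exists>a. (\<forall>v<t. a v \<subseteq> {..<l}) \<and>
     (\<forall>W. W \<subseteq> {..<t} \<longrightarrow> W \<noteq> {} \<longrightarrow> card W \<le> D \<longrightarrow> xorsum a W \<noteq> {})"
  using assms
proof (induction t)
  case 0
  show ?case by (intro exI[of _ "\<lambda>_. {}"]) auto
next
  case (Suc t)
  let ?S = "\<lambda>t. {W. W \<subseteq> {..<t} \<and> card W \<le> D}"
  have mono: "?S t \<subseteq> ?S (Suc t)" by (auto simp: lessThan_Suc)
  have fin: "finite (?S t)" for t :: nat by (rule finite_subset[of _ "Pow {..<t}"]) auto
  have lt: "card (?S t) < 2 ^ l"
    using card_mono[OF fin mono] Suc.prems by simp
  then obtain a where a: "\<And>v. v < t \<Longrightarrow> a v \<subseteq> {..<l}"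
    "\<And>W. W \<subseteq> {..<t} \<Longrightarrow> W \<noteq> {} \<Longrightarrow> card W \<le> D \<Longrightarrow> xorsum a W \<noteq> {}"
    using Suc.IH by blast
  have "card (xorsum a ` ?S t) < card (Pow {..<l})"
    using lt card_image_le[OF fin, of "xorsum a" t] by (simp add: card_Pow)
  hence "\<not> Pow {..<l} \<subseteq> xorsum a ` ?S t"
    using fin by (meson card_mono finite_imageI leD)
  then obtain b where b: "b \<subseteq> {..<l}" "b \<notin> xorsum a ` ?S t" by auto
  define a' where "a' = a(t := b)"
  have "xorsum a' W \<noteq> {}" if W: "W \<subseteq> {..<Suc t}" "W \<noteq> {}" "card W \<le> D" for W
  proof (cases "t \<in> W")
    case False
    hence "W \<subseteq> {..<t}" using W(1) by (auto simp: less_Suc_eq)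
    moreover have "xorsum a' W = xorsum a W"
      using False by (intro xorsum_cong) (auto simp: a'_def)
    ultimately show ?thesis using a(2) W by simp
  next
    case True
    define W0 where "W0 = W - {t}"
    have W0: "W0 \<subseteq> {..<t}" "t \<notin> W0" "finite W0" "W = insert t W0"
      using W(1) True finite_subset[OF W(1)] by (auto simp: W0_def less_Suc_eq)
    have "card W0 \<le> D" using W0 W(3) by simp
    hence "b \<noteq> xorsum a W0" using b(2) W0 by auto
    moreover have "xorsum a' W0 = xorsum a W0"
      using W0 by (intro xorsum_cong) (auto simp: a'_def)
    ultimately show ?thesis
      using W0 by (auto simp: xorsum_insert a'_def)
  qed
  moreover have "a' v \<subseteq> {..<l}" if "v < Suc t" for v
    using that a(1) b(1) by (auto simp: a'_def less_Suc_eq)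
  ultimately show ?case by blast
qed

text \<open>The Hamming balls of radius \<open>k\<close> around the members of \<open>\<P>\<close>
  are too small in total to cover the cube.\<close>

lemma ex_far_set:
  assumes "finite U" "finite \<P>" "\<And>P. P \<in> \<P> \<Longrightarrow> P \<subseteq> U"
    and "card \<P> * card {W. W \<subseteq> U \<and> card W \<le> k} < 2 ^ card U"
  shows "\<exists>c\<subseteq>U. \<forall>P\<in>\<P>. k < card (sym_diff c P)"
proof (rule ccontr)
  assume neg: "\<not> ?thesis"
  let ?B = "{W. W \<subseteq> U \<and> card W \<le> k}"
  have fin: "finite ?B" by (rule finite_subset[of _ "Pow U"]) (use assms in auto)
  have "Pow U \<subseteq> (\<lambda>(P, W). sym_diff P W) ` (\<P> \<times> ?B)"
  proof
    fix c assume c: "c \<in> Pow U"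
    then obtain P where P: "P \<in> \<P>" "card (sym_diff c P) \<le> k" using neg by (auto simp: not_less)
    have "sym_diff c P \<in> ?B" using c P assms(3)[OF P(1)] by auto
    moreover have "c = sym_diff P (sym_diff c P)" by auto
    ultimately show "c \<in> (\<lambda>(P, W). sym_diff P W) ` (\<P> \<times> ?B)"
      using P(1) by (intro image_eqI[of _ _ "(P, sym_diff c P)"]) auto
  qed
  hence "card (Pow U) \<le> card (\<P> \<times> ?B)"
    using assms(2) fin by (meson card_image_le card_mono finite_SigmaI finite_imageI le_trans)
  thus False using assms(1,4) by (simp add: card_Pow card_cartesian_product)
qed

section \<open>A system of parity constraints without good assignments\<close>

text \<open>Weight 1/16 per element: (17/16)^64 < 2^6 yields \<open>2 ^ (6 * r)\<close>, and
  dividing by \<open>(1 / 16) ^ r\<close> contributes \<open>2 ^ (4 * r)\<close>. This is the origin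
  of the label length \<open>10 * r\<close>.\<close>

lemma card_small_subsets_64:
  assumes "r > 0"
  shows "card {W. W \<subseteq> {..<64 * r} \<and> card W \<le> r} < 2 ^ (10 * r)"
proof -
  have num: "(17 / 16 :: real) ^ 64 < 2 ^ 6" by (simp add: power_divide)
  let ?N = "real (card {W. W \<subseteq> {..<64 * r} \<and> card W \<le> r})"
  have "?N * (1 / 16) ^ r \<le> (1 + 1 / 16) ^ (64 * r)"
    using card_small_subsets[of "{..<64 * r}" "1 / 16" r] by simp
  also have "\<dots> = ((17 / 16) ^ 64) ^ r" by (simp add: power_mult)
  also have "\<dots> < (2 ^ 6) ^ r"
    using num assms by (intro power_strict_mono) auto
  finally have lt: "?N * (1 / 16) ^ r < (2 ^ 6) ^ r" .
  have inv: "(1 / 16) ^ r * (2 ^ 4) ^ r = (1::real)"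
    unfolding power_mult_distrib[symmetric] by simp
  have "?N = ?N * ((1 / 16) ^ r * (2 ^ 4) ^ r)"
    unfolding inv by simp
  also have "\<dots> = ?N * (1 / 16) ^ r * (2 ^ 4) ^ r"
    by (rule mult.assoc[symmetric])
  also have "\<dots> < (2 ^ 6) ^ r * (2 ^ 4) ^ r"
    by (rule mult_strict_right_mono[OF lt]) simp
  also have "\<dots> = 2 ^ (6 * r + 4 * r)"
    unfolding power_mult[symmetric] power_add[symmetric] by (rule refl)
  also have "6 * r + 4 * r = 10 * r" by simp
  finally have "?N < real (2 ^ (10 * r))"
    unfolding of_nat_power of_nat_numeral .
  thus ?thesis unfolding of_nat_less_iff .
qed

text \<open>The same weight, now for a ball of relative radius 1/16 in the cube of right-hand sides:
  6 * 64 + 4 * 256 = 1408.\<close>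

lemma card_small_subsets_4096:
  assumes "finite U" "card U = 4096 * s"
  shows "card {W. W \<subseteq> U \<and> card W \<le> 256 * s} \<le> 2 ^ (1408 * s)"
proof -
  have num: "(17 / 16 :: real) ^ 64 < 2 ^ 6" by (simp add: power_divide)
  let ?N = "real (card {W. W \<subseteq> U \<and> card W \<le> 256 * s})"
  have "?N * (1 / 16) ^ (256 * s) \<le> (1 + 1 / 16) ^ (4096 * s)"
    using card_small_subsets[of U "1 / 16" "256 * s"] assms by simp
  also have "\<dots> = ((17 / 16) ^ 64) ^ (64 * s)" by (simp flip: power_mult)
  also have "\<dots> \<le> (2 ^ 6) ^ (64 * s)"
    using num by (intro power_mono) auto
  finally have le: "?N * (1 / 16) ^ (256 * s) \<le> (2 ^ 6) ^ (64 * s)" .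
  have inv: "(1 / 16) ^ (256 * s) * (2 ^ 4) ^ (256 * s) = (1::real)"
    unfolding power_mult_distrib[symmetric] by simp
  have "?N = ?N * ((1 / 16) ^ (256 * s) * (2 ^ 4) ^ (256 * s))"
    unfolding inv by simp
  also have "\<dots> = ?N * (1 / 16) ^ (256 * s) * (2 ^ 4) ^ (256 * s)"
    by (rule mult.assoc[symmetric])
  also have "\<dots> \<le> (2 ^ 6) ^ (64 * s) * (2 ^ 4) ^ (256 * s)"
    by (rule mult_right_mono[OF le]) simp
  also have "\<dots> = 2 ^ (6 * (64 * s) + 4 * (256 * s))"
    unfolding power_mult[symmetric] power_add[symmetric] by (rule refl)
  also have "6 * (64 * s) + 4 * (256 * s) = 1408 * s" by simp
  finally have "real (card {W. W \<subseteq> U \<and> card W \<le> 256 * s}) \<le> real (2 ^ (1408 * s))"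
    unfolding of_nat_power of_nat_numeral .
  thus ?thesis unfolding of_nat_le_iff .
qed

text \<open>The linear equation in multiplicative form, with signs in place of bits. The label of
  \<open>u\<close> is tested by \<open>a v\<close> and the label of \<open>v\<close> by
  \<open>a u\<close>, so exchanging the players amounts to transposing \<open>c\<close>.\<close>

definition mismatch :: "(nat \<Rightarrow> nat set) \<Rightarrow> (nat \<Rightarrow> nat \<Rightarrow> real) \<Rightarrow> nat \<Rightarrow> nat set \<Rightarrow> nat \<Rightarrow> nat set \<Rightarrow> bool" where
  "mismatch a c u \<alpha> v \<beta> \<longleftrightarrow> chi (a v) \<alpha> * chi (a u) \<beta> \<noteq> c u v"

lemma chi_cong: "(\<And>b. b \<in> A \<Longrightarrow> b \<in> z \<longleftrightarrow> b \<in> z') \<Longrightarrow> chi A z = chi A z'"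
  unfolding chi_def by (intro prod.cong) auto

text \<open>A pair of pure strategies has only 2 * 64 * 10 * r^2 = 1280 * r^2 relevant bits against
  4096 * r^2 equations. Balls of radius 256 * r^2 add 1408 * r^2 to the exponent, and 1280 + 1408 <
  4096.\<close>

lemma ex_unsatisfiable_constraints:
  assumes r: "r > 0"
  shows "\<exists>a c. (\<forall>v<64 * r. a v \<subseteq> {..<10 * r}) \<and>
     (\<forall>W. W \<subseteq> {..<64 * r} \<longrightarrow> W \<noteq> {} \<longrightarrow> card W \<le> r \<longrightarrow> xorsum a W \<noteq> {}) \<and>
     (\<forall>u v. c u v = 1 \<or> c u v = (-1::real)) \<and>
     (\<forall>F G. 256 * r\<^sup>2 \<le> card {(u, v). u < 64 * r \<and> v < 64 * r \<and> mismatch a c u (F u) v (G v)})"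
proof -
  define t l where "t = 64 * r" and "l = 10 * r"
  obtain a where a: "\<And>v. v < t \<Longrightarrow> a v \<subseteq> {..<l}"
    "\<And>W. W \<subseteq> {..<t} \<Longrightarrow> W \<noteq> {} \<Longrightarrow> card W \<le> r \<Longrightarrow> xorsum a W \<noteq> {}"
    using ex_independent_sets[OF card_small_subsets_64[OF r]] by (auto simp: t_def l_def)
  define Z where "Z = {..<2 * t} \<times> {..<l}"
  define U where "U = {..<t} \<times> {..<t}"
  define P where "P z = {(u, v)\<in>U. chi (a v) (z `` {u}) * chi (a u) (z `` {t + v}) = -1}" for z :: "(nat \<times> nat) set"
  have U: "finite U" "card U = 4096 * r\<^sup>2"
    by (simp_all add: U_def t_def card_cartesian_product power2_eq_square)
  have "card (P ` Pow Z) \<le> 2 ^ card Z"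
    using card_image_le[of "Pow Z" P] by (simp add: card_Pow Z_def)
  also have "card Z = 1280 * r\<^sup>2"
    by (simp add: Z_def t_def l_def card_cartesian_product power2_eq_square)
  finally have "card (P ` Pow Z) * card {W. W \<subseteq> U \<and> card W \<le> 256 * r\<^sup>2} \<le> 2 ^ (1280 * r\<^sup>2) * 2 ^ (1408 * r\<^sup>2)"
    using card_small_subsets_4096[OF U] by (intro mult_le_mono) auto
  also have "\<dots> = 2 ^ (2688 * r\<^sup>2)"
    by (simp only: power_add[symmetric]) simp
  also have "\<dots> < 2 ^ card U"
    unfolding U using r by (intro power_strict_increasing) auto
  finally have "\<exists>c0\<subseteq>U. \<forall>X\<in>P ` Pow Z. 256 * r\<^sup>2 < card (sym_diff c0 X)"
    by (intro ex_far_set) (auto simp: U Z_def P_def)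
  then obtain c0 where c0: "c0 \<subseteq> U" "\<And>z. z \<subseteq> Z \<Longrightarrow> 256 * r\<^sup>2 < card (sym_diff c0 (P z))" by blast
  define c where "c u v = (if (u, v) \<in> c0 then -1 else 1 :: real)" for u v
  have "256 * r\<^sup>2 \<le> card {(u, v). u < t \<and> v < t \<and> mismatch a c u (F u) v (G v)}" for F G
  proof -
    \<comment> \<open>\<open>F\<close> and \<open>G\<close> may return arbitrary sets, but the
      characters read only the bits below \<open>l\<close>; clipping maps every pair of strategies
      to one of the finitely many \<open>z\<close>.\<close>
    define z where "z = {(u, b). u < t \<and> b < l \<and> b \<in> F u} \<union> {(i, b). t \<le> i \<and> i < 2 * t \<and> b < l \<and> b \<in> G (i - t)}"
    have z: "z \<subseteq> Z" by (auto simp: z_def Z_def)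
    have F: "chi (a v) (z `` {u}) = chi (a v) (F u)" if "u < t" "v < t" for u v
      using that a(1)[of v] by (intro chi_cong) (auto simp: z_def)
    have G: "chi (a v) (z `` {t + u}) = chi (a v) (G u)" if "u < t" "v < t" for u v
      using that a(1)[of v] by (intro chi_cong) (auto simp: z_def)
    have "(u, v) \<in> sym_diff c0 (P z) \<longleftrightarrow> u < t \<and> v < t \<and> mismatch a c u (F u) v (G v)" for u v
    proof (cases "u < t \<and> v < t")
      case True
      have "chi (a v) (F u) * chi (a u) (G v) = 1 \<or> chi (a v) (F u) * chi (a u) (G v) = -1"
        using chi_cases[of "a v" "F u"] chi_cases[of "a u" "G v"] by auto
      thus ?thesis using True by (auto simp: P_def U_def mismatch_def c_def F G)
    next
      case False
      thus ?thesis using c0(1) by (auto simp: P_def U_def)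
    qed
    hence "sym_diff c0 (P z) = {(u, v). u < t \<and> v < t \<and> mismatch a c u (F u) v (G v)}" by auto
    thus ?thesis using c0(2)[OF z] by simp
  qed
  hence "\<forall>F G. 256 * r\<^sup>2 \<le> card {(u, v). u < t \<and> v < t \<and> mismatch a c u (F u) v (G v)}" by blast
  moreover have "\<forall>u v. c u v = 1 \<or> c u v = -1" by (simp add: c_def)
  moreover have "\<forall>v<t. a v \<subseteq> {..<l}" "\<forall>W. W \<subseteq> {..<t} \<longrightarrow> W \<noteq> {} \<longrightarrow> card W \<le> r \<longrightarrow> xorsum a W \<noteq> {}"
    using a by simp_all
  ultimately show ?thesis unfolding t_def[symmetric] l_def[symmetric]
    by (intro exI[of _ a] exI[of _ c] conjI)
qed

section \<open>A pseudo-distribution on the solutions of the parity constraints\<close>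

text \<open>\<open>\<sigma> i j \<noteq> 0\<close> is an equivalence relation with class sizes
  \<open>n\<close>. Within a class the values multiply along paths, so after division by the class
  size the kernel factors through itself, and the form becomes a weighted sum of squares.\<close>

lemma partial_character_psd:
  fixes \<sigma> :: "'i \<Rightarrow> 'i \<Rightarrow> real"
  assumes fin: "finite I" and sym: "\<And>i j. i \<in> I \<Longrightarrow> j \<in> I \<Longrightarrow> \<sigma> i j = \<sigma> j i"
    and diag: "\<And>i. i \<in> I \<Longrightarrow> \<sigma> i i = 1"
    and trans: "\<And>i j k. i \<in> I \<Longrightarrow> j \<in> I \<Longrightarrow> k \<in> I \<Longrightarrow> \<sigma> i j \<noteq> 0 \<Longrightarrow> \<sigma> j k \<noteq> 0 \<Longrightarrow> \<sigma> i k = \<sigma> i j * \<sigma> j k"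
  shows "(\<Sum>i\<in>I. \<Sum>k\<in>I. q i * q k * \<sigma> i k) \<ge> 0"
proof -
  define n where "n i = real (card {j\<in>I. \<sigma> i j \<noteq> 0})" for i
  have n_pos: "n i > 0" if "i \<in> I" for i
    using that fin diag[OF that] by (auto simp: n_def card_gt_0_iff)
  have n_eq: "n i = n j" if "i \<in> I" "j \<in> I" "\<sigma> i j \<noteq> 0" for i j
  proof -
    have "\<sigma> i k \<noteq> 0 \<longleftrightarrow> \<sigma> j k \<noteq> 0" if "k \<in> I" for k
      using trans[of i j k] trans[of j i k] sym[of i j] that \<open>i \<in> I\<close> \<open>j \<in> I\<close> \<open>\<sigma> i j \<noteq> 0\<close>
      by (metis mult_eq_0_iff)
    hence "{k\<in>I. \<sigma> i k \<noteq> 0} = {k\<in>I. \<sigma> j k \<noteq> 0}" by blast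
    thus ?thesis by (simp add: n_def)
  qed
  have gram: "\<sigma> i k = (\<Sum>j\<in>I. \<sigma> i j * \<sigma> j k / n j)" if i: "i \<in> I" and k: "k \<in> I" for i k
  proof -
    have "(\<Sum>j\<in>I. \<sigma> i j * \<sigma> j k / n j) = (\<Sum>j\<in>I. if \<sigma> i j \<noteq> 0 then \<sigma> i k / n i else 0)"
    proof (intro sum.cong refl)
      fix j assume j: "j \<in> I"
      show "\<sigma> i j * \<sigma> j k / n j = (if \<sigma> i j \<noteq> 0 then \<sigma> i k / n i else 0)"
      proof (cases "\<sigma> i j \<noteq> 0 \<and> \<sigma> j k \<noteq> 0")
        case True
        thus ?thesis using trans[OF i j k] n_eq[OF i j] by simp
      next
        case False
        moreover have "\<sigma> i k = 0" if "\<sigma> i j \<noteq> 0" "\<sigma> j k = 0"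
          using trans[OF j i k] sym[OF i j] that by auto
        ultimately show ?thesis by auto
      qed
    qed
    also have "\<dots> = n i * (\<sigma> i k / n i)"
      using fin by (simp add: sum.If_cases n_def Int_def)
    finally show ?thesis using n_pos[OF i] by simp
  qed
  have "(\<Sum>i\<in>I. \<Sum>k\<in>I. q i * q k * \<sigma> i k) = (\<Sum>i\<in>I. \<Sum>k\<in>I. \<Sum>j\<in>I. (q i * \<sigma> i j) * (q k * \<sigma> j k) / n j)"
    by (intro sum.cong refl, subst gram) (auto simp: sum_distrib_left mult_ac)
  also have "\<dots> = (\<Sum>i\<in>I. \<Sum>j\<in>I. \<Sum>k\<in>I. (q i * \<sigma> i j) * (q k * \<sigma> j k) / n j)"
    by (intro sum.cong refl sum.swap)
  also have "\<dots> = (\<Sum>j\<in>I. \<Sum>i\<in>I. \<Sum>k\<in>I. (q i * \<sigma> i j) * (q k * \<sigma> j k) / n j)"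
    by (rule sum.swap)
  also have "\<dots> = (\<Sum>j\<in>I. (\<Sum>i\<in>I. q i * \<sigma> i j)\<^sup>2 / n j)"
    by (intro sum.cong refl)
      (simp add: power2_eq_square sum_product sum_divide_distrib sym)
  also have "\<dots> \<ge> 0"
    by (intro sum_nonneg divide_nonneg_nonneg) (auto simp: n_def)
  finally show ?thesis .
qed

locale xor_game =
  fixes t l D K :: nat and a :: "nat \<Rightarrow> nat set" and c :: "nat \<Rightarrow> nat \<Rightarrow> real"
  assumes t_pos: "t > 0"
    and a_sub: "\<And>v. v < t \<Longrightarrow> a v \<subseteq> {..<l}"
    and indep: "\<And>W. W \<subseteq> {..<t} \<Longrightarrow> W \<noteq> {} \<Longrightarrow> card W \<le> D \<Longrightarrow> xorsum a W \<noteq> {}"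
    and c_cases: "\<And>u v. c u v = 1 \<or> c u v = -1"
    and K_pos: "K \<ge> 1" and K_D: "2 * K \<le> D"
begin

text \<open>The labels of both players form one set of pairs: index \<open>u < t\<close> is question \<open>u\<close> to the
  row player, index \<open>t + v\<close> is question \<open>v\<close> to the column player.\<close>

definition Z :: "(nat \<times> nat) set" where "Z = {..<2 * t} \<times> {..<l}"

definition V :: "nat \<times> nat \<Rightarrow> (nat \<times> nat) set" where
  "V = (\<lambda>(u, v). {u} \<times> a v \<union> {t + v} \<times> a u)"

definition rhs :: "(nat \<times> nat) set \<Rightarrow> real" where "rhs E = (\<Prod>(u, v)\<in>E. c u v)"

text \<open>Size is counted in questions of each player, not in equations: a low-degree function
  reads few labels, but each of them completely.\<close>

definition small_sets :: "(nat \<times> nat) set set" where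
  "small_sets = {E. E \<subseteq> {..<t} \<times> {..<t} \<and> card (fst ` E) \<le> K \<and> card (snd ` E) \<le> K}"

text \<open>Fourier inversion: the signed density for which \<open>xorsum V E\<close> has
  expectation \<open>rhs E\<close> when \<open>E\<close> is small, and all other characters have
  expectation 0.\<close>

definition weight :: "(nat \<times> nat) set \<Rightarrow> real" where
  "weight z = (\<Sum>E\<in>small_sets. rhs E * chi (xorsum V E) z) / 2 ^ card Z"

definition PE :: "((nat \<times> nat) set \<Rightarrow> real) \<Rightarrow> real" where
  "PE h = (\<Sum>z\<in>Pow Z. weight z * h z)"

lemma finite_Z [simp]: "finite Z" by (simp add: Z_def)

lemma finite_subset_Z: "\<xi> \<subseteq> Z \<Longrightarrow> finite \<xi>"
  using finite_Z by (rule finite_subset[rotated])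

lemma finite_constraints: "E \<subseteq> {..<t} \<times> {..<t} \<Longrightarrow> finite E"
  by (rule finite_subset) auto

lemma finite_small_sets [simp]: "finite small_sets"
  by (rule finite_subset[of _ "Pow ({..<t} \<times> {..<t})"]) (auto simp: small_sets_def)

lemma V_subset: "e \<in> {..<t} \<times> {..<t} \<Longrightarrow> V e \<subseteq> Z"
  using a_sub by (auto simp: V_def Z_def)

lemma xorsum_V_subset: "E \<subseteq> {..<t} \<times> {..<t} \<Longrightarrow> xorsum V E \<subseteq> Z"
  using xorsum_subset_UN[of V E] V_subset by blast

lemma PE_cong: "(\<And>z. z \<subseteq> Z \<Longrightarrow> h z = g z) \<Longrightarrow> PE h = PE g"
  unfolding PE_def by (intro sum.cong) auto

lemma PE_add: "PE (\<lambda>z. h z + g z) = PE h + PE g"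
  by (simp add: PE_def distrib_left sum.distrib)

lemma PE_scale: "PE (\<lambda>z. k * h z) = k * PE h"
  by (simp add: PE_def sum_distrib_left mult_ac)

lemma PE_sum: "PE (\<lambda>z. \<Sum>i\<in>S. h i z) = (\<Sum>i\<in>S. PE (h i))"
  unfolding PE_def by (simp add: sum_distrib_left) (rule sum.swap)

lemma rhs_cases: "rhs E = 1 \<or> rhs E = -1"
  unfolding rhs_def
proof (induction E rule: infinite_finite_induct)
  case (insert e E)
  thus ?case using c_cases[of "fst e" "snd e"] by (auto simp: case_prod_beta)
qed auto

lemma rhs_sym_diff:
  assumes "finite E" "finite E'"
  shows "rhs (sym_diff E E') = rhs E * rhs E'"
proof -
  have split: "rhs A = rhs (A - B) * rhs (A \<inter> B)" if "finite A" for A B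
    unfolding rhs_def using that by (subst prod.union_disjoint[symmetric]) (auto simp: Un_Diff_Int)
  have "rhs (sym_diff E E') = rhs (E - E') * rhs (E' - E)"
    unfolding rhs_def using assms by (intro prod.union_disjoint) auto
  moreover have "rhs E = rhs (E - E') * rhs (E \<inter> E')" "rhs E' = rhs (E' - E) * rhs (E \<inter> E')"
    using split[of E E'] split[of E' E] assms by (auto simp: Int_commute)
  moreover have "rhs (E \<inter> E') * rhs (E \<inter> E') = 1"
    using rhs_cases[of "E \<inter> E'"] by auto
  ultimately show ?thesis by (simp add: mult_ac)
qed

lemma PE_chi:
  assumes "\<xi> \<subseteq> Z"
  shows "PE (chi \<xi>) = (\<Sum>E\<in>small_sets. if xorsum V E = \<xi> then rhs E else 0)"
proof -
  have "PE (chi \<xi>) = (\<Sum>z\<in>Pow Z. \<Sum>E\<in>small_sets. rhs E * (chi (xorsum V E) z * chi \<xi> z) / 2 ^ card Z)"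
    by (simp add: PE_def weight_def sum_divide_distrib sum_distrib_right sum_distrib_left mult_ac)
  also have "\<dots> = (\<Sum>E\<in>small_sets. \<Sum>z\<in>Pow Z. rhs E * (chi (xorsum V E) z * chi \<xi> z) / 2 ^ card Z)"
    by (rule sum.swap)
  also have "\<dots> = (\<Sum>E\<in>small_sets. if xorsum V E = \<xi> then rhs E else 0)"
  proof (intro sum.cong refl)
    fix E assume "E \<in> small_sets"
    hence sub: "xorsum V E \<subseteq> Z" by (intro xorsum_V_subset) (auto simp: small_sets_def)
    have "(\<Sum>z\<in>Pow Z. rhs E * (chi (xorsum V E) z * chi \<xi> z) / 2 ^ card Z)
        = rhs E / 2 ^ card Z * (\<Sum>z\<in>Pow Z. chi (sym_diff (xorsum V E) \<xi>) z)"
      using sub assms by (simp add: chi_sym_diff finite_subset_Z sum_distrib_left)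
    also have "(\<Sum>z\<in>Pow Z. chi (sym_diff (xorsum V E) \<xi>) z) = (if xorsum V E = \<xi> then 2 ^ card Z else 0)"
      using sub assms by (subst sum_chi) auto
    finally show "(\<Sum>z\<in>Pow Z. rhs E * (chi (xorsum V E) z * chi \<xi> z) / 2 ^ card Z)
        = (if xorsum V E = \<xi> then rhs E else 0)"
      by simp
  qed
  finally show ?thesis .
qed

text \<open>In its equation with \<open>v\<close>, the row question \<open>u\<close> meets
  \<open>a v\<close>; what \<open>E\<close> leaves on the label of \<open>u\<close> is therefore the
  sum of \<open>a\<close> over the partners of \<open>u\<close>.\<close>

lemma xorsum_V_row:
  assumes E: "E \<subseteq> {..<t} \<times> {..<t}" and "u < t"
  shows "xorsum V E `` {u} = xorsum a (E `` {u})"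
proof -
  have "{e\<in>E. (u, b) \<in> V e} = Pair u ` {v\<in>E `` {u}. b \<in> a v}" for b
    using assms by (auto simp: V_def)
  hence "card {e\<in>E. (u, b) \<in> V e} = card {v\<in>E `` {u}. b \<in> a v}" for b
    by (simp add: card_image inj_on_def del: Image_singleton_iff)
  thus ?thesis by (auto simp: xorsum_def)
qed

lemma xorsum_V_column:
  assumes E: "E \<subseteq> {..<t} \<times> {..<t}" and "v < t"
  shows "xorsum V E `` {t + v} = xorsum a (E\<inverse> `` {v})"
proof -
  have "{e\<in>E. (t + v, b) \<in> V e} = (\<lambda>u. (u, v)) ` {u\<in>E\<inverse> `` {v}. b \<in> a u}" for b
    using assms by (auto simp: V_def)
  hence "card {e\<in>E. (t + v, b) \<in> V e} = card {u\<in>E\<inverse> `` {v}. b \<in> a u}" for b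
    by (simp add: card_image inj_on_def)
  thus ?thesis by (auto simp: xorsum_def)
qed

text \<open>No touched question cancels: it has between 1 and \<open>D\<close> partners, and the sum
  of \<open>a\<close> over them is nonzero by independence. The bound on one player's questions thus
  protects the questions of the other.\<close>

lemma support_xorsum_V:
  assumes E: "E \<subseteq> {..<t} \<times> {..<t}" and "card (fst ` E) \<le> D" "card (snd ` E) \<le> D"
  shows "fst ` E \<subseteq> fst ` xorsum V E" "(\<lambda>v. t + v) ` snd ` E \<subseteq> fst ` xorsum V E"
proof -
  have fin: "finite E" using E by (rule finite_constraints)
  show "fst ` E \<subseteq> fst ` xorsum V E"
  proof
    fix u assume u: "u \<in> fst ` E"
    have "E `` {u} \<subseteq> snd ` E" by force
    hence "card (E `` {u}) \<le> D" using fin assms(3) by (meson card_mono finite_imageI le_trans)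
    moreover have "E `` {u} \<subseteq> {..<t}" "E `` {u} \<noteq> {}" "u < t" using E u by auto
    ultimately have "xorsum V E `` {u} \<noteq> {}"
      using indep xorsum_V_row[OF E] by simp
    thus "u \<in> fst ` xorsum V E" by force
  qed
  show "(\<lambda>v. t + v) ` snd ` E \<subseteq> fst ` xorsum V E"
  proof
    fix i assume "i \<in> (\<lambda>v. t + v) ` snd ` E"
    then obtain v where v: "v \<in> snd ` E" "i = t + v" by auto
    have "E\<inverse> `` {v} \<subseteq> fst ` E" by force
    hence "card (E\<inverse> `` {v}) \<le> D" using fin assms(2) by (meson card_mono finite_imageI le_trans)
    moreover have "E\<inverse> `` {v} \<subseteq> {..<t}" "E\<inverse> `` {v} \<noteq> {}" "v < t" using E v by auto
    ultimately have "xorsum V E `` {t + v} \<noteq> {}"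
      using indep xorsum_V_column[OF E] by simp
    thus "i \<in> fst ` xorsum V E" using v by force
  qed
qed

lemma card_support_xorsum_V:
  assumes E: "E \<subseteq> {..<t} \<times> {..<t}" and "card (fst ` E) \<le> D" "card (snd ` E) \<le> D"
  shows "card (fst ` E) \<le> card (fst ` xorsum V E)" "card (snd ` E) \<le> card (fst ` xorsum V E)"
proof -
  have fin: "finite (fst ` xorsum V E)"
    using finite_subset_Z[OF xorsum_V_subset[OF E]] by simp
  show "card (fst ` E) \<le> card (fst ` xorsum V E)"
    using support_xorsum_V(1)[OF assms] fin by (rule card_mono[rotated])
  have "card (snd ` E) = card ((\<lambda>v. t + v) ` snd ` E)" by (simp add: card_image)
  also have "\<dots> \<le> card (fst ` xorsum V E)"
    using support_xorsum_V(2)[OF assms] fin by (rule card_mono[rotated])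
  finally show "card (snd ` E) \<le> card (fst ` xorsum V E)" .
qed

lemma sym_diff_small_sets:
  assumes "E \<in> small_sets" "E' \<in> small_sets"
  shows "sym_diff E E' \<subseteq> {..<t} \<times> {..<t}"
    "card (fst ` sym_diff E E') \<le> D" "card (snd ` sym_diff E E') \<le> D"
proof -
  have fin: "finite E" "finite E'"
    using assms finite_constraints by (auto simp: small_sets_def)
  have *: "card (f ` sym_diff E E') \<le> D" if "card (f ` E) \<le> K" "card (f ` E') \<le> K" for f :: "nat \<times> nat \<Rightarrow> nat"
  proof -
    have "card (f ` sym_diff E E') \<le> card (f ` E \<union> f ` E')"
      using fin by (intro card_mono) auto
    also have "\<dots> \<le> card (f ` E) + card (f ` E')" by (rule card_Un_le)
    finally show ?thesis using that K_D by simp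
  qed
  show "sym_diff E E' \<subseteq> {..<t} \<times> {..<t}"
    "card (fst ` sym_diff E E') \<le> D" "card (snd ` sym_diff E E') \<le> D"
    using assms * by (auto simp: small_sets_def)
qed

text \<open>Equal sums leave nothing of the symmetric difference, so it touches no question at
  all.\<close>

lemma xorsum_V_inj:
  assumes "E \<in> small_sets" "E' \<in> small_sets" "xorsum V E = xorsum V E'"
  shows "E = E'"
proof -
  have "finite E" "finite E'" using assms finite_constraints by (auto simp: small_sets_def)
  hence "xorsum V (sym_diff E E') = {}" using assms(3) by (simp add: xorsum_sym_diff)
  hence "fst ` sym_diff E E' = {}"
    using support_xorsum_V(1)[OF sym_diff_small_sets[OF assms(1,2)]] by simp
  thus ?thesis by auto
qed

lemma PE_chi_xorsum:
  assumes "E \<in> small_sets"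
  shows "PE (chi (xorsum V E)) = rhs E"
proof -
  have "xorsum V E \<subseteq> Z" using assms by (intro xorsum_V_subset) (auto simp: small_sets_def)
  hence "PE (chi (xorsum V E)) = (\<Sum>E'\<in>small_sets. if xorsum V E' = xorsum V E then rhs E' else 0)"
    by (rule PE_chi)
  also have "\<dots> = (\<Sum>E'\<in>small_sets. if E' = E then rhs E' else 0)"
    using assms xorsum_V_inj by (intro sum.cong) auto
  finally show ?thesis using assms by simp
qed

lemma PE_chi_nonzeroD:
  assumes "\<xi> \<subseteq> Z" "PE (chi \<xi>) \<noteq> 0"
  obtains E where "E \<in> small_sets" "\<xi> = xorsum V E"
proof -
  have "\<exists>E\<in>small_sets. xorsum V E = \<xi>"
  proof (rule ccontr)
    assume "\<not> ?thesis"
    hence "PE (chi \<xi>) = 0" unfolding PE_chi[OF assms(1)] by (intro sum.neutral) auto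
    thus False using assms(2) by simp
  qed
  thus ?thesis using that by blast
qed

text \<open>The symmetric difference of two small sets may touch \<open>2 * K\<close> questions per
  player. That is still within the range of independence, so it touches no more questions than
  survive in \<open>sym_diff \<xi> \<eta>\<close>, and is small again.\<close>

lemma PE_chi_mult:
  assumes "\<xi> \<subseteq> Z" "\<eta> \<subseteq> Z" "PE (chi \<xi>) \<noteq> 0" "PE (chi \<eta>) \<noteq> 0" "card (fst ` sym_diff \<xi> \<eta>) \<le> K"
  shows "PE (chi (sym_diff \<xi> \<eta>)) = PE (chi \<xi>) * PE (chi \<eta>)"
proof -
  obtain E where E: "E \<in> small_sets" "\<xi> = xorsum V E" using PE_chi_nonzeroD assms(1,3) by blast
  obtain E' where E': "E' \<in> small_sets" "\<eta> = xorsum V E'" using PE_chi_nonzeroD assms(2,4) by blast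
  have fin: "finite E" "finite E'"
    using E E' finite_constraints by (auto simp: small_sets_def)
  have eq: "sym_diff \<xi> \<eta> = xorsum V (sym_diff E E')"
    using fin E E' by (simp add: xorsum_sym_diff)
  have "sym_diff E E' \<in> small_sets"
    using sym_diff_small_sets[OF E(1) E'(1)] card_support_xorsum_V[OF sym_diff_small_sets[OF E(1) E'(1)]]
      assms(5) unfolding small_sets_def eq by auto
  hence "PE (chi (sym_diff \<xi> \<eta>)) = rhs (sym_diff E E')" unfolding eq by (rule PE_chi_xorsum)
  thus ?thesis using E E' fin by (simp add: PE_chi_xorsum rhs_sym_diff)
qed

lemma PE_chi_empty: "PE (chi {}) = 1"
  using PE_chi_xorsum[of "{}"] by (simp add: small_sets_def rhs_def)

lemma PE_1: "PE (\<lambda>_. 1) = 1"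
  using PE_chi_empty by (simp add: PE_def)

section \<open>Functions that read few labels\<close>

definition low_chars :: "nat \<Rightarrow> (nat \<times> nat) set set" where
  "low_chars e = {\<xi>. \<xi> \<subseteq> Z \<and> card (fst ` \<xi>) \<le> e}"

text \<open>Degree counted in labels: a character may read any number of bits of each of its at most
  \<open>e\<close> labels. Hence one coordinate of a strategy vector has degree 1 although it
  depends on all bits of a label.\<close>

definition lowdeg :: "nat \<Rightarrow> ((nat \<times> nat) set \<Rightarrow> real) \<Rightarrow> bool" where
  "lowdeg e h \<longleftrightarrow> (\<exists>q. \<forall>z. z \<subseteq> Z \<longrightarrow> h z = (\<Sum>\<xi>\<in>low_chars e. q \<xi> * chi \<xi> z))"

lemma finite_low_chars [simp]: "finite (low_chars e)"
  by (rule finite_subset[of _ "Pow Z"]) (auto simp: low_chars_def)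

lemma lowdeg_cong: "lowdeg e h \<Longrightarrow> (\<And>z. z \<subseteq> Z \<Longrightarrow> h z = g z) \<Longrightarrow> lowdeg e g"
  unfolding lowdeg_def by metis

lemma lowdeg_chi: "\<xi> \<subseteq> Z \<Longrightarrow> card (fst ` \<xi>) \<le> e \<Longrightarrow> lowdeg e (chi \<xi>)"
  unfolding lowdeg_def
  by (intro exI[of _ "\<lambda>\<eta>. if \<eta> = \<xi> then 1 else 0"])
    (auto simp: low_chars_def if_distrib[where f = "\<lambda>x. x * _"] finite_low_chars[unfolded low_chars_def]
      cong: if_cong)

lemma lowdeg_add: "lowdeg e h \<Longrightarrow> lowdeg e g \<Longrightarrow> lowdeg e (\<lambda>z. h z + g z)"
  unfolding lowdeg_def
proof (elim exE)
  fix p q assume "\<forall>z. z \<subseteq> Z \<longrightarrow> h z = (\<Sum>\<xi>\<in>low_chars e. p \<xi> * chi \<xi> z)"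
    "\<forall>z. z \<subseteq> Z \<longrightarrow> g z = (\<Sum>\<xi>\<in>low_chars e. q \<xi> * chi \<xi> z)"
  thus "\<exists>q. \<forall>z. z \<subseteq> Z \<longrightarrow> h z + g z = (\<Sum>\<xi>\<in>low_chars e. q \<xi> * chi \<xi> z)"
    by (intro exI[of _ "\<lambda>\<xi>. p \<xi> + q \<xi>"]) (auto simp: distrib_right sum.distrib)
qed

lemma lowdeg_scale: "lowdeg e h \<Longrightarrow> lowdeg e (\<lambda>z. k * h z)"
  unfolding lowdeg_def
proof (elim exE)
  fix q assume "\<forall>z. z \<subseteq> Z \<longrightarrow> h z = (\<Sum>\<xi>\<in>low_chars e. q \<xi> * chi \<xi> z)"
  thus "\<exists>q. \<forall>z. z \<subseteq> Z \<longrightarrow> k * h z = (\<Sum>\<xi>\<in>low_chars e. q \<xi> * chi \<xi> z)"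
    by (intro exI[of _ "\<lambda>\<xi>. k * q \<xi>"]) (auto simp: sum_distrib_left mult_ac)
qed

lemma lowdeg_const: "lowdeg e (\<lambda>_. k)"
  using lowdeg_scale[OF lowdeg_chi[of "{}" e], of k] by simp

lemma lowdeg_sum: "(\<And>i. i \<in> S \<Longrightarrow> lowdeg e (h i)) \<Longrightarrow> lowdeg e (\<lambda>z. \<Sum>i\<in>S. h i z)"
  by (induction S rule: infinite_finite_induct) (auto intro: lowdeg_const lowdeg_add)

lemma card_support_sym_diff:
  assumes "\<xi> \<subseteq> Z" "\<eta> \<subseteq> Z"
  shows "card (fst ` sym_diff \<xi> \<eta>) \<le> card (fst ` \<xi>) + card (fst ` \<eta>)"
proof -
  have "card (fst ` sym_diff \<xi> \<eta>) \<le> card (fst ` \<xi> \<union> fst ` \<eta>)"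
    using assms[THEN finite_subset_Z] by (intro card_mono) auto
  also have "\<dots> \<le> card (fst ` \<xi>) + card (fst ` \<eta>)" by (rule card_Un_le)
  finally show ?thesis .
qed

lemma lowdeg_mult:
  assumes "lowdeg e h" "lowdeg e' g"
  shows "lowdeg (e + e') (\<lambda>z. h z * g z)"
proof -
  obtain p where p: "\<And>z. z \<subseteq> Z \<Longrightarrow> h z = (\<Sum>\<xi>\<in>low_chars e. p \<xi> * chi \<xi> z)"
    using assms(1) by (auto simp: lowdeg_def)
  obtain q where q: "\<And>z. z \<subseteq> Z \<Longrightarrow> g z = (\<Sum>\<xi>\<in>low_chars e'. q \<xi> * chi \<xi> z)"
    using assms(2) by (auto simp: lowdeg_def)
  have "lowdeg (e + e') (\<lambda>z. \<Sum>\<xi>\<in>low_chars e. \<Sum>\<eta>\<in>low_chars e'. p \<xi> * q \<eta> * chi (sym_diff \<xi> \<eta>) z)"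
  proof (intro lowdeg_sum lowdeg_scale lowdeg_chi)
    fix \<xi> \<eta> assume "\<xi> \<in> low_chars e" "\<eta> \<in> low_chars e'"
    thus "sym_diff \<xi> \<eta> \<subseteq> Z" "card (fst ` sym_diff \<xi> \<eta>) \<le> e + e'"
      using card_support_sym_diff[of \<xi> \<eta>] by (auto simp: low_chars_def)
  qed
  thus ?thesis
  proof (rule lowdeg_cong)
    fix z assume z: "z \<subseteq> Z"
    have "h z * g z = (\<Sum>\<xi>\<in>low_chars e. \<Sum>\<eta>\<in>low_chars e'. (p \<xi> * chi \<xi> z) * (q \<eta> * chi \<eta> z))"
      by (simp add: p[OF z] q[OF z] sum_product)
    also have "\<dots> = (\<Sum>\<xi>\<in>low_chars e. \<Sum>\<eta>\<in>low_chars e'. p \<xi> * q \<eta> * chi (sym_diff \<xi> \<eta>) z)"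
      by (intro sum.cong refl, subst chi_sym_diff)
        (auto simp: low_chars_def finite_subset_Z)
    finally show "(\<Sum>\<xi>\<in>low_chars e. \<Sum>\<eta>\<in>low_chars e'. p \<xi> * q \<eta> * chi (sym_diff \<xi> \<eta>) z) = h z * g z" ..
  qed
qed

lemma lowdeg_mono: "lowdeg e h \<Longrightarrow> e \<le> e' \<Longrightarrow> lowdeg e' h"
  using lowdeg_mult[of e h "e' - e" "\<lambda>_. 1"] lowdeg_const by simp

lemma lowdeg_power: "lowdeg e h \<Longrightarrow> lowdeg (k * e) (\<lambda>z. h z ^ k)"
proof (induction k)
  case 0
  show ?case by (simp add: lowdeg_const)
next
  case (Suc k)
  thus ?case using lowdeg_mult[of e h "k * e" "\<lambda>z. h z ^ k"] by simp
qed

lemma lowdeg_prod: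
  "finite S \<Longrightarrow> (\<And>i. i \<in> S \<Longrightarrow> lowdeg (e i) (h i)) \<Longrightarrow> lowdeg (\<Sum>i\<in>S. e i) (\<lambda>z. \<Prod>i\<in>S. h i z)"
proof (induction S rule: finite_induct)
  case empty
  show ?case by (simp add: lowdeg_const)
next
  case (insert i S)
  thus ?case using lowdeg_mult[of "e i" "h i" "sum e S" "\<lambda>z. \<Prod>i\<in>S. h i z"] by simp
qed

text \<open>Fourier expansion of a point mass on one label; all its characters live on the single
  index \<open>i\<close>.\<close>

lemma lowdeg_indicator:
  assumes i: "i < 2 * t" and \<alpha>: "\<alpha> \<subseteq> {..<l}"
  shows "lowdeg 1 (\<lambda>z. if z `` {i} = \<alpha> then 1 else 0)"
proof -
  have "lowdeg 1 (\<lambda>z. \<Sum>A\<in>Pow {..<l}. chi A \<alpha> / 2 ^ l * chi ({i} \<times> A) z)"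
  proof (intro lowdeg_sum lowdeg_scale lowdeg_chi)
    fix A assume "A \<in> Pow {..<l}"
    thus "{i} \<times> A \<subseteq> Z" using i by (auto simp: Z_def)
    have "fst ` ({i} \<times> A) \<subseteq> {i}" by auto
    from card_mono[OF _ this] show "card (fst ` ({i} \<times> A)) \<le> 1" by simp
  qed
  thus ?thesis
  proof (rule lowdeg_cong)
    fix z assume z: "z \<subseteq> Z"
    let ?\<beta> = "z `` {i}"
    have \<beta>: "?\<beta> \<subseteq> {..<l}" using z by (auto simp: Z_def)
    have "chi ({i} \<times> A) z = chi A ?\<beta>" if "finite A" for A
    proof -
      have "{i} \<times> A = Pair i ` A" by auto
      thus ?thesis by (simp add: chi_def prod.reindex inj_on_def)
    qed
    hence "(\<Sum>A\<in>Pow {..<l}. chi A \<alpha> / 2 ^ l * chi ({i} \<times> A) z)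
      = (\<Sum>A\<in>Pow {..<l}. chi A \<alpha> / 2 ^ l * chi A ?\<beta>)"
      by (intro sum.cong refl) (auto dest: finite_subset)
    also have "\<dots> = (\<Sum>A\<in>Pow {..<l}. chi (sym_diff \<alpha> ?\<beta>) A) / 2 ^ l"
      unfolding sum_divide_distrib
    proof (intro sum.cong refl)
      fix A assume "A \<in> Pow {..<l}"
      hence fin: "finite A" "finite \<alpha>" "finite ?\<beta>" using \<alpha> \<beta> by (auto dest: finite_subset)
      thus "chi A \<alpha> / 2 ^ l * chi A ?\<beta> = chi (sym_diff \<alpha> ?\<beta>) A / 2 ^ l"
        by (simp add: chi_sym_diff chi_commute[of A])
    qed
    also have "\<dots> = (if ?\<beta> = \<alpha> then 1 else 0)"
      using \<alpha> \<beta> by (subst sum_chi) auto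
    finally show "(\<Sum>A\<in>Pow {..<l}. chi A \<alpha> / 2 ^ l * chi ({i} \<times> A) z) = (if ?\<beta> = \<alpha> then 1 else 0)" .
  qed
qed

text \<open>The kernel \<open>PE (chi (sym_diff \<xi> \<eta>))\<close> is a partial character:
  characters of degree \<open>e\<close> have pairwise differences of degree at most
  \<open>2 * e\<close>, hence within \<open>K\<close>, where nonzero values multiply.\<close>

lemma PE_square_nonneg:
  assumes "lowdeg e h" "2 * e \<le> K"
  shows "PE (\<lambda>z. h z ^ 2) \<ge> 0"
proof -
  obtain q where q: "\<And>z. z \<subseteq> Z \<Longrightarrow> h z = (\<Sum>\<xi>\<in>low_chars e. q \<xi> * chi \<xi> z)"
    using assms(1) by (auto simp: lowdeg_def)
  let ?\<sigma> = "\<lambda>\<xi> \<eta>. PE (chi (sym_diff \<xi> \<eta>))"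
  have "PE (\<lambda>z. h z ^ 2) = PE (\<lambda>z. \<Sum>\<xi>\<in>low_chars e. \<Sum>\<eta>\<in>low_chars e. q \<xi> * q \<eta> * chi (sym_diff \<xi> \<eta>) z)"
  proof (rule PE_cong)
    fix z assume z: "z \<subseteq> Z"
    have "h z ^ 2 = (\<Sum>\<xi>\<in>low_chars e. \<Sum>\<eta>\<in>low_chars e. (q \<xi> * chi \<xi> z) * (q \<eta> * chi \<eta> z))"
      by (simp add: q[OF z] power2_eq_square sum_product)
    also have "\<dots> = (\<Sum>\<xi>\<in>low_chars e. \<Sum>\<eta>\<in>low_chars e. q \<xi> * q \<eta> * chi (sym_diff \<xi> \<eta>) z)"
      by (intro sum.cong refl, subst chi_sym_diff)
        (auto simp: low_chars_def finite_subset_Z)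
    finally show "h z ^ 2 = (\<Sum>\<xi>\<in>low_chars e. \<Sum>\<eta>\<in>low_chars e. q \<xi> * q \<eta> * chi (sym_diff \<xi> \<eta>) z)" .
  qed
  also have "\<dots> = (\<Sum>\<xi>\<in>low_chars e. \<Sum>\<eta>\<in>low_chars e. q \<xi> * q \<eta> * ?\<sigma> \<xi> \<eta>)"
    by (simp only: PE_sum PE_scale)
  also have "\<dots> \<ge> 0"
  proof (rule partial_character_psd)
    fix \<xi> \<eta> \<zeta>
    assume 1: "\<xi> \<in> low_chars e" "\<eta> \<in> low_chars e" "\<zeta> \<in> low_chars e" "?\<sigma> \<xi> \<eta> \<noteq> 0" "?\<sigma> \<eta> \<zeta> \<noteq> 0"
    have eq: "sym_diff (sym_diff \<xi> \<eta>) (sym_diff \<eta> \<zeta>) = sym_diff \<xi> \<zeta>" by auto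
    have "PE (chi (sym_diff (sym_diff \<xi> \<eta>) (sym_diff \<eta> \<zeta>))) = ?\<sigma> \<xi> \<eta> * ?\<sigma> \<eta> \<zeta>"
    proof (rule PE_chi_mult)
      show "card (fst ` sym_diff (sym_diff \<xi> \<eta>) (sym_diff \<eta> \<zeta>)) \<le> K"
        unfolding eq using card_support_sym_diff[of \<xi> \<zeta>] 1 assms(2) by (auto simp: low_chars_def)
    qed (use 1 in \<open>auto simp: low_chars_def\<close>)
    thus "?\<sigma> \<xi> \<zeta> = ?\<sigma> \<xi> \<eta> * ?\<sigma> \<eta> \<zeta>" unfolding eq .
  next
    show "?\<sigma> \<xi> \<eta> = ?\<sigma> \<eta> \<xi>" for \<xi> \<eta> by (simp only: Un_commute)
  qed (simp_all add: PE_chi_empty del: chi_empty)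
  finally show ?thesis .
qed

text \<open>Adding an equation neither creates nor destroys derivability as long as the degree stays
  within \<open>K\<close>; the equation touches one label of each player, hence
  \<open>e + 2\<close>.\<close>

lemma PE_mult_constraint:
  assumes "lowdeg e h" "e + 2 \<le> K" "u < t" "v < t"
  shows "PE (\<lambda>z. h z * (c u v * chi (V (u, v)) z)) = PE h"
proof -
  obtain q where q: "\<And>z. z \<subseteq> Z \<Longrightarrow> h z = (\<Sum>\<xi>\<in>low_chars e. q \<xi> * chi \<xi> z)"
    using assms(1) by (auto simp: lowdeg_def)
  let ?V = "V (u, v)"
  have V: "?V \<subseteq> Z" "PE (chi ?V) = c u v"
    using V_subset assms(3,4) PE_chi_xorsum[of "{(u, v)}"] K_pos by (auto simp: small_sets_def rhs_def)
  have c: "c u v * c u v = 1" "c u v \<noteq> 0" using c_cases[of u v] by auto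
  have key: "c u v * PE (chi (sym_diff \<xi> ?V)) = PE (chi \<xi>)" if \<xi>: "\<xi> \<in> low_chars e" for \<xi>
  proof (cases "PE (chi \<xi>) = 0")
    case False
    have "fst ` ?V \<subseteq> {u, t + v}" by (auto simp: V_def)
    hence "card (fst ` ?V) \<le> 2" using card_mono[of "{u, t + v}" "fst ` ?V"] by (simp add: card_insert_if split: if_splits)
    hence "card (fst ` sym_diff \<xi> ?V) \<le> K"
      using card_support_sym_diff[of \<xi> ?V] \<xi> V(1) assms(2) by (auto simp: low_chars_def)
    hence "PE (chi (sym_diff \<xi> ?V)) = PE (chi \<xi>) * c u v"
      using PE_chi_mult[of \<xi> ?V] \<xi> V False c by (auto simp: low_chars_def)
    thus ?thesis using c(1) by simp
  next
    \<comment> \<open>Otherwise adding the equation once more would derive \<open>\<xi>\<close>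
      itself.\<close>
    case True
    have "PE (chi (sym_diff \<xi> ?V)) = 0"
    proof (rule ccontr)
      assume nz: "PE (chi (sym_diff \<xi> ?V)) \<noteq> 0"
      have eq: "sym_diff (sym_diff \<xi> ?V) ?V = \<xi>" by auto
      have "PE (chi (sym_diff (sym_diff \<xi> ?V) ?V)) = PE (chi (sym_diff \<xi> ?V)) * PE (chi ?V)"
      proof (rule PE_chi_mult)
        show "card (fst ` sym_diff (sym_diff \<xi> ?V) ?V) \<le> K"
          unfolding eq using \<xi> assms(2) by (auto simp: low_chars_def)
      qed (use \<xi> V nz c in \<open>auto simp: low_chars_def\<close>)
      thus False unfolding eq using True nz V c by simp
    qed
    thus ?thesis using True by simp
  qed
  have "PE (\<lambda>z. h z * (c u v * chi ?V z)) = PE (\<lambda>z. \<Sum>\<xi>\<in>low_chars e. q \<xi> * (c u v * chi (sym_diff \<xi> ?V) z))"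
  proof (rule PE_cong)
    fix z assume z: "z \<subseteq> Z"
    show "h z * (c u v * chi ?V z) = (\<Sum>\<xi>\<in>low_chars e. q \<xi> * (c u v * chi (sym_diff \<xi> ?V) z))"
      unfolding q[OF z] sum_distrib_right
      using V(1) by (intro sum.cong refl, subst chi_sym_diff) (auto simp: low_chars_def finite_subset_Z)
  qed
  also have "\<dots> = (\<Sum>\<xi>\<in>low_chars e. q \<xi> * (c u v * PE (chi (sym_diff \<xi> ?V))))"
    by (simp only: PE_sum PE_scale)
  also have "\<dots> = (\<Sum>\<xi>\<in>low_chars e. q \<xi> * PE (chi \<xi>))"
    using key by (intro sum.cong refl) simp
  also have "\<dots> = PE (\<lambda>z. \<Sum>\<xi>\<in>low_chars e. q \<xi> * chi \<xi> z)"
    by (simp only: PE_sum PE_scale)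
  also have "\<dots> = PE h"
    by (rule PE_cong) (simp add: q)
  finally show ?thesis .
qed

end

section \<open>The pseudo-equilibrium\<close>

lemma pseudo_expectation_sum_single:
  "pseudo_expectation (\<Sum>i\<in>I. Poly_Mapping.single (z i) (w i)) f = (\<Sum>i\<in>I. w i * mpoly_eval f (z i))"
proof -
  interpret pm_linear "\<lambda>c::real. c" "mpoly_eval f" by standard simp_all
  have "pseudo_expectation \<mu> f = pm_lift (\<lambda>c. c) (mpoly_eval f) \<mu>" for \<mu>
    by (simp add: pseudo_expectation_def pm_lift_def)
  thus ?thesis by (simp add: pm_lift_sum pm_lift_single)
qed

text \<open>The game enters only through its assignment part and, for each deviation, through a
  bound that depends on the opponent's question alone and averages to at most 1/2. No hidden
  function appears, so the measure below can be shared by many games.\<close>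

locale xor_bimatrix = xor_game t l D K a c for t l D K a c +
  fixes d n :: nat and pos :: "nat \<Rightarrow> nat set \<Rightarrow> nat" and R C :: "real mat"
  assumes d_K: "2 * d + 2 \<le> K"
    and pos_less: "\<And>u \<alpha>. u < t \<Longrightarrow> \<alpha> \<subseteq> {..<l} \<Longrightarrow> pos u \<alpha> < n"
    and pos_inj: "\<And>u \<alpha> v \<beta>. u < t \<Longrightarrow> \<alpha> \<subseteq> {..<l} \<Longrightarrow> v < t \<Longrightarrow> \<beta> \<subseteq> {..<l} \<Longrightarrow> pos u \<alpha> = pos v \<beta> \<Longrightarrow> u = v \<and> \<alpha> = \<beta>"
    and R_pos: "\<And>u \<alpha> v \<beta>. u < t \<Longrightarrow> \<alpha> \<subseteq> {..<l} \<Longrightarrow> v < t \<Longrightarrow> \<beta> \<subseteq> {..<l} \<Longrightarrow>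
      R $$ (pos u \<alpha>, pos v \<beta>) = (if mismatch a c u \<alpha> v \<beta> then 0 else 1 / 2)"
    and C_pos: "\<And>u \<alpha> v \<beta>. u < t \<Longrightarrow> \<alpha> \<subseteq> {..<l} \<Longrightarrow> v < t \<Longrightarrow> \<beta> \<subseteq> {..<l} \<Longrightarrow>
      C $$ (pos u \<alpha>, pos v \<beta>) = (if mismatch a c u \<alpha> v \<beta> then 0 else 1 / 2)"
    and R_dev: "\<And>i. i < n \<Longrightarrow> \<exists>g. (\<forall>v<t. \<forall>\<beta>. \<beta> \<subseteq> {..<l} \<longrightarrow> R $$ (i, pos v \<beta>) \<le> g v) \<and> (\<Sum>v<t. g v) \<le> real t / 2"
    and C_dev: "\<And>j. j < n \<Longrightarrow> \<exists>g. (\<forall>u<t. \<forall>\<alpha>. \<alpha> \<subseteq> {..<l} \<longrightarrow> C $$ (pos u \<alpha>, j) \<le> g u) \<and> (\<Sum>u<t. g u) \<le> real t / 2"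
begin

text \<open>Weight of strategy \<open>i\<close> for a player who draws a uniform question and
  answers it by the labelling \<open>z\<close>; the offset \<open>s\<close> is 0 for the row player
  and \<open>t\<close> for the column player.\<close>

definition coord :: "nat \<Rightarrow> nat \<Rightarrow> (nat \<times> nat) set \<Rightarrow> real" where
  "coord s i z = (if \<exists>u<t. i = pos u (z `` {s + u}) then 1 / real t else 0)"

definition pt :: "(nat \<times> nat) set \<Rightarrow> real vec" where
  "pt z = vec (2 * n) (\<lambda>k. if k < n then coord 0 k z else coord t (k - n) z)"

definition \<mu> :: signed_measure where
  "\<mu> = (\<Sum>z\<in>Pow Z. Poly_Mapping.single (pt z) (weight z))"

lemma pseudo_expectation_\<mu>: "pseudo_expectation \<mu> f = PE (\<lambda>z. mpoly_eval f (pt z))"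
  unfolding \<mu>_def pseudo_expectation_sum_single PE_def ..

lemma pt_x: "i < n \<Longrightarrow> pt z $ i = coord 0 i z"
  by (simp add: pt_def)

lemma pt_y: "j < n \<Longrightarrow> pt z $ (n + j) = coord t j z"
  by (simp add: pt_def)

lemma label_subset: "z \<subseteq> Z \<Longrightarrow> z `` {i} \<subseteq> {..<l}"
  by (auto simp: Z_def)

lemma sum_coord:
  assumes z: "z \<subseteq> Z"
  shows "(\<Sum>i<n. f i * coord s i z) = (\<Sum>u<t. f (pos u (z `` {s + u}))) / real t"
proof -
  let ?p = "\<lambda>u. pos u (z `` {s + u})"
  have inj: "inj_on ?p {..<t}"
  proof (rule inj_onI)
    fix u v assume "u \<in> {..<t}" "v \<in> {..<t}" "?p u = ?p v"
    thus "u = v" using pos_inj[OF _ label_subset[OF z] _ label_subset[OF z]] by auto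
  qed
  have sub: "?p ` {..<t} \<subseteq> {..<n}"
    using pos_less label_subset[OF z] by auto
  have "(\<Sum>i<n. f i * coord s i z) = (\<Sum>i\<in>?p ` {..<t}. f i * coord s i z)"
    using sub by (intro sum.mono_neutral_right) (auto simp: coord_def)
  also have "\<dots> = (\<Sum>i\<in>?p ` {..<t}. f i / real t)"
    by (intro sum.cong refl) (auto simp: coord_def)
  also have "\<dots> = (\<Sum>u<t. f (?p u) / real t)"
    using inj by (simp add: sum.reindex)
  finally show ?thesis by (simp add: sum_divide_distrib)
qed

lemma lowdeg_coord:
  assumes "s \<le> t"
  shows "lowdeg 1 (coord s i)"
proof (cases "\<exists>u<t. \<exists>\<alpha>. \<alpha> \<subseteq> {..<l} \<and> i = pos u \<alpha>")
  case True
  then obtain u \<alpha> where u: "u < t" "\<alpha> \<subseteq> {..<l}" "i = pos u \<alpha>" by auto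
  have "lowdeg 1 (\<lambda>z. 1 / real t * (if z `` {s + u} = \<alpha> then 1 else 0))"
    using u assms by (intro lowdeg_scale lowdeg_indicator) auto
  thus ?thesis
  proof (rule lowdeg_cong)
    fix z assume "z \<subseteq> Z"
    hence "(\<exists>v<t. i = pos v (z `` {s + v})) \<longleftrightarrow> z `` {s + u} = \<alpha>"
      using u pos_inj[OF u(1,2)] label_subset by metis
    thus "1 / real t * (if z `` {s + u} = \<alpha> then 1 else 0) = coord s i z"
      by (simp add: coord_def)
  qed
next
  case False
  show ?thesis
  proof (rule lowdeg_cong[OF lowdeg_const[of 1 0]])
    fix z assume "z \<subseteq> Z"
    hence "\<not> (\<exists>u<t. i = pos u (z `` {s + u}))" using False label_subset by blast
    thus "0 = coord s i z" unfolding coord_def by (rule if_not_P[symmetric])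
  qed
qed

lemma lowdeg_mpoly_eval:
  assumes "p \<in> mpolys (2 * n)" "total_degree p \<le> e"
  shows "lowdeg e (\<lambda>z. mpoly_eval p (pt z))"
  unfolding mpoly_eval_def
proof (intro lowdeg_sum lowdeg_scale)
  fix \<alpha> assume \<alpha>: "\<alpha> \<in> Poly_Mapping.keys p"
  have "lowdeg (\<Sum>i\<in>Poly_Mapping.keys \<alpha>. Poly_Mapping.lookup \<alpha> i * 1)
     (\<lambda>z. \<Prod>i\<in>Poly_Mapping.keys \<alpha>. (pt z $ i) ^ Poly_Mapping.lookup \<alpha> i)"
  proof (intro lowdeg_prod lowdeg_power finite_keys)
    fix i assume "i \<in> Poly_Mapping.keys \<alpha>"
    hence i: "i < 2 * n" using assms(1) \<alpha> by (auto simp: mpolys_def)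
    show "lowdeg 1 (\<lambda>z. pt z $ i)"
      using lowdeg_coord[of 0 i] lowdeg_coord[of t "i - n"] i by (cases "i < n") (simp_all add: pt_def)
  qed
  moreover have "(\<Sum>i\<in>Poly_Mapping.keys \<alpha>. Poly_Mapping.lookup \<alpha> i * 1) \<le> e"
    using mono_degree_le_total_degree[OF \<alpha>] assms(2) by (simp add: mono_degree_def)
  ultimately show "lowdeg e (\<lambda>z. \<Prod>i\<in>Poly_Mapping.keys \<alpha>. (pt z $ i) ^ Poly_Mapping.lookup \<alpha> i)"
    by (rule lowdeg_mono)
qed

lemma satisfies_nonnegI:
  assumes "\<And>g. lowdeg d g \<Longrightarrow> PE (\<lambda>z. (g z)\<^sup>2 * mpoly_eval h (pt z)) \<ge> 0"
  shows "satisfies_nonneg d (2 * n) \<mu> h"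
  unfolding satisfies_nonneg_def
proof (intro ballI impI)
  fix p assume p: "p \<in> mpolys (2 * n)" "total_degree (p\<^sup>2 * h) \<le> d"
  show "0 \<le> pseudo_expectation \<mu> (p\<^sup>2 * h)"
  \<comment> \<open>If \<open>h\<close> is zero, the degree of the product says nothing about
    \<open>p\<close>.\<close>
  proof (cases "p = 0 \<or> h = 0")
    case True
    hence "p\<^sup>2 * h = 0" by auto
    hence "pseudo_expectation \<mu> (p\<^sup>2 * h) = 0"
      by (simp only: pseudo_expectation_def mpoly_eval_0 mult_zero_right sum.neutral_const)
    thus ?thesis by simp
  next
    case False
    hence "total_degree p \<le> d" using total_degree_square_mult_ge[of p h] p(2) by simp
    thus ?thesis
      using assms[OF lowdeg_mpoly_eval[OF p(1)]] by (simp add: pseudo_expectation_\<mu>)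
  qed
qed

lemma satisfies_zeroI:
  assumes "\<And>z. z \<subseteq> Z \<Longrightarrow> mpoly_eval h (pt z) = 0"
  shows "satisfies_zero d (2 * n) \<mu> h"
proof -
  have "PE (\<lambda>z. (g z)\<^sup>2 * mpoly_eval h (pt z)) = 0" "PE (\<lambda>z. (g z)\<^sup>2 * mpoly_eval (- h) (pt z)) = 0" for g
    using assms by (simp_all add: PE_def)
  thus ?thesis unfolding satisfies_zero_def by (auto intro!: satisfies_nonnegI)
qed

text \<open>A coordinate is 0 or 1/t, hence t times its own square, so the expression is a multiple
  of a square of degree \<open>d + 1\<close>.\<close>

lemma PE_square_coord_nonneg:
  assumes "lowdeg d g" "s \<le> t"
  shows "PE (\<lambda>z. (g z)\<^sup>2 * coord s i z) \<ge> 0"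
proof -
  have "lowdeg (d + 1) (\<lambda>z. g z * coord s i z)"
    using assms by (intro lowdeg_mult lowdeg_coord)
  hence "0 \<le> real t * PE (\<lambda>z. (g z * coord s i z)\<^sup>2)"
    using d_K by (intro mult_nonneg_nonneg PE_square_nonneg) auto
  also have "\<dots> = PE (\<lambda>z. real t * (g z * coord s i z)\<^sup>2)" by (simp add: PE_scale)
  also have "\<dots> = PE (\<lambda>z. (g z)\<^sup>2 * coord s i z)"
    using t_pos by (intro PE_cong) (auto simp: coord_def power2_eq_square field_simps)
  finally show ?thesis .
qed

text \<open>Extended to strategies as \<open>b'\<close>, the bound depends on the opponent's
  question only, and since each question is drawn with weight exactly 1/t it contributes the
  constant average of \<open>b\<close>. The slack \<open>b' - W\<close> is a nonnegative combination
  of coordinates.\<close>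

lemma PE_square_deviation_le:
  assumes g: "lowdeg d g" and s: "s \<le> t"
    and W: "\<And>v \<beta>. v < t \<Longrightarrow> \<beta> \<subseteq> {..<l} \<Longrightarrow> W (pos v \<beta>) \<le> b v" and b: "(\<Sum>v<t. b v) \<le> real t / 2"
  shows "PE (\<lambda>z. (g z)\<^sup>2 * (\<Sum>j<n. W j * coord s j z)) \<le> PE (\<lambda>z. (g z)\<^sup>2) / 2"
proof -
  define J where "J = (\<lambda>(v, \<beta>). pos v \<beta>) ` ({..<t} \<times> Pow {..<l})"
  \<comment> \<open>The choice recovers the question from the strategy; strategies that are no
    assignments get \<open>W j\<close>, which makes their slack zero.\<close>
  define b' where "b' j = (if j \<in> J then b (SOME v. v < t \<and> (\<exists>\<beta>. \<beta> \<subseteq> {..<l} \<and> j = pos v \<beta>)) else W j)" for j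
  have b': "b' (pos v \<beta>) = b v" if v: "v < t" "\<beta> \<subseteq> {..<l}" for v \<beta>
  proof -
    have "(SOME w. w < t \<and> (\<exists>\<gamma>. \<gamma> \<subseteq> {..<l} \<and> pos v \<beta> = pos w \<gamma>)) = v"
      using v pos_inj by (intro some_equality) blast+
    moreover have "pos v \<beta> \<in> J" using v by (auto simp: J_def)
    ultimately show ?thesis by (simp add: b'_def)
  qed
  have nonneg: "0 \<le> b' j - W j" for j
  proof (cases "j \<in> J")
    case True
    then obtain v \<beta> where "v < t" "\<beta> \<subseteq> {..<l}" "j = pos v \<beta>" by (auto simp: J_def)
    thus ?thesis using b' W by simp
  qed (simp add: b'_def)
  have eq: "(\<Sum>j<n. b' j * coord s j z) = (\<Sum>v<t. b v) / real t" if z: "z \<subseteq> Z" for z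
    unfolding sum_coord[OF z] using label_subset[OF z] b' by simp
  have "0 \<le> (\<Sum>j<n. (b' j - W j) * PE (\<lambda>z. (g z)\<^sup>2 * coord s j z))"
    using nonneg PE_square_coord_nonneg[OF g s] by (intro sum_nonneg mult_nonneg_nonneg) auto
  also have "\<dots> = PE (\<lambda>z. \<Sum>j<n. (b' j - W j) * ((g z)\<^sup>2 * coord s j z))"
    by (simp only: PE_sum PE_scale)
  also have "\<dots> = PE (\<lambda>z. (\<Sum>v<t. b v) / real t * (g z)\<^sup>2 + (- 1) * ((g z)\<^sup>2 * (\<Sum>j<n. W j * coord s j z)))"
  proof (rule PE_cong)
    fix z assume z: "z \<subseteq> Z"
    have "(\<Sum>j<n. (b' j - W j) * ((g z)\<^sup>2 * coord s j z))
      = (g z)\<^sup>2 * (\<Sum>j<n. b' j * coord s j z) - (g z)\<^sup>2 * (\<Sum>j<n. W j * coord s j z)"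
      by (simp add: sum_distrib_left sum_subtractf[symmetric] algebra_simps)
    thus "(\<Sum>j<n. (b' j - W j) * ((g z)\<^sup>2 * coord s j z))
      = (\<Sum>v<t. b v) / real t * (g z)\<^sup>2 + (- 1) * ((g z)\<^sup>2 * (\<Sum>j<n. W j * coord s j z))"
      unfolding eq[OF z] by (simp add: mult_ac)
  qed
  also have "\<dots> = (\<Sum>v<t. b v) / real t * PE (\<lambda>z. (g z)\<^sup>2) - PE (\<lambda>z. (g z)\<^sup>2 * (\<Sum>j<n. W j * coord s j z))"
    by (simp only: PE_add PE_scale)
  also have "(\<Sum>v<t. b v) / real t * PE (\<lambda>z. (g z)\<^sup>2) \<le> 1 / 2 * PE (\<lambda>z. (g z)\<^sup>2)"
    using b t_pos d_K PE_square_nonneg[OF g] by (intro mult_right_mono) (auto simp: field_simps)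
  finally show ?thesis by simp
qed

lemma mismatch_label:
  assumes "u < t" "v < t"
  shows "(if mismatch a c u (z `` {u}) v (z `` {t + v}) then 0 else 1 / 2)
     = 1 / 4 + 1 / 4 * (c u v * chi (V (u, v)) z)"
proof -
  have fin: "finite (a u)" "finite (a v)" using assms a_sub finite_subset by blast+
  have slice: "chi ({i} \<times> A) z = chi A (z `` {i})" for i A
  proof -
    have "{i} \<times> A = Pair i ` A" by auto
    thus ?thesis by (simp add: chi_def prod.reindex inj_on_def)
  qed
  have "chi (V (u, v)) z = chi ({u} \<times> a v) z * chi ({t + v} \<times> a u) z"
    unfolding V_def case_prod_conv using fin assms by (intro chi_Un_disjoint) auto
  hence "chi (V (u, v)) z = chi (a v) (z `` {u}) * chi (a u) (z `` {t + v})" by (simp add: slice)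
  thus ?thesis
    using c_cases[of u v] chi_cases[of "a v" "z `` {u}"] chi_cases[of "a u" "z `` {t + v}"]
    by (auto simp: mismatch_def)
qed

text \<open>The square of \<open>g\<close> has degree \<open>2 * d\<close>, so
  \<open>2 * d + 2 \<le> K\<close> lets every equation count as satisfied, and each pair of
  questions contributes the full payoff 1/2.\<close>

lemma PE_square_payoff:
  assumes g: "lowdeg d g"
    and M: "\<And>u \<alpha> v \<beta>. u < t \<Longrightarrow> \<alpha> \<subseteq> {..<l} \<Longrightarrow> v < t \<Longrightarrow> \<beta> \<subseteq> {..<l} \<Longrightarrow>
      M $$ (pos u \<alpha>, pos v \<beta>) = (if mismatch a c u \<alpha> v \<beta> then 0 else 1 / 2)"
  shows "PE (\<lambda>z. (g z)\<^sup>2 * mpoly_eval (payoff_poly n M) (pt z)) = PE (\<lambda>z. (g z)\<^sup>2) / 2"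
proof -
  have "PE (\<lambda>z. (g z)\<^sup>2 * mpoly_eval (payoff_poly n M) (pt z))
     = PE (\<lambda>z. 1 / (real t)\<^sup>2 * (\<Sum>u<t. \<Sum>v<t. 1 / 4 * (g z)\<^sup>2 + 1 / 4 * ((g z)\<^sup>2 * (c u v * chi (V (u, v)) z))))"
  proof (rule PE_cong)
    fix z assume z: "z \<subseteq> Z"
    have "mpoly_eval (payoff_poly n M) (pt z) = (\<Sum>i<n. (\<Sum>j<n. M $$ (i, j) * coord t j z) * coord 0 i z)"
      by (simp add: payoff_poly_def x_var_def y_var_def pt_x pt_y sum_distrib_right sum_distrib_left mult_ac)
    also have "\<dots> = 1 / (real t)\<^sup>2 * (\<Sum>u<t. \<Sum>v<t. M $$ (pos u (z `` {u}), pos v (z `` {t + v})))"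
      unfolding sum_coord[OF z] by (simp add: power2_eq_square sum_divide_distrib[symmetric])
    also have "(\<Sum>u<t. \<Sum>v<t. M $$ (pos u (z `` {u}), pos v (z `` {t + v})))
       = (\<Sum>u<t. \<Sum>v<t. 1 / 4 + 1 / 4 * (c u v * chi (V (u, v)) z))"
    proof (intro sum.cong refl)
      fix u v assume "u \<in> {..<t}" "v \<in> {..<t}"
      hence uv: "u < t" "v < t" by auto
      show "M $$ (pos u (z `` {u}), pos v (z `` {t + v})) = 1 / 4 + 1 / 4 * (c u v * chi (V (u, v)) z)"
        using M[OF uv(1) label_subset[OF z] uv(2) label_subset[OF z]] mismatch_label[OF uv] by simp
    qed
    finally show "(g z)\<^sup>2 * mpoly_eval (payoff_poly n M) (pt z)
      = 1 / (real t)\<^sup>2 * (\<Sum>u<t. \<Sum>v<t. 1 / 4 * (g z)\<^sup>2 + 1 / 4 * ((g z)\<^sup>2 * (c u v * chi (V (u, v)) z)))"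
      by (simp add: sum_distrib_left distrib_left mult_ac)
  qed
  also have "\<dots> = 1 / (real t)\<^sup>2 * (\<Sum>u<t. \<Sum>v<t. 1 / 4 * PE (\<lambda>z. (g z)\<^sup>2) + 1 / 4 * PE (\<lambda>z. (g z)\<^sup>2 * (c u v * chi (V (u, v)) z)))"
    by (simp only: PE_scale PE_sum PE_add)
  also have "\<dots> = 1 / (real t)\<^sup>2 * (\<Sum>u<t. \<Sum>v<t. 1 / 2 * PE (\<lambda>z. (g z)\<^sup>2))"
  proof (intro arg_cong[where f = "\<lambda>x. 1 / (real t)\<^sup>2 * x"] sum.cong refl)
    fix u v assume "u \<in> {..<t}" "v \<in> {..<t}"
    hence "PE (\<lambda>z. (g z)\<^sup>2 * (c u v * chi (V (u, v)) z)) = PE (\<lambda>z. (g z)\<^sup>2)"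
      using d_K by (intro PE_mult_constraint[OF lowdeg_power[OF g]]) auto
    thus "1 / 4 * PE (\<lambda>z. (g z)\<^sup>2) + 1 / 4 * PE (\<lambda>z. (g z)\<^sup>2 * (c u v * chi (V (u, v)) z)) = 1 / 2 * PE (\<lambda>z. (g z)\<^sup>2)"
      by simp
  qed
  also have "\<dots> = PE (\<lambda>z. (g z)\<^sup>2) / 2"
    using t_pos by (simp add: power2_eq_square)
  finally show ?thesis .
qed

theorem pseudo_equilibrium_\<mu>: "pseudo_equilibrium d n (R, C) \<mu>"
proof -
  have dist: "pseudo_distribution d (2 * n) \<mu>"
    unfolding pseudo_distribution_def
  proof (intro conjI ballI impI)
    have "Poly_Mapping.keys \<mu> \<subseteq> (\<Union>z\<in>Pow Z. Poly_Mapping.keys (Poly_Mapping.single (pt z) (weight z)))"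
      unfolding \<mu>_def by (rule keys_sum)
    thus "Poly_Mapping.keys \<mu> \<subseteq> carrier_vec (2 * n)"
      by (rule subset_trans) (auto simp: pt_def)
    show "pseudo_expectation \<mu> 1 = 1"
      by (simp add: pseudo_expectation_\<mu> PE_1)
    fix q assume q: "q \<in> mpolys (2 * n)" "real (total_degree q) \<le> real d / 2"
    hence "lowdeg d (\<lambda>z. mpoly_eval q (pt z))" by (intro lowdeg_mpoly_eval) auto
    thus "0 \<le> pseudo_expectation \<mu> (q ^ 2)"
      using d_K by (auto simp: pseudo_expectation_\<mu> intro!: PE_square_nonneg)
  qed
  have sum1: "(\<Sum>i<n. coord s i z) = 1" if "z \<subseteq> Z" for s z
    using sum_coord[OF that, of "\<lambda>_. 1" s] t_pos by simp
  have diff: "PE (\<lambda>z. (g z)\<^sup>2 * (x z - y z)) = PE (\<lambda>z. (g z)\<^sup>2 * x z) - PE (\<lambda>z. (g z)\<^sup>2 * y z)" for g x y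
    using PE_add[of "\<lambda>z. (g z)\<^sup>2 * x z" "\<lambda>z. -1 * ((g z)\<^sup>2 * y z)"] by (simp only: PE_scale right_diff_distrib) simp
  have "satisfies_nonneg d (2 * n) \<mu> (x_var i)" if "i < n" for i
    using that PE_square_coord_nonneg by (intro satisfies_nonnegI) (simp add: x_var_def pt_x)
  moreover have "satisfies_nonneg d (2 * n) \<mu> (y_var n j)" if "j < n" for j
    using that PE_square_coord_nonneg by (intro satisfies_nonnegI) (simp add: y_var_def pt_y)
  moreover have "satisfies_zero d (2 * n) \<mu> ((\<Sum>i<n. x_var i) - 1)"
    using sum1 by (intro satisfies_zeroI) (simp add: x_var_def pt_x)
  moreover have "satisfies_zero d (2 * n) \<mu> ((\<Sum>j<n. y_var n j) - 1)"
    using sum1 by (intro satisfies_zeroI) (simp add: y_var_def pt_y)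
  moreover have "satisfies_nonneg d (2 * n) \<mu> (payoff_poly n R - row_payoff_poly n R i)" if i: "i < n" for i
  proof (rule satisfies_nonnegI)
    fix g assume g: "lowdeg d g"
    obtain b where b: "\<And>v \<beta>. v < t \<Longrightarrow> \<beta> \<subseteq> {..<l} \<Longrightarrow> R $$ (i, pos v \<beta>) \<le> b v" "(\<Sum>v<t. b v) \<le> real t / 2"
      using R_dev[OF i] by blast
    have "mpoly_eval (row_payoff_poly n R i) (pt z) = (\<Sum>j<n. R $$ (i, j) * coord t j z)" for z
      by (simp add: row_payoff_poly_def y_var_def pt_y)
    thus "0 \<le> PE (\<lambda>z. (g z)\<^sup>2 * mpoly_eval (payoff_poly n R - row_payoff_poly n R i) (pt z))"
      using PE_square_payoff[OF g R_pos] PE_square_deviation_le[OF g order_refl, of "\<lambda>j. R $$ (i, j)" b] b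
      by (simp add: diff)
  qed
  moreover have "satisfies_nonneg d (2 * n) \<mu> (payoff_poly n C - col_payoff_poly n C j)" if j: "j < n" for j
  proof (rule satisfies_nonnegI)
    fix g assume g: "lowdeg d g"
    obtain b where b: "\<And>v \<beta>. v < t \<Longrightarrow> \<beta> \<subseteq> {..<l} \<Longrightarrow> C $$ (pos v \<beta>, j) \<le> b v" "(\<Sum>v<t. b v) \<le> real t / 2"
      using C_dev[OF j] by blast
    have "mpoly_eval (col_payoff_poly n C j) (pt z) = (\<Sum>i<n. C $$ (i, j) * coord 0 i z)" for z
      by (simp add: col_payoff_poly_def x_var_def pt_x)
    thus "0 \<le> PE (\<lambda>z. (g z)\<^sup>2 * mpoly_eval (payoff_poly n C - col_payoff_poly n C j) (pt z))"
      using PE_square_payoff[OF g C_pos] PE_square_deviation_le[OF g le0, of "\<lambda>i. C $$ (i, j)" b] b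
      by (simp add: diff)
  qed
  ultimately show ?thesis using dist unfolding pseudo_equilibrium_def by simp
qed

end

section \<open>The games\<close>

text \<open>\<open>Asg u \<alpha>\<close> answers question \<open>u\<close> by \<open>\<alpha>\<close>, \<open>Chal T\<close> bets that the opponent's question lies in \<open>T\<close>.
  \<open>Blk k b T\<close> plays the pair \<open>(k, b)\<close> and bets that the first component of the opponent's pair lies in
  \<open>T\<close> or that this pair is not on the graph of the hidden function.\<close>

datatype role = Asg nat "nat set" | Chal "nat set" | Blk nat nat "nat set"

text \<open>Normalized to mean zero under a uniform question, so a uniform player cannot be
  exploited.\<close>

definition bet :: "nat \<Rightarrow> nat \<Rightarrow> nat set \<Rightarrow> real" where
  "bet t k T = (if k \<in> T then 1 else 0) - real (card T) / real t"

text \<open>On the graph this is \<open>bet\<close>; off the graph even the empty bet wins.\<close>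

definition hidden_bet :: "nat \<Rightarrow> (nat \<Rightarrow> nat) \<Rightarrow> nat \<Rightarrow> nat \<Rightarrow> nat set \<Rightarrow> real" where
  "hidden_bet t f k b T = (if k \<in> T \<or> f k \<noteq> b then 1 else 0) - real (card T) / real t"

text \<open>The hidden function occurs only when two \<open>Blk\<close> roles meet. The value
  159/320 lies between perfect cooperation, 160/320, and the 150/320 that real players can achieve
  on uniform questions. A challenge averages 1/2 against uniform questions; the entries -1 make
  assignments and challenges costly against anything but assignments.\<close>

fun pay :: "nat \<Rightarrow> (nat \<Rightarrow> nat set) \<Rightarrow> (nat \<Rightarrow> nat \<Rightarrow> real) \<Rightarrow> (nat \<Rightarrow> nat) \<Rightarrow> role \<Rightarrow> role \<Rightarrow> real" where
  "pay t a c f (Asg u \<alpha>) (Asg v \<beta>) = (if mismatch a c u \<alpha> v \<beta> then 0 else 1 / 2)"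
| "pay t a c f (Asg u \<alpha>) (Chal T) = -1"
| "pay t a c f (Asg u \<alpha>) (Blk k b T) = -1"
| "pay t a c f (Chal T) (Asg v \<beta>) = 1 / 2 + bet t v T / 2"
| "pay t a c f (Chal T) (Chal T') = -1"
| "pay t a c f (Chal T) (Blk k b T') = -1"
| "pay t a c f (Blk k b T) (Asg v \<beta>) = 159 / 320"
| "pay t a c f (Blk k b T) (Chal T') = 159 / 320"
| "pay t a c f (Blk k b T) (Blk k' b' T') = 1 / 2 + (hidden_bet t f k' b' T - hidden_bet t f k b T') / 4"

definition asg_roles :: "nat \<Rightarrow> nat \<Rightarrow> role set" where
  "asg_roles t l = (\<lambda>(u, \<alpha>). Asg u \<alpha>) ` ({..<t} \<times> Pow {..<l})"

definition chal_roles :: "nat \<Rightarrow> role set" where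
  "chal_roles t = Chal ` Pow {..<t}"

definition blk_roles :: "nat \<Rightarrow> nat \<Rightarrow> role set" where
  "blk_roles t Q = (\<lambda>(k, b, T). Blk k b T) ` ({..<t} \<times> {..<Q} \<times> Pow {..<t})"

definition roles :: "nat \<Rightarrow> nat \<Rightarrow> nat \<Rightarrow> role set" where
  "roles t l Q = asg_roles t l \<union> chal_roles t \<union> blk_roles t Q"

lemma finite_roles [simp]:
  "finite (asg_roles t l)" "finite (chal_roles t)" "finite (blk_roles t Q)" "finite (roles t l Q)"
  by (simp_all add: asg_roles_def chal_roles_def blk_roles_def roles_def)

lemma card_fraction:
  assumes "T \<subseteq> {..<t}"
  shows "0 \<le> real (card T) / real t" "real (card T) / real t \<le> 1"
  using card_mono[OF finite_lessThan assms] by (auto simp: divide_le_eq)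

lemma bet_bounds:
  assumes "T \<subseteq> {..<t}"
  shows "bet t k T \<le> 1" "-1 \<le> bet t k T" "hidden_bet t f k b T \<le> 1" "-1 \<le> hidden_bet t f k b T"
proof -
  define r where "r = real (card T) / real t"
  have "0 \<le> r" "r \<le> 1" using card_fraction[OF assms] by (simp_all add: r_def)
  thus "bet t k T \<le> 1" "-1 \<le> bet t k T" "hidden_bet t f k b T \<le> 1" "-1 \<le> hidden_bet t f k b T"
    unfolding bet_def hidden_bet_def r_def[symmetric] by auto
qed

lemma sum_bet:
  assumes "t > 0" "T \<subseteq> {..<t}"
  shows "(\<Sum>k<t. bet t k T) = 0"
proof -
  have "(\<Sum>k<t. if k \<in> T then 1 else 0 :: real) = card T"
    using assms(2) by (simp add: sum.If_cases Int_absorb1)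
  thus ?thesis using assms(1) by (simp add: bet_def sum_subtractf)
qed

lemma pay_bounds:
  assumes "\<rho> \<in> roles t l Q" "\<rho>' \<in> roles t l Q"
  shows "-1 \<le> pay t a c f \<rho> \<rho>'" "pay t a c f \<rho> \<rho>' \<le> 1"
proof -
  have b: "\<And>T k. T \<subseteq> {..<t} \<Longrightarrow> bet t k T \<le> 1 \<and> -1 \<le> bet t k T"
    "\<And>T k b. T \<subseteq> {..<t} \<Longrightarrow> hidden_bet t f k b T \<le> 1 \<and> -1 \<le> hidden_bet t f k b T"
    by (simp_all add: bet_bounds)
  have Chal: "T \<subseteq> {..<t}" if "Chal T \<in> roles t l Q" for T
    using that by (auto simp: roles_def asg_roles_def chal_roles_def blk_roles_def)
  have Blk: "T \<subseteq> {..<t}" if "Blk k b T \<in> roles t l Q" for k b T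
    using that by (auto simp: roles_def asg_roles_def chal_roles_def blk_roles_def)
  have half: "-1 \<le> 1 / 2 + x / 2 \<and> 1 / 2 + x / 2 \<le> 1" if "x \<le> 1 \<and> -1 \<le> x" for x :: real
    using that by (simp add: field_simps)
  have quarter: "-1 \<le> 1 / 2 + (x - y) / 4 \<and> 1 / 2 + (x - y) / 4 \<le> 1"
    if "x \<le> 1 \<and> -1 \<le> x" "y \<le> 1 \<and> -1 \<le> y" for x y :: real
    using that by (simp add: field_simps)
  have "-1 \<le> pay t a c f \<rho> \<rho>' \<and> pay t a c f \<rho> \<rho>' \<le> 1"
  proof (cases \<rho>)
    case 1: (Asg u \<alpha>)
    show ?thesis unfolding 1 by (cases \<rho>') simp_all
  next
    case 1: (Chal T)
    show ?thesis
    proof (cases \<rho>')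
      case 2: (Asg v \<beta>)
      show ?thesis unfolding 1 2 pay.simps by (rule half, rule b(1), rule Chal) (use assms 1 in simp)
    qed (simp_all add: 1)
  next
    case 1: (Blk k b' T)
    show ?thesis
    proof (cases \<rho>')
      case 2: (Blk k' b'' T')
      show ?thesis unfolding 1 2 pay.simps by (rule quarter; rule b(2); rule Blk) (use assms 1 2 in simp_all)
    qed (simp_all add: 1)
  qed
  thus "-1 \<le> pay t a c f \<rho> \<rho>'" "pay t a c f \<rho> \<rho>' \<le> 1" by auto
qed

lemma sum_roles:
  "(\<Sum>\<rho>\<in>roles t l Q. g \<rho>) =
     (\<Sum>\<rho>\<in>asg_roles t l. g \<rho>) + (\<Sum>\<rho>\<in>chal_roles t. g \<rho>) + (\<Sum>\<rho>\<in>blk_roles t Q. g \<rho>)"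
proof -
  have "(asg_roles t l \<union> chal_roles t) \<inter> blk_roles t Q = {}" "asg_roles t l \<inter> chal_roles t = {}"
    by (auto simp: asg_roles_def chal_roles_def blk_roles_def)
  hence "sum g (roles t l Q) = sum g (asg_roles t l \<union> chal_roles t) + sum g (blk_roles t Q)"
    "sum g (asg_roles t l \<union> chal_roles t) = sum g (asg_roles t l) + sum g (chal_roles t)"
    unfolding roles_def by (auto intro!: sum.union_disjoint)
  thus ?thesis by simp
qed

lemma sum_asg_roles: "(\<Sum>\<rho>\<in>asg_roles t l. g \<rho>) = (\<Sum>u<t. \<Sum>\<alpha>\<in>Pow {..<l}. g (Asg u \<alpha>))"
proof -
  have inj: "inj_on (\<lambda>(u, \<alpha>). Asg u \<alpha>) A" for A by (auto simp: inj_on_def)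
  have "(\<Sum>\<rho>\<in>asg_roles t l. g \<rho>) = (\<Sum>(u, \<alpha>)\<in>{..<t} \<times> Pow {..<l}. g (Asg u \<alpha>))"
    unfolding asg_roles_def by (subst sum.reindex[OF inj]) (simp add: case_prod_beta)
  thus ?thesis unfolding sum.cartesian_product .
qed

definition mix_on :: "'a set \<Rightarrow> ('a \<Rightarrow> real) \<Rightarrow> bool" where
  "mix_on S X \<longleftrightarrow> (\<forall>\<rho>\<in>S. X \<rho> \<ge> 0) \<and> sum X S = 1"

text \<open>The total loss against the best reply is at most \<open>\<epsilon>\<close> and no role
  contributes negatively to it, so any part \<open>P\<close> of the mixture also loses at most
  \<open>\<epsilon>\<close>.\<close>

lemma deviation_part:
  fixes U X :: "'a \<Rightarrow> real"
  assumes "finite S" "mix_on S X" and best: "\<And>\<rho>. \<rho> \<in> S \<Longrightarrow> (\<Sum>\<sigma>\<in>S. X \<sigma> * U \<sigma>) \<ge> U \<rho> - \<epsilon>"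
    and "P \<subseteq> S" "\<rho> \<in> S"
  shows "(\<Sum>\<sigma>\<in>P. X \<sigma> * U \<sigma>) \<ge> sum X P * U \<rho> - \<epsilon>"
proof -
  have fin: "finite (U ` S)" "U ` S \<noteq> {}" using assms by auto
  define m where "m = Max (U ` S)"
  have "m \<in> U ` S" unfolding m_def using fin by (rule Max_in)
  then obtain \<rho>' where \<rho>': "\<rho>' \<in> S" "U \<rho>' = m" by auto
  have le: "U \<sigma> \<le> m" if "\<sigma> \<in> S" for \<sigma> unfolding m_def using fin that by (intro Max_ge) auto
  have X: "X \<sigma> \<ge> 0" if "\<sigma> \<in> S" for \<sigma> using assms(2) that by (auto simp: mix_on_def)
  have tot: "sum X P + sum X (S - P) = 1"
    using assms by (simp add: mix_on_def sum.subset_diff[of P S X])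
  have "(\<Sum>\<sigma>\<in>S. X \<sigma> * U \<sigma>) = (\<Sum>\<sigma>\<in>S - P. X \<sigma> * U \<sigma>) + (\<Sum>\<sigma>\<in>P. X \<sigma> * U \<sigma>)"
    using assms by (intro sum.subset_diff) auto
  moreover have "(\<Sum>\<sigma>\<in>S - P. X \<sigma> * U \<sigma>) \<le> sum X (S - P) * m"
    unfolding sum_distrib_right using X le by (intro sum_mono mult_left_mono) auto
  moreover have "(\<Sum>\<sigma>\<in>S. X \<sigma> * U \<sigma>) \<ge> m - \<epsilon>" using best[OF \<rho>'(1)] \<rho>'(2) by simp
  moreover have "sum X (S - P) = 1 - sum X P" using tot by simp
  ultimately have "(\<Sum>\<sigma>\<in>P. X \<sigma> * U \<sigma>) \<ge> sum X P * m - \<epsilon>" by (simp add: algebra_simps)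
  moreover have "sum X P * U \<rho> \<le> sum X P * m"
    using X le assms by (intro mult_left_mono sum_nonneg) auto
  ultimately show ?thesis by linarith
qed

section \<open>Approximate equilibria of the games\<close>

locale role_game =
  fixes t l Q :: nat and a :: "nat \<Rightarrow> nat set" and f :: "nat \<Rightarrow> nat"
  assumes t_pos: "t > 0" and f_less: "\<And>k. k < t \<Longrightarrow> f k < Q"
begin

abbreviation "RA \<equiv> asg_roles t l"
abbreviation "RD \<equiv> chal_roles t"
abbreviation "RB \<equiv> blk_roles t Q"
abbreviation "RR \<equiv> roles t l Q"

definition util :: "(nat \<Rightarrow> nat \<Rightarrow> real) \<Rightarrow> (role \<Rightarrow> real) \<Rightarrow> role \<Rightarrow> real" where
  "util c Y \<rho> = (\<Sum>\<rho>'\<in>RR. Y \<rho>' * pay t a c f \<rho> \<rho>')"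

definition best_response :: "real \<Rightarrow> (nat \<Rightarrow> nat \<Rightarrow> real) \<Rightarrow> (role \<Rightarrow> real) \<Rightarrow> (role \<Rightarrow> real) \<Rightarrow> bool" where
  "best_response \<epsilon> c X Y \<longleftrightarrow> (\<forall>\<rho>\<in>RR. (\<Sum>\<sigma>\<in>RR. X \<sigma> * util c Y \<sigma>) \<ge> util c Y \<rho> - \<epsilon>)"

definition hard :: "(nat \<Rightarrow> nat \<Rightarrow> real) \<Rightarrow> bool" where
  "hard c \<longleftrightarrow> (\<forall>F G. real t ^ 2 / 16 \<le> real (card {(u, v). u < t \<and> v < t \<and> mismatch a c u (F u) v (G v)}))"

text \<open>On assignments \<open>2 * pay\<close> is the indicator of success, so this is the joint
  mass of satisfied pairs.\<close>

definition win :: "(nat \<Rightarrow> nat \<Rightarrow> real) \<Rightarrow> (role \<Rightarrow> real) \<Rightarrow> (role \<Rightarrow> real) \<Rightarrow> real" where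
  "win c X Y = (\<Sum>\<rho>\<in>RA. \<Sum>\<rho>'\<in>RA. X \<rho> * Y \<rho>' * (2 * pay t a c f \<rho> \<rho>'))"

text \<open>The mass of assignments with question in \<open>T\<close>, minus the share of
  \<open>T\<close> under uniform questions.\<close>

definition bias :: "(role \<Rightarrow> real) \<Rightarrow> nat set \<Rightarrow> real" where
  "bias X T = (\<Sum>u<t. (\<Sum>\<alpha>\<in>Pow {..<l}. X (Asg u \<alpha>)) * bet t u T)"

lemma RB_cases: "\<rho> \<in> RB \<Longrightarrow> (\<And>k b T. \<rho> = Blk k b T \<Longrightarrow> k < t \<Longrightarrow> b < Q \<Longrightarrow> T \<subseteq> {..<t} \<Longrightarrow> thesis) \<Longrightarrow> thesis"
  by (auto simp: blk_roles_def)

section \<open>Utilities against a fixed mixture\<close>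

lemma util_Asg:
  assumes "\<rho> \<in> RA"
  shows "util c Y \<rho> = (\<Sum>\<rho>'\<in>RA. Y \<rho>' * pay t a c f \<rho> \<rho>') - sum Y RD - sum Y RB"
proof -
  have "(\<Sum>\<rho>'\<in>RD. Y \<rho>' * pay t a c f \<rho> \<rho>') = - sum Y RD" "(\<Sum>\<rho>'\<in>RB. Y \<rho>' * pay t a c f \<rho> \<rho>') = - sum Y RB"
    unfolding sum_negf[symmetric] using assms
    by (auto simp: asg_roles_def chal_roles_def blk_roles_def intro!: sum.cong)
  thus ?thesis by (simp add: util_def sum_roles)
qed

lemma util_Chal:
  assumes "T \<subseteq> {..<t}"
  shows "util c Y (Chal T) = sum Y RA / 2 + bias Y T / 2 - sum Y RD - sum Y RB"
proof -
  have "(\<Sum>\<rho>'\<in>RD. Y \<rho>' * pay t a c f (Chal T) \<rho>') = - sum Y RD" "(\<Sum>\<rho>'\<in>RB. Y \<rho>' * pay t a c f (Chal T) \<rho>') = - sum Y RB"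
    unfolding sum_negf[symmetric]
    by (auto simp: chal_roles_def blk_roles_def intro!: sum.cong)
  moreover have "(\<Sum>\<rho>'\<in>RA. Y \<rho>' * pay t a c f (Chal T) \<rho>') = sum Y RA / 2 + bias Y T / 2"
    by (simp add: sum_asg_roles bias_def sum_divide_distrib sum_distrib_right sum_distrib_left distrib_left sum.distrib mult_ac)
  ultimately show ?thesis by (simp add: util_def sum_roles)
qed

lemma util_Blk:
  assumes "\<rho> \<in> RB"
  shows "util c Y \<rho> = 159 / 320 * (sum Y RA + sum Y RD) + (\<Sum>\<rho>'\<in>RB. Y \<rho>' * pay t a c f \<rho> \<rho>')"
proof -
  have "(\<Sum>\<rho>'\<in>RA. Y \<rho>' * pay t a c f \<rho> \<rho>') = 159 / 320 * sum Y RA" "(\<Sum>\<rho>'\<in>RD. Y \<rho>' * pay t a c f \<rho> \<rho>') = 159 / 320 * sum Y RD"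
    unfolding sum_distrib_left using assms
    by (auto simp: asg_roles_def chal_roles_def blk_roles_def intro!: sum.cong)
  thus ?thesis by (simp add: util_def sum_roles)
qed

lemma pay_Blk_nonneg:
  assumes "\<rho> \<in> RB" "\<rho>' \<in> RB"
  shows "pay t a c f \<rho> \<rho>' \<ge> 0"
proof -
  obtain k b T where 1: "\<rho> = Blk k b T" "T \<subseteq> {..<t}" using assms(1) by (rule RB_cases)
  obtain k' b' T' where 2: "\<rho>' = Blk k' b' T'" "T' \<subseteq> {..<t}" using assms(2) by (rule RB_cases)
  have "0 \<le> 1 / 2 + (x - y) / 4" if "-1 \<le> x" "y \<le> 1" for x y :: real
    using that by (simp add: field_simps)
  thus ?thesis unfolding 1(1) 2(1) pay.simps
    using bet_bounds(3,4)[OF 1(2)] bet_bounds(3,4)[OF 2(2)] by blast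
qed

lemma bias_le:
  assumes "mix_on RR X" "T \<subseteq> {..<t}"
  shows "bias X T \<le> sum X RA"
proof -
  have "bias X T \<le> (\<Sum>u<t. (\<Sum>\<alpha>\<in>Pow {..<l}. X (Asg u \<alpha>)) * 1)"
    unfolding bias_def
  proof (intro sum_mono mult_left_mono sum_nonneg)
    fix u \<alpha> assume "u \<in> {..<t}" "\<alpha> \<in> Pow {..<l}"
    thus "0 \<le> X (Asg u \<alpha>)" using assms(1) by (auto simp: mix_on_def roles_def asg_roles_def)
  qed (use assms bet_bounds in auto)
  thus ?thesis by (simp add: sum_asg_roles)
qed

lemma sum_nonblock_util:
  assumes "mix_on RR X"
  shows "(\<Sum>\<sigma>\<in>RA \<union> RD. X \<sigma> * util c Y \<sigma>) =
    win c X Y / 2 - sum X RA * (sum Y RD + sum Y RB) +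
    (\<Sum>\<sigma>\<in>RD. X \<sigma> * (util c Y \<sigma> + sum Y RD + sum Y RB)) - sum X RD * (sum Y RD + sum Y RB)"
proof -
  have "RA \<inter> RD = {}" by (auto simp: asg_roles_def chal_roles_def)
  hence "(\<Sum>\<sigma>\<in>RA \<union> RD. X \<sigma> * util c Y \<sigma>) = (\<Sum>\<sigma>\<in>RA. X \<sigma> * util c Y \<sigma>) + (\<Sum>\<sigma>\<in>RD. X \<sigma> * util c Y \<sigma>)"
    by (intro sum.union_disjoint) auto
  moreover have "(\<Sum>\<sigma>\<in>RA. X \<sigma> * util c Y \<sigma>) = win c X Y / 2 - sum X RA * (sum Y RD + sum Y RB)"
  proof -
    define e where "e = sum Y RD + sum Y RB"
    have "(\<Sum>\<sigma>\<in>RA. X \<sigma> * util c Y \<sigma>) = (\<Sum>\<sigma>\<in>RA. X \<sigma> * ((\<Sum>\<rho>'\<in>RA. Y \<rho>' * pay t a c f \<sigma> \<rho>') - e))"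
      by (intro sum.cong refl) (simp add: util_Asg e_def)
    also have "\<dots> = (\<Sum>\<sigma>\<in>RA. X \<sigma> * (\<Sum>\<rho>'\<in>RA. Y \<rho>' * pay t a c f \<sigma> \<rho>')) - sum X RA * e"
      by (simp add: right_diff_distrib sum_subtractf sum_distrib_right)
    also have "(\<Sum>\<sigma>\<in>RA. X \<sigma> * (\<Sum>\<rho>'\<in>RA. Y \<rho>' * pay t a c f \<sigma> \<rho>')) = win c X Y / 2"
      by (simp add: win_def sum_distrib_left sum_divide_distrib mult_ac)
    finally show ?thesis unfolding e_def .
  qed
  moreover have "(\<Sum>\<sigma>\<in>RD. X \<sigma> * util c Y \<sigma>) =
    (\<Sum>\<sigma>\<in>RD. X \<sigma> * (util c Y \<sigma> + sum Y RD + sum Y RB)) - sum X RD * (sum Y RD + sum Y RB)"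
    by (simp add: distrib_left sum.distrib sum_distrib_right)
  ultimately show ?thesis by simp
qed

lemma sum_Chal_util_le:
  assumes "mix_on RR X" "mix_on RR Y"
  shows "(\<Sum>\<sigma>\<in>RD. X \<sigma> * (util c Y \<sigma> + sum Y RD + sum Y RB)) \<le> sum X RD * sum Y RA"
  unfolding sum_distrib_right
proof (intro sum_mono mult_left_mono)
  fix \<sigma> assume \<sigma>: "\<sigma> \<in> RD"
  then obtain T where T: "\<sigma> = Chal T" "T \<subseteq> {..<t}" by (auto simp: chal_roles_def)
  show "util c Y \<sigma> + sum Y RD + sum Y RB \<le> sum Y RA"
    using bias_le[OF assms(2) T(2)] T by (simp add: util_Chal)
  show "0 \<le> X \<sigma>" using assms(1) \<sigma> by (auto simp: mix_on_def roles_def)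
qed

lemma bias_complement:
  assumes "T \<subseteq> {..<t}"
  shows "bias X ({..<t} - T) = - bias X T"
proof -
  have "card ({..<t} - T) = t - card T" "card T \<le> t"
    using card_Diff_subset[OF finite_subset[OF assms] assms] card_mono[OF _ assms] by auto
  hence "bet t u ({..<t} - T) = - bet t u T" if "u < t" for u
    using that t_pos by (auto simp: bet_def field_simps)
  thus ?thesis by (simp add: bias_def sum_negf[symmetric])
qed

text \<open>Rounding mixed labels to pure ones does not increase the failure mass, and pure labels
  fail on a sixteenth of all pairs. Passing from uniform questions to the real marginals costs at
  most the bias of each player times the mass of the other.\<close>

lemma win_le:
  assumes "mix_on RR X" "mix_on RR Y" "hard c"
    and "\<And>T. T \<subseteq> {..<t} \<Longrightarrow> bias X T \<le> \<delta>" "\<And>T. T \<subseteq> {..<t} \<Longrightarrow> bias Y T \<le> \<delta>'"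
  shows "win c X Y \<le> 15 / 16 * (sum X RA * sum Y RA) + sum Y RA * \<delta> + sum X RA * \<delta>'"
proof -
  define mm where "mm u \<alpha> v \<beta> = (if mismatch a c u \<alpha> v \<beta> then 1 else 0 :: real)" for u \<alpha> v \<beta>
  define x where "x u = (\<Sum>\<alpha>\<in>Pow {..<l}. X (Asg u \<alpha>))" for u
  define y where "y v = (\<Sum>\<beta>\<in>Pow {..<l}. Y (Asg v \<beta>))" for v
  have X0: "X (Asg u \<alpha>) \<ge> 0" if "u < t" "\<alpha> \<in> Pow {..<l}" for u \<alpha>
    using assms(1) that by (auto simp: mix_on_def roles_def asg_roles_def)
  have Y0: "Y (Asg u \<alpha>) \<ge> 0" if "u < t" "\<alpha> \<in> Pow {..<l}" for u \<alpha>
    using assms(2) that by (auto simp: mix_on_def roles_def asg_roles_def)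
  have x0: "x u \<ge> 0" and y0: "y u \<ge> 0" if "u < t" for u
    using X0 Y0 that by (auto simp: x_def y_def intro!: sum_nonneg)
  have sx: "sum X RA = (\<Sum>u<t. x u)" and sy: "sum Y RA = (\<Sum>u<t. y u)"
    by (simp_all add: sum_asg_roles x_def y_def)
  have biasX: "bias X T = (\<Sum>u<t. x u * bet t u T)" for T by (simp add: bias_def x_def)
  have biasY: "bias Y T = (\<Sum>u<t. y u * bet t u T)" for T by (simp add: bias_def y_def)
  have mass: "(\<Sum>u\<in>T. x u) = sum X RA * (card T / t) + bias X T" 
      "(\<Sum>u\<in>T. y u) = sum Y RA * (card T / t) + bias Y T" if T: "T \<subseteq> {..<t}" for T
  proof -
    have *: "(\<Sum>u\<in>T. w u) = (\<Sum>u<t. w u) * (card T / t) + (\<Sum>u<t. w u * bet t u T)" for w :: "nat \<Rightarrow> real"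
    proof -
      have "(\<Sum>u<t. w u * bet t u T) = (\<Sum>u<t. if u \<in> T then w u else 0) - (\<Sum>u<t. w u) * (card T / t)"
        unfolding sum_distrib_right sum_subtractf[symmetric]
        by (intro sum.cong) (auto simp: bet_def right_diff_distrib)
      also have "(\<Sum>u<t. if u \<in> T then w u else 0) = (\<Sum>u\<in>T. w u)"
        using T by (simp add: sum.If_cases Int_absorb1)
      finally show ?thesis by simp
    qed
    show "(\<Sum>u\<in>T. x u) = sum X RA * (card T / t) + bias X T" 
      "(\<Sum>u\<in>T. y u) = sum Y RA * (card T / t) + bias Y T"
      unfolding sx sy biasX biasY by (rule *)+
  qed
  have lower: "bias X T \<ge> - \<delta>" "bias Y T \<ge> - \<delta>'" if "T \<subseteq> {..<t}" for T
    using assms(4,5)[of "{..<t} - T"] bias_complement[OF that] by auto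
  define W where "W u \<alpha> = (\<Sum>v<t. \<Sum>\<beta>\<in>Pow {..<l}. Y (Asg v \<beta>) * mm u \<alpha> v \<beta>)" for u \<alpha>
  \<comment> \<open>Each row question gets the label that fails least against \<open>Y\<close>;
    below, each column question gets the label that fails least against these row labels.\<close>
  define F where "F u = arg_min_on (W u) (Pow {..<l})" for u
  have F: "W u (F u) \<le> W u \<alpha>" if "\<alpha> \<in> Pow {..<l}" for u \<alpha>
    unfolding F_def using that by (intro arg_min_least) auto
  define W' where "W' v \<beta> = (\<Sum>u<t. x u * mm u (F u) v \<beta>)" for v \<beta>
  define G where "G v = arg_min_on (W' v) (Pow {..<l})" for v
  have G: "W' v (G v) \<le> W' v \<beta>" if "\<beta> \<in> Pow {..<l}" for v \<beta>
    unfolding G_def using that by (intro arg_min_least) auto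
  define Bad where "Bad = {(u, v). u < t \<and> v < t \<and> mismatch a c u (F u) v (G v)}"
  define col where "col v = {u. u < t \<and> mismatch a c u (F u) v (G v)}" for v
  define row where "row u = {v. v < t \<and> mismatch a c u (F u) v (G v)}" for u
  have col_sub: "col v \<subseteq> {..<t}" and row_sub: "row u \<subseteq> {..<t}" for u v by (auto simp: col_def row_def)
  have Bad: "Bad = (SIGMA u:{..<t}. row u)" by (auto simp: Bad_def row_def)
  have "real (card Bad) = (\<Sum>u<t. real (card (row u)))"
    unfolding Bad by (subst card_SigmaI) (auto simp: row_def)
  hence cardBad: "(\<Sum>u<t. real (card (row u))) \<ge> real t ^ 2 / 16"
    using assms(3)[unfolded hard_def, THEN spec, THEN spec, of F G] unfolding Bad_def by simp
  \<comment> \<open>Uniform column questions are replaced by the marginal \<open>y\<close>, row by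
    row, while row questions stay uniform.\<close>
  have "sum X RA * sum Y RA / 16 - sum X RA * \<delta>' = sum X RA * sum Y RA * (real t ^ 2 / 16) / real t ^ 2 - sum X RA * \<delta>'"
    using t_pos by simp
  also have "\<dots> \<le> sum X RA * sum Y RA * (\<Sum>u<t. real (card (row u))) / real t ^ 2 - sum X RA * \<delta>'"
    using cardBad x0 y0 unfolding sx sy
    by (intro diff_right_mono divide_right_mono mult_left_mono mult_nonneg_nonneg sum_nonneg) auto
  also have "\<dots> = sum X RA / t * (\<Sum>u<t. sum Y RA * (card (row u) / t) - \<delta>')"
  proof -
    have "(\<Sum>u<t. sum Y RA * (card (row u) / t) - \<delta>') = sum Y RA * (\<Sum>u<t. real (card (row u))) / t - t * \<delta>'"
      by (simp add: sum_subtractf sum_distrib_left sum_divide_distrib)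
    thus ?thesis using t_pos by (simp add: power2_eq_square right_diff_distrib)
  qed
  also have "\<dots> \<le> sum X RA / t * (\<Sum>u<t. \<Sum>v\<in>row u. y v)"
    unfolding sx using x0
  proof (intro mult_left_mono sum_mono divide_nonneg_nonneg sum_nonneg)
    fix u
    show "sum Y RA * (card (row u) / t) - \<delta>' \<le> (\<Sum>v\<in>row u. y v)"
      using mass(2)[OF row_sub, of u] lower(2)[OF row_sub, of u] by linarith
  qed auto
  also have "(\<Sum>u<t. \<Sum>v\<in>row u. y v) = (\<Sum>u<t. \<Sum>v<t. y v * mm u (F u) v (G v))"
    using row_sub
    by (intro arg_cong2[where f = "(*)"] sum.cong refl sum.mono_neutral_cong_left) (auto simp: row_def mm_def)
  also have "\<dots> = (\<Sum>v<t. \<Sum>u<t. y v * mm u (F u) v (G v))" by (rule sum.swap)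
  also have "\<dots> = (\<Sum>v<t. y v * card (col v))"
  proof (intro sum.cong refl)
    fix v
    have "(\<Sum>u<t. mm u (F u) v (G v)) = (\<Sum>u\<in>col v. 1)"
      by (rule sum.mono_neutral_cong_right) (auto simp: col_def mm_def)
    thus "(\<Sum>u<t. y v * mm u (F u) v (G v)) = y v * card (col v)" by (simp flip: sum_distrib_left)
  qed
  finally have 1: "sum X RA * sum Y RA / 16 - sum X RA * \<delta>' \<le> sum X RA / t * (\<Sum>v<t. y v * card (col v))" .
  \<comment> \<open>Now the uniform row questions are replaced by \<open>x\<close>, column by
    column; afterwards the rounding of \<open>G\<close> and \<open>F\<close> is undone.\<close>
  have "sum X RA / t * (\<Sum>v<t. y v * card (col v)) - sum Y RA * \<delta> = (\<Sum>v<t. y v * (sum X RA * (card (col v) / t) - \<delta>))"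
    unfolding sy right_diff_distrib sum_subtractf
    by (simp add: sum_distrib_right sum_distrib_left mult_ac)
  also have "\<dots> \<le> (\<Sum>v<t. y v * (\<Sum>u\<in>col v. x u))"
  proof (intro sum_mono mult_left_mono)
    fix v
    show "sum X RA * (card (col v) / t) - \<delta> \<le> (\<Sum>u\<in>col v. x u)"
      using mass(1)[OF col_sub, of v] lower(1)[OF col_sub, of v] by linarith
  qed (use y0 in auto)
  also have "\<dots> = (\<Sum>v<t. y v * W' v (G v))"
    unfolding W'_def
    by (intro sum.cong refl arg_cong2[where f = "(*)"] sum.mono_neutral_cong_left) (auto simp: col_def mm_def)
  also have "\<dots> = (\<Sum>v<t. \<Sum>\<beta>\<in>Pow {..<l}. Y (Asg v \<beta>) * W' v (G v))"
    by (simp add: y_def sum_distrib_right)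
  also have "\<dots> \<le> (\<Sum>v<t. \<Sum>\<beta>\<in>Pow {..<l}. Y (Asg v \<beta>) * W' v \<beta>)"
    using Y0 G by (intro sum_mono mult_left_mono) auto
  also have "\<dots> = (\<Sum>v<t. \<Sum>\<beta>\<in>Pow {..<l}. \<Sum>u<t. Y (Asg v \<beta>) * (x u * mm u (F u) v \<beta>))"
    by (simp add: W'_def sum_distrib_left)
  also have "\<dots> = (\<Sum>v<t. \<Sum>u<t. \<Sum>\<beta>\<in>Pow {..<l}. Y (Asg v \<beta>) * (x u * mm u (F u) v \<beta>))"
    by (intro sum.cong refl sum.swap)
  also have "\<dots> = (\<Sum>u<t. \<Sum>v<t. \<Sum>\<beta>\<in>Pow {..<l}. Y (Asg v \<beta>) * (x u * mm u (F u) v \<beta>))"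
    by (rule sum.swap)
  also have "\<dots> = (\<Sum>u<t. x u * W u (F u))"
    by (simp add: W_def sum_distrib_left mult_ac)
  also have "\<dots> = (\<Sum>u<t. \<Sum>\<alpha>\<in>Pow {..<l}. X (Asg u \<alpha>) * W u (F u))"
    by (simp add: x_def sum_distrib_right)
  also have "\<dots> \<le> (\<Sum>u<t. \<Sum>\<alpha>\<in>Pow {..<l}. X (Asg u \<alpha>) * W u \<alpha>)"
    using X0 F by (intro sum_mono mult_left_mono) auto
  also have "\<dots> = (\<Sum>\<rho>\<in>RA. \<Sum>\<rho>'\<in>RA. X \<rho> * Y \<rho>' * (1 - 2 * pay t a c f \<rho> \<rho>'))"
    unfolding sum_asg_roles W_def sum_distrib_left
    by (intro sum.cong refl) (simp add: mm_def)
  also have "\<dots> = sum X RA * sum Y RA - win c X Y"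
    by (simp add: win_def right_diff_distrib sum_subtractf sum_product)
  finally show ?thesis using 1 by (simp add: mult.commute)
qed

end

definition blk_bet :: "nat \<Rightarrow> (nat \<Rightarrow> nat) \<Rightarrow> nat set \<Rightarrow> role \<Rightarrow> real" where
  "blk_bet t f T \<rho> = (case \<rho> of Blk k b T' \<Rightarrow> hidden_bet t f k b T | _ \<Rightarrow> 0)"

text \<open>A condition on one player's strategy alone, so that it also controls the partial oracle.
  The empty bet forces the pairs to lie almost on the graph, the other bets force the first
  components to be almost uniform.\<close>

definition near_hidden :: "nat \<Rightarrow> nat \<Rightarrow> real \<Rightarrow> (nat \<Rightarrow> nat) \<Rightarrow> (role \<Rightarrow> real) \<Rightarrow> bool" where
  "near_hidden t Q \<epsilon> f X \<longleftrightarrow> sum X (blk_roles t Q) \<ge> 1 - 2 * \<epsilon> \<and>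
     (\<forall>T. T \<subseteq> {..<t} \<longrightarrow> (\<Sum>\<rho>\<in>blk_roles t Q. X \<rho> * blk_bet t f T \<rho>) \<le> 16 * \<epsilon>)"

context role_game
begin

abbreviation "flip c \<equiv> (\<lambda>u v. c v u)"

section \<open>Little mass outside the second game\<close>

lemma best_part:
  assumes "mix_on RR X" "best_response \<epsilon> c X Y" "P \<subseteq> RR" "\<rho> \<in> RR"
  shows "(\<Sum>\<sigma>\<in>P. X \<sigma> * util c Y \<sigma>) \<ge> sum X P * util c Y \<rho> - \<epsilon>"
  using deviation_part[of RR X "util c Y" \<epsilon> P \<rho>] assms by (simp add: best_response_def)

lemma mix_nonneg:
  assumes "mix_on RR X"
  shows "0 \<le> sum X RA" "0 \<le> sum X RD" "0 \<le> sum X RB" "sum X RB = 1 - (sum X RA + sum X RD)"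
    "sum X (RA \<union> RD) = sum X RA + sum X RD"
proof -
  show "0 \<le> sum X RA" "0 \<le> sum X RD" "0 \<le> sum X RB"
    using assms by (auto simp: mix_on_def roles_def intro!: sum_nonneg)
  show "sum X RB = 1 - (sum X RA + sum X RD)"
    using assms sum_roles[of X t l Q] by (simp add: mix_on_def)
  show "sum X (RA \<union> RD) = sum X RA + sum X RD"
    by (intro sum.union_disjoint) (auto simp: asg_roles_def chal_roles_def)
qed

lemma Blk_in_RB: "k < t \<Longrightarrow> T \<subseteq> {..<t} \<Longrightarrow> Blk k (f k) T \<in> RB"
  using f_less unfolding blk_roles_def by (intro image_eqI[of _ _ "(k, f k, T)"]) auto

lemma util_Blk_ge:
  assumes "mix_on RR Y" "\<rho> \<in> RB"
  shows "util c Y \<rho> \<ge> 159 / 320 * (sum Y RA + sum Y RD)"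
proof -
  have "(\<Sum>\<rho>'\<in>RB. Y \<rho>' * pay t a c f \<rho> \<rho>') \<ge> 0"
    using assms pay_Blk_nonneg by (intro sum_nonneg mult_nonneg_nonneg) (auto simp: mix_on_def roles_def)
  thus ?thesis using assms(2) by (simp add: util_Blk)
qed

lemma win_le_product:
  assumes "mix_on RR X" "mix_on RR Y"
  shows "win c X Y \<le> sum X RA * sum Y RA"
proof -
  have "win c X Y \<le> (\<Sum>\<rho>\<in>RA. \<Sum>\<rho>'\<in>RA. X \<rho> * Y \<rho>' * 1)"
    unfolding win_def
  proof (intro sum_mono mult_left_mono mult_nonneg_nonneg)
    fix \<rho> \<rho>' assume "\<rho> \<in> RA" "\<rho>' \<in> RA"
    thus "2 * pay t a c f \<rho> \<rho>' \<le> 1" "0 \<le> X \<rho>" "0 \<le> Y \<rho>'"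
      using assms by (auto simp: mix_on_def roles_def asg_roles_def)
  qed
  thus ?thesis by (simp add: sum_product)
qed

lemma win_flip: "win (flip c) Y X = win c X Y"
proof -
  have "pay t a (flip c) f \<rho>' \<rho> = pay t a c f \<rho> \<rho>'" if "\<rho> \<in> RA" "\<rho>' \<in> RA" for \<rho> \<rho>'
    using that by (auto simp: asg_roles_def mismatch_def mult.commute)
  hence "win c X Y = (\<Sum>\<rho>\<in>RA. \<Sum>\<rho>'\<in>RA. Y \<rho>' * X \<rho> * (2 * pay t a (flip c) f \<rho>' \<rho>))"
    unfolding win_def by (intro sum.cong refl) simp
  also have "\<dots> = win (flip c) Y X"
    unfolding win_def by (rule sum.swap)
  finally show ?thesis ..
qed

text \<open>Three ways to improve on the part outside the second game: moving to a
  \<open>Blk\<close> role, which earns 159/320 there; challenging \<open>T\<close>; and, for the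
  last bound, a \<open>Blk\<close> role again, whose utility is nonnegative while the others lose at
  least 1 against every \<open>Blk\<close> role.\<close>

lemma nonblock_one_sided:
  assumes "mix_on RR X" "mix_on RR Y" "best_response \<epsilon> c X Y"
  defines "\<xi> \<equiv> sum X RA + sum X RD" and "\<upsilon> \<equiv> sum Y RA + sum Y RD"
  shows "win c X Y / 2 - sum X RA * sum Y RD + sum X RD * sum Y RA \<ge> 159 / 320 * (\<xi> * \<upsilon>) - \<epsilon>"
    and "T \<subseteq> {..<t} \<Longrightarrow> \<xi> * bias Y T \<le> sum X RD * sum Y RA + 2 * \<epsilon>"
    and "\<xi> - 2 * (\<xi> * \<upsilon>) \<le> \<epsilon>"
proof -
  define B where "B = sum Y RB"
  have P: "RA \<union> RD \<subseteq> RR" by (auto simp: roles_def)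
  have \<xi>: "sum X (RA \<union> RD) = \<xi>" "\<xi> \<ge> 0" using mix_nonneg[OF assms(1)] by (simp_all add: \<xi>_def)
  have nn: "0 \<le> sum X RA" "0 \<le> sum X RD" "0 \<le> sum Y RA" "0 \<le> sum Y RD" "0 \<le> B" "B = 1 - \<upsilon>"
    using mix_nonneg[OF assms(1)] mix_nonneg[OF assms(2)] by (simp_all add: B_def \<upsilon>_def)
  have upper: "(\<Sum>\<sigma>\<in>RA \<union> RD. X \<sigma> * util c Y \<sigma>) \<le>
      win c X Y / 2 - \<xi> * sum Y RD + sum X RD * sum Y RA - \<xi> * B"
    using sum_nonblock_util[OF assms(1), of c Y] sum_Chal_util_le[OF assms(1,2), of c]
    by (simp add: \<xi>_def B_def algebra_simps)
  have blk: "Blk 0 (f 0) {} \<in> RB" using t_pos by (intro Blk_in_RB) auto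
  hence blk': "Blk 0 (f 0) {} \<in> RR" by (simp add: roles_def)
  have "\<xi> * (159 / 320 * \<upsilon>) \<le> \<xi> * util c Y (Blk 0 (f 0) {})"
    using util_Blk_ge[OF assms(2) blk, of c] \<xi>(2) by (intro mult_left_mono) (auto simp: \<upsilon>_def)
  also have "\<dots> \<le> (\<Sum>\<sigma>\<in>RA \<union> RD. X \<sigma> * util c Y \<sigma>) + \<epsilon>"
    using best_part[OF assms(1,3) P blk'] \<xi>(1) by simp
  finally have lower: "\<xi> * (159 / 320 * \<upsilon>) \<le> (\<Sum>\<sigma>\<in>RA \<union> RD. X \<sigma> * util c Y \<sigma>) + \<epsilon>" .
  have "\<xi> * B \<ge> 0" "sum X RD * sum Y RD \<ge> 0" using \<xi>(2) nn by simp_all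
  show "win c X Y / 2 - sum X RA * sum Y RD + sum X RD * sum Y RA \<ge> 159 / 320 * (\<xi> * \<upsilon>) - \<epsilon>"
  proof -
    have "\<xi> * (159 / 320 * \<upsilon>) = 159 / 320 * (\<xi> * \<upsilon>)" by simp
    moreover have "\<xi> * sum Y RD = sum X RA * sum Y RD + sum X RD * sum Y RD"
      by (simp add: \<xi>_def distrib_right)
    ultimately show ?thesis
      using lower upper \<open>\<xi> * B \<ge> 0\<close> \<open>sum X RD * sum Y RD \<ge> 0\<close> by linarith
  qed
  show "\<xi> * bias Y T \<le> sum X RD * sum Y RA + 2 * \<epsilon>" if T: "T \<subseteq> {..<t}"
  proof -
    have "Chal T \<in> RR" using T by (auto simp: roles_def chal_roles_def)
    from best_part[OF assms(1,3) P this]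
    have "\<xi> * (sum Y RA / 2 + bias Y T / 2 - sum Y RD - B) \<le> (\<Sum>\<sigma>\<in>RA \<union> RD. X \<sigma> * util c Y \<sigma>) + \<epsilon>"
      using \<xi>(1) T by (simp add: util_Chal B_def)
    hence "\<xi> * bias Y T \<le> win c X Y + 2 * (sum X RD * sum Y RA) - \<xi> * sum Y RA + 2 * \<epsilon>"
      using upper by (simp add: algebra_simps)
    thus ?thesis using win_le_product[OF assms(1,2), of c] by (simp add: \<xi>_def algebra_simps)
  qed
  have "util c Y \<sigma> \<le> \<upsilon> - B" if \<sigma>: "\<sigma> \<in> RA \<union> RD" for \<sigma>
  proof (cases "\<sigma> \<in> RA")
    case True
    have "(\<Sum>\<rho>'\<in>RA. Y \<rho>' * pay t a c f \<sigma> \<rho>') \<le> (\<Sum>\<rho>'\<in>RA. Y \<rho>' * 1)"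
      using assms(2) True pay_bounds(2)[of \<sigma> t l Q] by (intro sum_mono mult_left_mono) (auto simp: roles_def mix_on_def)
    thus ?thesis using True nn by (simp add: util_Asg B_def \<upsilon>_def)
  next
    case False
    then obtain T where "\<sigma> = Chal T" "T \<subseteq> {..<t}" using \<sigma> by (auto simp: chal_roles_def)
    thus ?thesis using bias_le[OF assms(2), of T] nn by (simp add: util_Chal B_def \<upsilon>_def)
  qed
  hence "(\<Sum>\<sigma>\<in>RA \<union> RD. X \<sigma> * util c Y \<sigma>) \<le> (\<Sum>\<sigma>\<in>RA \<union> RD. X \<sigma> * (\<upsilon> - B))"
    using assms(1) by (intro sum_mono mult_left_mono) (auto simp: roles_def mix_on_def)
  also have "\<dots> = \<xi> * (\<upsilon> - B)" by (simp add: \<xi>(1) flip: sum_distrib_right)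
  finally have "\<xi> * (159 / 320 * \<upsilon>) \<le> \<xi> * (\<upsilon> - B) + \<epsilon>" using lower by linarith
  moreover have "0 \<le> \<xi> * (159 / 320 * \<upsilon>)" using \<xi>(2) nn by (simp add: \<upsilon>_def)
  ultimately have "0 \<le> \<xi> * (\<upsilon> - B) + \<epsilon>" by linarith
  thus "\<xi> - 2 * (\<xi> * \<upsilon>) \<le> \<epsilon>" unfolding nn(6) by (simp add: algebra_simps)
qed

lemma bias_empty: "bias X {} = 0"
  by (simp add: bias_def bet_def)

lemma nonblock_product_le:
  assumes X: "mix_on RR X" and Y: "mix_on RR Y" and "\<epsilon> \<ge> 0"
    and bX: "best_response \<epsilon> c X Y" and bY: "best_response \<epsilon> (flip c) Y X" and "hard c"
  shows "(sum X RA + sum X RD) * (sum Y RA + sum Y RD) \<le> 640 * \<epsilon>"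
proof -
  define \<xi> \<upsilon> where "\<xi> = sum X RA + sum X RD" and "\<upsilon> = sum Y RA + sum Y RD"
  note nn = mix_nonneg[OF X] mix_nonneg[OF Y]
  note R = nonblock_one_sided[OF X Y bX, folded \<xi>_def \<upsilon>_def]
  note C = nonblock_one_sided[OF Y X bY, folded \<xi>_def \<upsilon>_def, unfolded win_flip[of c Y X]]
  have prods: "0 \<le> sum X RA * sum Y RD" "0 \<le> sum X RD * sum Y RA" "0 \<le> sum X RD * sum Y RD"
    using nn by simp_all
  have split: "\<xi> * \<upsilon> = sum X RA * sum Y RA + sum X RA * sum Y RD + sum X RD * sum Y RA + sum X RD * sum Y RD"
    by (simp add: \<xi>_def \<upsilon>_def algebra_simps)
  \<comment> \<open>The mixed terms between assignments and challenges cancel when the inequalities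
    of both players are added.\<close>
  have win: "win c X Y \<ge> 159 / 160 * (\<xi> * \<upsilon>) - 2 * \<epsilon>"
    using R(1) C(1) by (simp add: mult.commute)
  \<comment> \<open>The masses of pairs involving a challenge are missing from \<open>win\<close>,
    so they sum to at most \<open>\<xi> * \<upsilon> / 160 + 2 * \<epsilon>\<close>; the bias bounds
    add another \<open>2 * \<epsilon>\<close>.\<close>
  define \<eta> where "\<eta> = \<xi> * \<upsilon> / 160 + 4 * \<epsilon>"
  have \<eta>: "sum X RD * sum Y RA + 2 * \<epsilon> \<le> \<eta>" "sum Y RD * sum X RA + 2 * \<epsilon> \<le> \<eta>"
    unfolding \<eta>_def using win win_le_product[OF X Y, of c] prods split mult.commute[of "sum Y RD" "sum X RA"]
    by linarith+
  \<comment> \<open>Only products of mass and bias are controlled. The largest bias itself therefore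
    serves as bound in \<open>win_le\<close>, which avoids division by a mass that may
    vanish.\<close>
  have max: "\<exists>T0. T0 \<subseteq> {..<t} \<and> 0 \<le> bias W T0 \<and> (\<forall>T. T \<subseteq> {..<t} \<longrightarrow> bias W T \<le> bias W T0)" for W
  proof -
    have fin: "finite (bias W ` Pow {..<t})" "bias W ` Pow {..<t} \<noteq> {}" by auto
    from Max_in[OF fin] obtain T0 where T0: "T0 \<in> Pow {..<t}" "Max (bias W ` Pow {..<t}) = bias W T0"
      by (rule imageE) blast
    have "bias W T \<le> bias W T0" if "T \<subseteq> {..<t}" for T
      unfolding T0(2)[symmetric] using that fin by (intro Max_ge) auto
    moreover from this[of "{}"] have "0 \<le> bias W T0" by (simp add: bias_empty)
    ultimately show ?thesis using T0(1) by (intro exI[of _ T0]) simp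
  qed
  obtain TX where TX: "TX \<subseteq> {..<t}" "0 \<le> bias X TX" "\<And>T. T \<subseteq> {..<t} \<Longrightarrow> bias X T \<le> bias X TX"
    using max[of X] by blast
  obtain TY where TY: "TY \<subseteq> {..<t}" "0 \<le> bias Y TY" "\<And>T. T \<subseteq> {..<t} \<Longrightarrow> bias Y T \<le> bias Y TY"
    using max[of Y] by blast
  have "sum Y RA * bias X TX \<le> \<upsilon> * bias X TX"
    using TX(2) nn by (intro mult_right_mono) (auto simp: \<upsilon>_def)
  also have "\<dots> \<le> \<eta>" using C(2)[OF TX(1)] \<eta> by (simp add: mult.commute)
  finally have 1: "sum Y RA * bias X TX \<le> \<eta>" .
  have "sum X RA * bias Y TY \<le> \<xi> * bias Y TY"
    using TY(2) nn by (intro mult_right_mono) (auto simp: \<xi>_def)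
  also have "\<dots> \<le> \<eta>" using R(2)[OF TY(1)] \<eta> by simp
  finally have 2: "sum X RA * bias Y TY \<le> \<eta>" .
  have "win c X Y \<le> 15 / 16 * (sum X RA * sum Y RA) + sum Y RA * bias X TX + sum X RA * bias Y TY"
    using TX(3) TY(3) by (intro win_le[OF X Y \<open>hard c\<close>])
  hence "win c X Y \<le> 15 / 16 * (\<xi> * \<upsilon>) + 2 * \<eta>"
    using 1 2 prods split by linarith
  \<comment> \<open>The margin is 159/160 - 150/160 - 2/160.\<close>
  moreover have "7 / 160 * p \<le> 10 * \<epsilon>"
    if "w \<le> 15 / 16 * p + 2 * (p / 160 + 4 * \<epsilon>)" "159 / 160 * p - 2 * \<epsilon> \<le> w" for w p
    using that by (simp add: field_simps)
  ultimately have "7 / 160 * (\<xi> * \<upsilon>) \<le> 10 * \<epsilon>" using win unfolding \<eta>_def by blast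
  thus ?thesis using \<open>\<epsilon> \<ge> 0\<close> unfolding \<xi>_def[symmetric] \<upsilon>_def[symmetric] by linarith
qed

text \<open>Bootstrapping: the bound on the product gives
  \<open>\<upsilon> \<le> 1281 * \<epsilon>\<close>, so \<open>\<upsilon>\<close> is below 1/4, and
  the quadratic term then absorbs at most half of \<open>\<xi>\<close>.\<close>

lemma nonblock_small:
  assumes X: "mix_on RR X" and Y: "mix_on RR Y" and \<epsilon>: "0 \<le> \<epsilon>" "\<epsilon> \<le> 1 / 20000"
    and bX: "best_response \<epsilon> c X Y" and bY: "best_response \<epsilon> (flip c) Y X" and "hard c"
  shows "sum X RA + sum X RD \<le> 2 * \<epsilon>"
proof -
  define \<xi> \<upsilon> where "\<xi> = sum X RA + sum X RD" and "\<upsilon> = sum Y RA + sum Y RD"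
  have nn: "0 \<le> \<xi>" "0 \<le> \<upsilon>" using mix_nonneg[OF X] mix_nonneg[OF Y] by (simp_all add: \<xi>_def \<upsilon>_def)
  have prod: "\<xi> * \<upsilon> \<le> 640 * \<epsilon>"
    using nonblock_product_le[OF X Y \<epsilon>(1) bX bY \<open>hard c\<close>] by (simp add: \<xi>_def \<upsilon>_def)
  have x: "\<xi> - 2 * (\<xi> * \<upsilon>) \<le> \<epsilon>" and y: "\<upsilon> - 2 * (\<upsilon> * \<xi>) \<le> \<epsilon>"
    using nonblock_one_sided(3)[OF X Y bX] nonblock_one_sided(3)[OF Y X bY] by (simp_all add: \<xi>_def \<upsilon>_def)
  have "\<upsilon> \<le> 1 / 4" using y prod \<epsilon> by (simp add: mult.commute)
  hence "\<xi> * \<upsilon> \<le> \<xi> * (1 / 4)" using nn by (intro mult_left_mono) auto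
  hence "\<xi> / 2 \<le> \<epsilon>" using x by simp
  thus ?thesis by (simp add: \<xi>_def)
qed

section \<open>Constant-sum play in the second game\<close>

lemma pay_sum_le:
  assumes "\<rho> \<in> RR" "\<rho>' \<in> RR"
  shows "pay t a c f \<rho> \<rho>' + pay t a (flip c) f \<rho>' \<rho> \<le> 1"
proof -
  have Chal: "bet t k T \<le> 1" if "Chal T \<in> RR" for k T
    using that by (intro bet_bounds) (auto simp: roles_def asg_roles_def chal_roles_def blk_roles_def)
  show ?thesis
  proof (cases \<rho>)
    case 1: (Asg u \<alpha>)
    show ?thesis
    proof (cases \<rho>')
      case 2: (Chal T)
      show ?thesis using Chal[of T u] assms(2) by (simp add: 1 2)
    qed (simp_all add: 1)
  next
    case 1: (Chal T)
    show ?thesis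
    proof (cases \<rho>')
      case 2: (Asg v \<beta>)
      show ?thesis using Chal[of T v] assms(1) by (simp add: 1 2)
    qed (simp_all add: 1)
  next
    case 1: (Blk k b T)
    show ?thesis
    proof (cases \<rho>')
      \<comment> \<open>Here equality holds: the bets of the two players cancel.\<close>
      case 2: (Blk k' b' T')
      show ?thesis unfolding 1 2 pay.simps by (simp add: field_simps)
    qed (simp_all add: 1)
  qed
qed

lemma total_util_le_1:
  assumes "mix_on RR X" "mix_on RR Y"
  shows "(\<Sum>\<rho>\<in>RR. X \<rho> * util c Y \<rho>) + (\<Sum>\<rho>'\<in>RR. Y \<rho>' * util (flip c) X \<rho>') \<le> 1"
proof -
  have "(\<Sum>\<rho>'\<in>RR. Y \<rho>' * util (flip c) X \<rho>') = (\<Sum>\<rho>'\<in>RR. \<Sum>\<rho>\<in>RR. X \<rho> * Y \<rho>' * pay t a (flip c) f \<rho>' \<rho>)"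
    by (simp add: util_def sum_distrib_left mult_ac)
  also have "\<dots> = (\<Sum>\<rho>\<in>RR. \<Sum>\<rho>'\<in>RR. X \<rho> * Y \<rho>' * pay t a (flip c) f \<rho>' \<rho>)"
    by (rule sum.swap)
  finally have "(\<Sum>\<rho>\<in>RR. X \<rho> * util c Y \<rho>) + (\<Sum>\<rho>'\<in>RR. Y \<rho>' * util (flip c) X \<rho>')
      = (\<Sum>\<rho>\<in>RR. \<Sum>\<rho>'\<in>RR. X \<rho> * Y \<rho>' * (pay t a c f \<rho> \<rho>' + pay t a (flip c) f \<rho>' \<rho>))"
    by (simp add: util_def sum_distrib_left distrib_left sum.distrib mult_ac)
  also have "\<dots> \<le> (\<Sum>\<rho>\<in>RR. \<Sum>\<rho>'\<in>RR. X \<rho> * Y \<rho>' * 1)"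
    using assms pay_sum_le by (intro sum_mono mult_left_mono mult_nonneg_nonneg) (auto simp: mix_on_def)
  also have "\<dots> = 1" using assms by (simp add: mix_on_def flip: sum_product)
  finally show ?thesis .
qed

text \<open>The deviator plays \<open>Blk k (f k) T\<close> for a uniform \<open>k\<close>. This
  stays on the graph, so the bets of the opponent average to zero and only the deviator's own bet
  remains.\<close>

lemma block_deviation:
  assumes "mix_on RR Y" "best_response \<epsilon> c X Y" "T \<subseteq> {..<t}"
  shows "(\<Sum>\<sigma>\<in>RR. X \<sigma> * util c Y \<sigma>) \<ge> sum Y RB / 2 + (\<Sum>\<rho>\<in>RB. Y \<rho> * blk_bet t f T \<rho>) / 4 - \<epsilon>"
proof -
  define w where "w = (\<Sum>\<sigma>\<in>RR. X \<sigma> * util c Y \<sigma>)"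
  define g where "g k \<rho> = (case \<rho> of Blk k' b' T' \<Rightarrow> bet t k T' | _ \<Rightarrow> 0)" for k \<rho>
  have "sum Y RB / 2 + (\<Sum>\<rho>\<in>RB. Y \<rho> * blk_bet t f T \<rho>) / 4 - (\<Sum>\<rho>\<in>RB. Y \<rho> * g k \<rho>) / 4 \<le> w + \<epsilon>"
    if k: "k < t" for k
  proof -
    have in_RB: "Blk k (f k) T \<in> RB" using k assms(3) by (rule Blk_in_RB)
    have "(\<Sum>\<rho>\<in>RB. Y \<rho> * pay t a c f (Blk k (f k) T) \<rho>) =
       (\<Sum>\<rho>\<in>RB. Y \<rho> / 2 + Y \<rho> * blk_bet t f T \<rho> / 4 - Y \<rho> * g k \<rho> / 4)"
    proof (intro sum.cong refl)
      fix \<rho> assume "\<rho> \<in> RB"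
      then obtain k' b' T' where "\<rho> = Blk k' b' T'" by (rule RB_cases)
      moreover have "hidden_bet t f k (f k) T' = bet t k T'" by (simp add: hidden_bet_def bet_def)
      ultimately show "Y \<rho> * pay t a c f (Blk k (f k) T) \<rho> = Y \<rho> / 2 + Y \<rho> * blk_bet t f T \<rho> / 4 - Y \<rho> * g k \<rho> / 4"
        by (simp add: blk_bet_def g_def algebra_simps add_divide_distrib diff_divide_distrib)
    qed
    hence "util c Y (Blk k (f k) T) \<ge> sum Y RB / 2 + (\<Sum>\<rho>\<in>RB. Y \<rho> * blk_bet t f T \<rho>) / 4 - (\<Sum>\<rho>\<in>RB. Y \<rho> * g k \<rho>) / 4"
      using util_Blk[OF in_RB, of c Y] mix_nonneg(1,2)[OF assms(1)]
      by (simp add: sum.distrib sum_subtractf sum_divide_distrib)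
    moreover have "Blk k (f k) T \<in> RR" using in_RB by (simp add: roles_def)
    ultimately show ?thesis using assms(2) unfolding best_response_def w_def by fastforce
  qed
  hence "(\<Sum>k<t. sum Y RB / 2 + (\<Sum>\<rho>\<in>RB. Y \<rho> * blk_bet t f T \<rho>) / 4 - (\<Sum>\<rho>\<in>RB. Y \<rho> * g k \<rho>) / 4) \<le> (\<Sum>k<t. w + \<epsilon>)"
    by (intro sum_mono) auto
  moreover have "(\<Sum>k<t. (\<Sum>\<rho>\<in>RB. Y \<rho> * g k \<rho>) / 4) = 0"
  proof -
    have "(\<Sum>k<t. \<Sum>\<rho>\<in>RB. Y \<rho> * g k \<rho>) = (\<Sum>\<rho>\<in>RB. Y \<rho> * (\<Sum>k<t. g k \<rho>))"
      unfolding sum_distrib_left by (rule sum.swap)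
    also have "\<dots> = 0"
    proof (intro sum.neutral ballI)
      fix \<rho> assume "\<rho> \<in> RB"
      then obtain k' b' T' where "\<rho> = Blk k' b' T'" "T' \<subseteq> {..<t}" by (rule RB_cases)
      thus "Y \<rho> * (\<Sum>k<t. g k \<rho>) = 0" using sum_bet[OF t_pos] by (simp add: g_def)
    qed
    finally show ?thesis by (simp flip: sum_divide_distrib)
  qed
  ultimately have "real t * (sum Y RB / 2 + (\<Sum>\<rho>\<in>RB. Y \<rho> * blk_bet t f T \<rho>) / 4) \<le> real t * (w + \<epsilon>)"
    by (simp add: sum_subtractf)
  thus ?thesis using t_pos by (simp add: w_def)
qed

text \<open>A minimax argument: each player can secure about 1/2 and the total is at most 1, so no
  bet can win much. The confinement of \<open>Y\<close> uses the game with exchanged players, whose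
  right-hand side is transposed.\<close>

lemma equilibrium_near_hidden:
  assumes X: "mix_on RR X" and Y: "mix_on RR Y" and \<epsilon>: "0 \<le> \<epsilon>" "\<epsilon> \<le> 1 / 20000"
    and bX: "best_response \<epsilon> c X Y" and bY: "best_response \<epsilon> (flip c) Y X"
    and "hard c" "hard (flip c)"
  shows "near_hidden t Q \<epsilon> f X"
proof -
  have BX: "sum X RB \<ge> 1 - 2 * \<epsilon>"
    using nonblock_small[OF X Y \<epsilon> bX bY \<open>hard c\<close>] mix_nonneg(4)[OF X] by simp
  have BY: "sum Y RB \<ge> 1 - 2 * \<epsilon>"
    using nonblock_small[OF Y X \<epsilon> bY bX \<open>hard (flip c)\<close>] mix_nonneg(4)[OF Y] by simp
  have "(\<Sum>\<rho>\<in>RB. Y \<rho> * blk_bet t f {} \<rho>) \<ge> 0"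
    using Y by (intro sum_nonneg mult_nonneg_nonneg)
      (auto simp: mix_on_def roles_def blk_bet_def hidden_bet_def split: role.splits)
  hence 1: "(\<Sum>\<sigma>\<in>RR. X \<sigma> * util c Y \<sigma>) \<ge> sum Y RB / 2 - \<epsilon>"
    using block_deviation[OF Y bX, of "{}"] by simp
  \<comment> \<open>Half of each block mass is at least \<open>1 / 2 - \<epsilon>\<close> and each
    deviation bound loses \<open>\<epsilon>\<close>; a quarter of the bet is thus at most
    \<open>4 * \<epsilon>\<close>.\<close>
  have "(\<Sum>\<rho>\<in>RB. X \<rho> * blk_bet t f T \<rho>) \<le> 16 * \<epsilon>" if T: "T \<subseteq> {..<t}" for T
    using block_deviation[OF X bY T] 1 total_util_le_1[OF X Y, of c] BX BY by simp
  thus ?thesis using BX by (simp add: near_hidden_def)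
qed

end

text \<open>Empty bets put almost all mass on both graphs, that is, on arguments in \<open>S\<close>
  where the functions agree. The bet on \<open>S\<close> caps that mass by about
  \<open>card S / t\<close>, which must therefore be close to 1.\<close>

lemma near_hidden_agree:
  assumes X: "\<And>\<rho>. \<rho> \<in> blk_roles t Q \<Longrightarrow> X \<rho> \<ge> 0" "sum X (blk_roles t Q) \<le> 1"
    and f: "near_hidden t Q \<epsilon> f X" and f': "near_hidden t Q \<epsilon> f' X" and "\<epsilon> \<le> 1 / 20000" "t > 0"
  shows "t \<le> 2 * card {k. k < t \<and> f k = f' k}"
proof -
  define S where "S = {k. k < t \<and> f k = f' k}"
  define fr where "fr = real (card S) / real t"
  let ?B = "blk_roles t Q"
  have S: "S \<subseteq> {..<t}" by (auto simp: S_def)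
  have fr: "0 \<le> fr" by (simp add: fr_def)
  have "1 \<le> blk_bet t f S \<rho> + blk_bet t f {} \<rho> + blk_bet t f' {} \<rho> + fr" if "\<rho> \<in> ?B" for \<rho>
    using that by (auto simp: blk_roles_def blk_bet_def hidden_bet_def S_def fr_def)
  hence "(\<Sum>\<rho>\<in>?B. X \<rho> * 1) \<le> (\<Sum>\<rho>\<in>?B. X \<rho> * (blk_bet t f S \<rho> + blk_bet t f {} \<rho> + blk_bet t f' {} \<rho> + fr))"
    using X(1) by (intro sum_mono mult_left_mono) auto
  also have "\<dots> = (\<Sum>\<rho>\<in>?B. X \<rho> * blk_bet t f S \<rho>) + (\<Sum>\<rho>\<in>?B. X \<rho> * blk_bet t f {} \<rho>)
      + (\<Sum>\<rho>\<in>?B. X \<rho> * blk_bet t f' {} \<rho>) + sum X ?B * fr"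
    by (simp add: distrib_left sum.distrib sum_distrib_right)
  also have "\<dots> \<le> 16 * \<epsilon> + 16 * \<epsilon> + 16 * \<epsilon> + 1 * fr"
    using f f' S X(2) fr by (intro add_mono mult_right_mono) (auto simp: near_hidden_def)
  finally have "1 - 2 * \<epsilon> \<le> 48 * \<epsilon> + fr" using f by (simp add: near_hidden_def)
  hence "1 / 2 \<le> fr" using \<open>\<epsilon> \<le> 1 / 20000\<close> by simp
  hence "real t \<le> 2 * real (card S)" using \<open>t > 0\<close> by (simp add: fr_def field_simps)
  hence "real t \<le> real (2 * card S)" by simp
  thus ?thesis unfolding S_def[symmetric] by (simp only: of_nat_le_iff)
qed

section \<open>Realizing the games with \<open>n\<close> strategies\<close>

text \<open>The column player uses the same payoff function from the other side of the table: roles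
  exchanged and \<open>c\<close> transposed.\<close>

definition role_bimatrix ::
  "nat \<Rightarrow> (nat \<Rightarrow> role) \<Rightarrow> nat \<Rightarrow> (nat \<Rightarrow> nat set) \<Rightarrow> (nat \<Rightarrow> nat \<Rightarrow> real) \<Rightarrow> (nat \<Rightarrow> nat) \<Rightarrow> game" where
  "role_bimatrix n \<rho> t a c f =
     (mat n n (\<lambda>(i, j). pay t a c f (\<rho> i) (\<rho> j)), mat n n (\<lambda>(i, j). pay t a (\<lambda>u v. c v u) f (\<rho> j) (\<rho> i)))"

text \<open>Several indices may carry the same role, which allows \<open>n\<close> to exceed the
  number of roles.\<close>

definition role_mix :: "nat \<Rightarrow> (nat \<Rightarrow> role) \<Rightarrow> real vec \<Rightarrow> role \<Rightarrow> real" where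
  "role_mix n \<rho> x \<sigma> = (\<Sum>i | i < n \<and> \<rho> i = \<sigma>. x $ i)"

lemma payoff_conv_sum:
  assumes "x \<in> carrier_vec n" "y \<in> carrier_vec n" "M \<in> carrier_mat n n"
  shows "payoff x M y = (\<Sum>i<n. x $ i * (\<Sum>j<n. y $ j * M $$ (i, j)))"
  using assms
  by (simp add: payoff_def scalar_prod_def mult_mat_vec_def atLeast0LessThan row_def mult.commute cong: sum.cong_simp)

lemma payoff_unit_left:
  assumes "y \<in> carrier_vec n" "M \<in> carrier_mat n n" "i < n"
  shows "payoff (unit_vec n i) M y = (\<Sum>j<n. y $ j * M $$ (i, j))"
proof -
  have "payoff (unit_vec n i) M y = (\<Sum>k<n. if k = i then (\<Sum>j<n. y $ j * M $$ (i, j)) else 0)"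
    unfolding payoff_conv_sum[OF unit_vec_carrier assms(1,2)]
    by (intro sum.cong refl) (use assms(3) in auto)
  thus ?thesis using assms(3) by simp
qed

lemma payoff_unit_right:
  assumes "x \<in> carrier_vec n" "M \<in> carrier_mat n n" "j < n"
  shows "payoff x M (unit_vec n j) = (\<Sum>i<n. x $ i * M $$ (i, j))"
proof -
  have "(\<Sum>k<n. unit_vec n j $ k * M $$ (i, k)) = (\<Sum>k<n. if k = j then M $$ (i, j) else 0)" for i
    by (intro sum.cong) (auto simp: unit_vec_def)
  thus ?thesis using assms by (subst payoff_conv_sum[OF assms(1) _ assms(2)]) auto
qed

lemma sum_role_mix:
  assumes "\<And>i. i < n \<Longrightarrow> \<rho> i \<in> S" "finite S"
  shows "(\<Sum>\<sigma>\<in>S. role_mix n \<rho> x \<sigma> * g \<sigma>) = (\<Sum>i<n. x $ i * g (\<rho> i))"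
proof -
  have "(\<Sum>\<sigma>\<in>S. role_mix n \<rho> x \<sigma> * g \<sigma>) = (\<Sum>\<sigma>\<in>S. \<Sum>i | i \<in> {..<n} \<and> \<rho> i = \<sigma>. x $ i * g (\<rho> i))"
    by (intro sum.cong refl) (auto simp: role_mix_def sum_distrib_right intro!: sum.cong)
  also have "\<dots> = (\<Sum>i<n. x $ i * g (\<rho> i))"
    using assms by (intro sum.group) auto
  finally show ?thesis .
qed

lemma mix_on_role_mix:
  assumes "\<And>i. i < n \<Longrightarrow> \<rho> i \<in> S" "finite S" "x \<in> mixed_strategies n"
  shows "mix_on S (role_mix n \<rho> x)"
  using assms sum_role_mix[OF assms(1,2), where g = "\<lambda>_. 1" and x = x]
  by (auto simp: mix_on_def mixed_strategies_def role_mix_def intro!: sum_nonneg)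

context role_game
begin

lemma util_role_mix:
  assumes "\<And>i. i < n \<Longrightarrow> \<rho> i \<in> RR"
  shows "util c (role_mix n \<rho> y) \<sigma> = (\<Sum>j<n. y $ j * pay t a c f \<sigma> (\<rho> j))"
  unfolding util_def by (rule sum_role_mix[OF assms]) auto

lemma approx_NE_best_response:
  assumes range: "\<rho> ` {..<n} = RR" and NE: "approx_NE \<epsilon> n (role_bimatrix n \<rho> t a c f) (x, y)"
  shows "mix_on RR (role_mix n \<rho> x)" "mix_on RR (role_mix n \<rho> y)"
    "best_response \<epsilon> c (role_mix n \<rho> x) (role_mix n \<rho> y)"
    "best_response \<epsilon> (flip c) (role_mix n \<rho> y) (role_mix n \<rho> x)"
proof -
  have \<rho>: "\<And>i. i < n \<Longrightarrow> \<rho> i \<in> RR" using range by auto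
  have x: "x \<in> mixed_strategies n" and y: "y \<in> mixed_strategies n"
    using NE by (auto simp: approx_NE_def role_bimatrix_def profiles_def)
  have ball_range: "(\<forall>\<sigma>\<in>RR. P \<sigma>) \<longleftrightarrow> (\<forall>i<n. P (\<rho> i))" for P
    unfolding range[symmetric] by auto
  have cx: "x \<in> carrier_vec n" and cy: "y \<in> carrier_vec n" using x y by (auto simp: mixed_strategies_def)
  show "mix_on RR (role_mix n \<rho> x)" "mix_on RR (role_mix n \<rho> y)"
    using mix_on_role_mix[OF \<rho>] x y by auto
  define R where "R = mat n n (\<lambda>(i, j). pay t a c f (\<rho> i) (\<rho> j))"
  define C where "C = mat n n (\<lambda>(i, j). pay t a (flip c) f (\<rho> j) (\<rho> i))"
  have M: "R \<in> carrier_mat n n" "C \<in> carrier_mat n n" by (simp_all add: R_def C_def)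
  have ineq: "payoff x R y \<ge> payoff (unit_vec n i) R y - \<epsilon>" "payoff x C y \<ge> payoff x C (unit_vec n i) - \<epsilon>"
    if "i < n" for i
    using NE that by (auto simp: approx_NE_def role_bimatrix_def R_def C_def)
  have uR: "(\<Sum>j<n. y $ j * R $$ (i, j)) = util c (role_mix n \<rho> y) (\<rho> i)" if "i < n" for i
    using that by (simp add: util_role_mix[OF \<rho>] R_def)
  have uC: "(\<Sum>i<n. x $ i * C $$ (i, j)) = util (flip c) (role_mix n \<rho> x) (\<rho> j)" if "j < n" for j
    using that by (simp add: util_role_mix[OF \<rho>] C_def)
  have "payoff x R y = (\<Sum>\<sigma>\<in>RR. role_mix n \<rho> x \<sigma> * util c (role_mix n \<rho> y) \<sigma>)"
    using \<rho> uR by (simp add: payoff_conv_sum[OF cx cy M(1)] sum_role_mix)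
  thus "best_response \<epsilon> c (role_mix n \<rho> x) (role_mix n \<rho> y)"
    unfolding best_response_def ball_range
    using ineq(1) uR by (simp add: payoff_unit_left[OF cy M(1)] range)
  have "payoff x C y = (\<Sum>j<n. y $ j * (\<Sum>i<n. x $ i * C $$ (i, j)))"
    unfolding payoff_conv_sum[OF cx cy M(2)] sum_distrib_left
    by (subst sum.swap) (simp add: mult_ac)
  also have "\<dots> = (\<Sum>\<sigma>\<in>RR. role_mix n \<rho> y \<sigma> * util (flip c) (role_mix n \<rho> x) \<sigma>)"
    using \<rho> uC by (simp add: sum_role_mix)
  finally show "best_response \<epsilon> (flip c) (role_mix n \<rho> y) (role_mix n \<rho> x)"
    unfolding best_response_def ball_range
    using ineq(2) uC by (simp add: payoff_unit_right[OF cx M(2)] range)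
qed

lemma approx_NE_near_hidden:
  assumes "\<rho> ` {..<n} = RR" "approx_NE \<epsilon> n (role_bimatrix n \<rho> t a c f) (x, y)"
    and "0 \<le> \<epsilon>" "\<epsilon> \<le> 1 / 20000" "hard c" "hard (flip c)"
  shows "near_hidden t Q \<epsilon> f (role_mix n \<rho> x)" "near_hidden t Q \<epsilon> f (role_mix n \<rho> y)"
  using approx_NE_best_response[OF assms(1,2)] assms(3-)
  by (auto intro: equilibrium_near_hidden[of _ "role_mix n \<rho> y" _ c] equilibrium_near_hidden[of _ "role_mix n \<rho> x" _ "flip c"])

end

text \<open>Assignments earn at most 1/2, challenges have mean 1/2 over uniform questions, and block
  roles earn 159/320 whatever they hide.\<close>

lemma pay_deviation:
  assumes "t > 0" "\<sigma> \<in> roles t l Q"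
  shows "\<exists>g. (\<forall>v<t. \<forall>\<beta>. \<beta> \<subseteq> {..<l} \<longrightarrow> pay t a c f \<sigma> (Asg v \<beta>) \<le> g v) \<and> (\<Sum>v<t. g v) \<le> real t / 2"
proof (cases \<sigma>)
  case (Chal T)
  hence T: "T \<subseteq> {..<t}" using assms(2) by (auto simp: roles_def asg_roles_def chal_roles_def blk_roles_def)
  have "(\<Sum>v<t. 1 / 2 + bet t v T / 2) = real t / 2"
    using sum_bet[OF assms(1) T] by (simp add: sum.distrib flip: sum_divide_distrib)
  thus ?thesis using Chal by (intro exI[of _ "\<lambda>v. 1 / 2 + bet t v T / 2"]) simp
next
  case (Asg u \<alpha>)
  thus ?thesis by (intro exI[of _ "\<lambda>_. 1 / 2"]) simp
next
  case (Blk k b T)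
  thus ?thesis using assms(1) by (intro exI[of _ "\<lambda>_. 159 / 320"]) simp
qed

text \<open>The order of the quantifiers is the point: the measure is built from \<open>a\<close>,
  \<open>c\<close> and the positions of the assignments, so it reveals nothing about
  \<open>f\<close>.\<close>

lemma ex_shared_pseudo_equilibrium:
  assumes game: "xor_game t l D K a c" and "2 * d + 2 \<le> K"
    and range: "\<rho> ` {..<n} = roles t l Q"
    and inj: "\<And>i j u \<alpha>. i < n \<Longrightarrow> j < n \<Longrightarrow> \<rho> i = Asg u \<alpha> \<Longrightarrow> \<rho> j = Asg u \<alpha> \<Longrightarrow> i = j"
  shows "\<exists>\<mu>. \<forall>f. pseudo_equilibrium d n (role_bimatrix n \<rho> t a c f) \<mu>"
proof -
  interpret xor_game t l D K a c by fact
  define pos where "pos u \<alpha> = (SOME i. i < n \<and> \<rho> i = Asg u \<alpha>)" for u \<alpha>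
  have pos: "pos u \<alpha> < n \<and> \<rho> (pos u \<alpha>) = Asg u \<alpha>" if "u < t" "\<alpha> \<subseteq> {..<l}" for u \<alpha>
  proof -
    have "Asg u \<alpha> \<in> \<rho> ` {..<n}" unfolding range using that by (auto simp: roles_def asg_roles_def)
    hence "\<exists>i. i < n \<and> \<rho> i = Asg u \<alpha>" by (metis imageE lessThan_iff)
    thus ?thesis unfolding pos_def by (rule someI_ex)
  qed
  have \<rho>: "\<rho> i \<in> roles t l Q" if "i < n" for i using range that by auto
  have "pseudo_equilibrium d n (role_bimatrix n \<rho> t a c f) (xor_bimatrix.\<mu> t l K a c n pos)" for f
  proof -
    define R where "R = mat n n (\<lambda>(i, j). pay t a c f (\<rho> i) (\<rho> j))"
    define C where "C = mat n n (\<lambda>(i, j). pay t a (\<lambda>u v. c v u) f (\<rho> j) (\<rho> i))"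
    have "xor_bimatrix t l D K a c d n pos R C"
    proof
      show "2 * d + 2 \<le> K" by fact
      show "pos u \<alpha> < n" if "u < t" "\<alpha> \<subseteq> {..<l}" for u \<alpha>
        using pos[OF that] by (rule conjunct1)
      show "u = v \<and> \<alpha> = \<beta>" if "u < t" "\<alpha> \<subseteq> {..<l}" "v < t" "\<beta> \<subseteq> {..<l}" "pos u \<alpha> = pos v \<beta>" for u \<alpha> v \<beta>
      proof -
        have "Asg u \<alpha> = \<rho> (pos u \<alpha>)" using pos[OF that(1,2)] by simp
        also have "\<dots> = Asg v \<beta>" unfolding that(5) using pos[OF that(3,4)] by simp
        finally show ?thesis by simp
      qed
      show "R $$ (pos u \<alpha>, pos v \<beta>) = (if mismatch a c u \<alpha> v \<beta> then 0 else 1 / 2)"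
        if "u < t" "\<alpha> \<subseteq> {..<l}" "v < t" "\<beta> \<subseteq> {..<l}" for u \<alpha> v \<beta>
        using pos[OF that(1,2)] pos[OF that(3,4)] by (simp add: R_def)
      show "C $$ (pos u \<alpha>, pos v \<beta>) = (if mismatch a c u \<alpha> v \<beta> then 0 else 1 / 2)"
        if "u < t" "\<alpha> \<subseteq> {..<l}" "v < t" "\<beta> \<subseteq> {..<l}" for u \<alpha> v \<beta>
        using pos[OF that(1,2)] pos[OF that(3,4)] by (simp add: C_def mismatch_def mult.commute)
      show "\<exists>g. (\<forall>v<t. \<forall>\<beta>. \<beta> \<subseteq> {..<l} \<longrightarrow> R $$ (i, pos v \<beta>) \<le> g v) \<and> (\<Sum>v<t. g v) \<le> real t / 2"
        if i: "i < n" for i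
      proof -
        obtain g where g: "\<And>v \<beta>. v < t \<Longrightarrow> \<beta> \<subseteq> {..<l} \<Longrightarrow> pay t a c f (\<rho> i) (Asg v \<beta>) \<le> g v" "(\<Sum>v<t. g v) \<le> real t / 2"
          using pay_deviation[OF t_pos \<rho>[OF i], of a c f] by blast
        show ?thesis
          using g pos i by (intro exI[of _ g]) (simp add: R_def)
      qed
      show "\<exists>g. (\<forall>u<t. \<forall>\<alpha>. \<alpha> \<subseteq> {..<l} \<longrightarrow> C $$ (pos u \<alpha>, j) \<le> g u) \<and> (\<Sum>u<t. g u) \<le> real t / 2"
        if j: "j < n" for j
      proof -
        obtain g where g: "\<And>v \<beta>. v < t \<Longrightarrow> \<beta> \<subseteq> {..<l} \<Longrightarrow> pay t a (\<lambda>u v. c v u) f (\<rho> j) (Asg v \<beta>) \<le> g v" "(\<Sum>v<t. g v) \<le> real t / 2"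
          using pay_deviation[OF t_pos \<rho>[OF j], of a "\<lambda>u v. c v u" f] by blast
        show ?thesis
          using g pos j by (intro exI[of _ g]) (simp add: C_def)
      qed
    qed
    from xor_bimatrix.pseudo_equilibrium_\<mu>[OF this] show ?thesis
      by (simp add: role_bimatrix_def R_def C_def)
  qed
  thus ?thesis by blast
qed

text \<open>Surplus indices become copies of one block role; assignments must keep unique positions,
  because the pseudo-equilibrium puts its mass there.\<close>

lemma ex_role_assignment:
  assumes "t > 0" "Q > 0" "card (roles t l Q) \<le> n"
  shows "\<exists>\<rho>. \<rho> ` {..<n} = roles t l Q \<and>
    (\<forall>i j u \<alpha>. i < n \<longrightarrow> j < n \<longrightarrow> \<rho> i = Asg u \<alpha> \<longrightarrow> \<rho> j = Asg u \<alpha> \<longrightarrow> i = j)"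
proof -
  define N where "N = card (roles t l Q)"
  obtain h where h: "bij_betw h {0..<N} (roles t l Q)"
    using ex_bij_betw_nat_finite[of "roles t l Q"] by (auto simp: N_def)
  define \<rho> where "\<rho> i = (if i < N then h i else Blk 0 0 {})" for i
  have "Blk 0 0 {} \<in> roles t l Q"
    using assms by (auto simp: roles_def blk_roles_def intro!: image_eqI[of _ _ "(0, 0, {})"])
  moreover have im: "h ` {0..<N} = roles t l Q" using h by (simp add: bij_betw_def)
  ultimately have "\<rho> ` {..<n} \<subseteq> roles t l Q" by (auto simp: \<rho>_def)
  moreover have "roles t l Q \<subseteq> \<rho> ` {..<n}"
  proof
    fix \<sigma> assume "\<sigma> \<in> roles t l Q"
    then obtain i where "i < N" "\<sigma> = h i" unfolding im[symmetric] by auto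
    hence "\<sigma> = \<rho> i" "i < n" using assms(3) by (simp_all add: \<rho>_def N_def)
    thus "\<sigma> \<in> \<rho> ` {..<n}" by blast
  qed
  moreover have "i = j" if "\<rho> i = Asg u \<alpha>" "\<rho> j = Asg u \<alpha>" for i j u \<alpha>
  proof -
    have "i < N" "j < N" using that by (auto simp: \<rho>_def split: if_splits)
    thus ?thesis using that h by (auto simp: \<rho>_def bij_betw_def inj_on_def)
  qed
  ultimately show ?thesis by blast
qed

section \<open>Counting hidden functions\<close>

text \<open>At most \<open>2 ^ t\<close> choices of the set of agreement, and at most half of the
  values remain free outside it.\<close>

lemma card_agreeing_functions:
  fixes f0 :: "nat \<Rightarrow> nat"
  assumes "Q > 0"
  shows "card {f \<in> {..<t} \<rightarrow>\<^sub>E {..<Q}. t \<le> 2 * card {k. k < t \<and> f0 k = f k}} \<le> 2 ^ t * Q ^ (t div 2)"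
proof -
  define F where "F = {..<t} \<rightarrow>\<^sub>E {..<Q}"
  define \<A> where "\<A> = {A. A \<subseteq> {..<t} \<and> t \<le> 2 * card A}"
  have fin: "finite F" "finite \<A>"
    unfolding F_def \<A>_def by (auto intro: finite_PiE finite_subset[of _ "Pow {..<t}"])
  have part: "card {f\<in>F. \<forall>k\<in>A. f k = f0 k} \<le> Q ^ (t div 2)" if A: "A \<in> \<A>" for A
  proof -
    let ?r = "\<lambda>f. restrict f ({..<t} - A)"
    have inj: "inj_on ?r {f\<in>F. \<forall>k\<in>A. f k = f0 k}"
    proof (rule inj_onI)
      fix f g assume fg: "f \<in> {f\<in>F. \<forall>k\<in>A. f k = f0 k}" "g \<in> {f\<in>F. \<forall>k\<in>A. f k = f0 k}" "?r f = ?r g"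
      have "f k = g k" if "k < t" for k
      proof (cases "k \<in> A")
        case False
        thus ?thesis using fun_cong[OF fg(3), of k] that by simp
      qed (use fg in auto)
      thus "f = g" using fg(1,2) unfolding F_def
        by (intro PiE_ext[of f "{..<t}" "\<lambda>_. {..<Q}" g]) auto
    qed
    have "?r ` {f\<in>F. \<forall>k\<in>A. f k = f0 k} \<subseteq> ({..<t} - A) \<rightarrow>\<^sub>E {..<Q}"
      unfolding F_def by auto
    hence "card {f\<in>F. \<forall>k\<in>A. f k = f0 k} \<le> card (({..<t} - A) \<rightarrow>\<^sub>E {..<Q})"
      using inj by (intro card_inj_on_le) (auto intro: finite_PiE)
    also have "\<dots> = Q ^ card ({..<t} - A)" by (simp add: card_PiE)
    also have "\<dots> \<le> Q ^ (t div 2)"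
    proof (rule power_increasing)
      have "card ({..<t} - A) = t - card A"
        using A by (subst card_Diff_subset) (auto simp: \<A>_def intro: finite_subset)
      thus "card ({..<t} - A) \<le> t div 2" using A by (auto simp: \<A>_def)
    qed (use assms in auto)
    finally show ?thesis .
  qed
  have "{f\<in>F. t \<le> 2 * card {k. k < t \<and> f0 k = f k}} \<subseteq> (\<Union>A\<in>\<A>. {f\<in>F. \<forall>k\<in>A. f k = f0 k})"
  proof
    fix f assume f: "f \<in> {f\<in>F. t \<le> 2 * card {k. k < t \<and> f0 k = f k}}"
    hence "{k. k < t \<and> f0 k = f k} \<in> \<A>" by (auto simp: \<A>_def)
    thus "f \<in> (\<Union>A\<in>\<A>. {f\<in>F. \<forall>k\<in>A. f k = f0 k})"
      by (rule UN_I) (use f in simp)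
  qed
  hence "card {f\<in>F. t \<le> 2 * card {k. k < t \<and> f0 k = f k}} \<le> card (\<Union>A\<in>\<A>. {f\<in>F. \<forall>k\<in>A. f k = f0 k})"
    using fin by (intro card_mono) auto
  also have "\<dots> \<le> (\<Sum>A\<in>\<A>. card {f\<in>F. \<forall>k\<in>A. f k = f0 k})"
    using fin(2) by (rule card_UN_le)
  also have "\<dots> \<le> card \<A> * Q ^ (t div 2)"
    using sum_mono[OF part] by simp
  also have "card \<A> \<le> card (Pow {..<t})"
    by (intro card_mono) (auto simp: \<A>_def)
  finally show ?thesis unfolding F_def by (simp add: card_Pow)
qed

text \<open>All functions that fit \<open>X\<close> agree on half of the arguments with any fixed
  one among them.\<close>

lemma card_near_hidden_le:
  assumes "Q > 0" "t > 0" "mix_on (roles t l Q) X" "\<epsilon> \<le> 1 / 20000"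
  shows "card {f \<in> {..<t} \<rightarrow>\<^sub>E {..<Q}. near_hidden t Q \<epsilon> f X} \<le> 2 ^ t * Q ^ (t div 2)"
proof (cases "\<exists>f0 \<in> {..<t} \<rightarrow>\<^sub>E {..<Q}. near_hidden t Q \<epsilon> f0 X")
  case True
  then obtain f0 where f0: "near_hidden t Q \<epsilon> f0 X" by blast
  have X: "X \<rho> \<ge> 0" if "\<rho> \<in> blk_roles t Q" for \<rho>
    using assms(3) that by (auto simp: mix_on_def roles_def)
  have "sum X (blk_roles t Q) \<le> sum X (roles t l Q)"
    using assms(3) by (intro sum_mono2) (auto simp: mix_on_def roles_def)
  hence X1: "sum X (blk_roles t Q) \<le> 1" using assms(3) by (simp add: mix_on_def)
  have "{f \<in> {..<t} \<rightarrow>\<^sub>E {..<Q}. near_hidden t Q \<epsilon> f X}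
      \<subseteq> {f \<in> {..<t} \<rightarrow>\<^sub>E {..<Q}. t \<le> 2 * card {k. k < t \<and> f0 k = f k}}"
    using near_hidden_agree[OF X X1 f0 _ assms(4,2)] by auto
  hence "card {f \<in> {..<t} \<rightarrow>\<^sub>E {..<Q}. near_hidden t Q \<epsilon> f X}
      \<le> card {f \<in> {..<t} \<rightarrow>\<^sub>E {..<Q}. t \<le> 2 * card {k. k < t \<and> f0 k = f k}}"
    using finite_PiE[of "{..<t}" "\<lambda>_. {..<Q}"] by (intro card_mono) simp_all
  also have "\<dots> \<le> 2 ^ t * Q ^ (t div 2)" by (rule card_agreeing_functions[OF assms(1)])
  finally show ?thesis .
next
  case False
  hence "{f \<in> {..<t} \<rightarrow>\<^sub>E {..<Q}. near_hidden t Q \<epsilon> f X} = {}" by blast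
  thus ?thesis by (simp only: card.empty)
qed

section \<open>Oracle algorithms\<close>

text \<open>All functions that answer yes to a query are conceded, at most \<open>B\<close> of them;
  the others follow the no branch. The output accounts for the additional \<open>B\<close>.\<close>

lemma card_solved_le:
  assumes fin: "finite F"
    and orc: "\<And>a. a \<in> QS \<Longrightarrow> card {f\<in>F. orc (G f) a} \<le> B"
    and out: "\<And>p. p \<in> P \<Longrightarrow> card {f\<in>F. good (G f) p} \<le> B"
    and "queries T \<subseteq> QS" "outputs T \<subseteq> P"
  shows "card {f\<in>F. good (G f) (run_tree (orc (G f)) T)} \<le> (max_queries T + 1) * B"
  using assms(4,5)
proof (induction T)
  case (Output p)
  thus ?case using out by simp
next
  case (Query a T1 T2)
  let ?S = "\<lambda>T. {f\<in>F. good (G f) (run_tree (orc (G f)) T)}"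
  have "card (?S (Query a T1 T2)) \<le> card ({f\<in>F. orc (G f) a} \<union> ?S T2)"
    using fin by (intro card_mono) auto
  also have "\<dots> \<le> card {f\<in>F. orc (G f) a} + card (?S T2)" by (rule card_Un_le)
  also have "\<dots> \<le> B + (max_queries T2 + 1) * B"
    using Query orc[of a] by (intro add_mono) auto
  also have "\<dots> \<le> (max_queries (Query a T1 T2) + 1) * B" by (simp add: algebra_simps)
  finally show ?case .
qed

text \<open>Averaging in the manner of Yao: the expected number of solved functions is at least two
  thirds of \<open>F\<close>, yet no single decision tree solves more than
  \<open>(q + 1) * B\<close>. Since \<open>\<mu>\<close> is common to all \<open>f\<close>, so is
  the distribution on trees.\<close>

lemma OV_counting_bound:
  assumes fin: "finite F"
    and orc: "\<And>a. a \<in> QS \<Longrightarrow> card {f\<in>F. orc (G f) a} \<le> B"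
    and out: "\<And>p. p \<in> profiles n \<Longrightarrow> card {f\<in>F. approx_NE \<epsilon> n (G f) p} \<le> B"
    and alg: "OV_algorithm QS n q A" and comp: "computes_approx_NE orc \<epsilon> d n A"
    and G: "\<And>f. f \<in> F \<Longrightarrow> G f \<in> games n \<and> payoffs_in n {-1..1} (G f) \<and> pseudo_equilibrium d n (G f) \<mu>"
  shows "2 / 3 * real (card F) \<le> (real q + 1) * real B"
proof -
  define E where "E f = {T \<in> space (A \<mu>). approx_NE \<epsilon> n (G f) (run_tree (orc (G f)) T)}" for f
  have space: "max_queries T \<le> q" "queries T \<subseteq> QS" "outputs T \<subseteq> profiles n" if "T \<in> space (A \<mu>)" for T
    using alg that by (auto simp: OV_algorithm_def)
  interpret prob_space "A \<mu>" using alg by (simp add: OV_algorithm_def)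
  have ge: "2 / 3 \<le> measure (A \<mu>) (E f)" if "f \<in> F" for f
    using comp G[OF that] unfolding computes_approx_NE_def E_def by blast
  \<comment> \<open>A non-measurable event would have measure 0, contrary to the success
    bound.\<close>
  have sets: "E f \<in> sets (A \<mu>)" if "f \<in> F" for f
    using ge[OF that] measure_notin_sets[of "E f" "A \<mu>"] by force
  have int: "integrable (A \<mu>) (indicator (E f) :: _ \<Rightarrow> real)" if "f \<in> F" for f
    using sets[OF that] by (intro integrable_real_indicator) (auto simp: emeasure_eq_measure)
  have "2 / 3 * real (card F) = (\<Sum>f\<in>F. 2 / 3)" by simp
  also have "\<dots> \<le> (\<Sum>f\<in>F. measure (A \<mu>) (E f))" by (intro sum_mono ge)
  also have "\<dots> = (\<Sum>f\<in>F. integral\<^sup>L (A \<mu>) (indicator (E f)))"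
    using sets by (intro sum.cong refl) (simp add: Int_absorb1 E_def)
  also have "\<dots> = (\<integral>T. (\<Sum>f\<in>F. indicator (E f) T) \<partial>A \<mu>)"
    using int by (intro Bochner_Integration.integral_sum[symmetric]) auto
  also have "\<dots> \<le> (\<integral>T. (real q + 1) * real B \<partial>A \<mu>)"
  proof (rule integral_mono)
    fix T assume T: "T \<in> space (A \<mu>)"
    have "(\<Sum>f\<in>F. indicator (E f) T) = real (card {f\<in>F. approx_NE \<epsilon> n (G f) (run_tree (orc (G f)) T)})"
      using fin T by (simp add: indicator_def E_def sum.If_cases Int_def)
    also have "\<dots> \<le> real ((max_queries T + 1) * B)"
      using card_solved_le[where orc = orc and good = "approx_NE \<epsilon> n" and G = G, OF fin orc out space(2,3)[OF T]] by (simp only: of_nat_le_iff)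
    also have "\<dots> \<le> real ((q + 1) * B)"
      using space(1)[OF T] unfolding of_nat_le_iff by (intro mult_le_mono1) simp
    also have "\<dots> = (real q + 1) * real B" by (simp add: algebra_simps)
    finally show "(\<Sum>f\<in>F. indicator (E f) T) \<le> (real q + 1) * real B" .
  qed (use int in auto)
  also have "\<dots> = (real q + 1) * real B" by (simp add: prob_space)
  finally show ?thesis .
qed

section \<open>The lower bound\<close>

text \<open>Block roles dominate, with exponent 7 + 8 + 64 for the argument, the value and the
  bet.\<close>

lemma card_roles_le:
  assumes "r > 0"
  shows "card (roles (64 * r) (10 * r) (2 ^ (8 * r))) \<le> 2 ^ (80 * r)"
proof -
  let ?t = "64 * r"
  have "64 * r \<le> 2 ^ 6 * 2 ^ r" using less_exp[of r] by simp
  also have "\<dots> = 2 ^ (6 + r)" by (simp only: power_add)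
  also have "\<dots> \<le> 2 ^ (7 * r)" using assms by (intro power_increasing) auto
  finally have t: "?t \<le> 2 ^ (7 * r)" .
  have "card (asg_roles ?t (10 * r)) \<le> card ({..<?t} \<times> Pow {..<10 * r})"
    unfolding asg_roles_def by (intro card_image_le) auto
  also have "\<dots> = ?t * 2 ^ (10 * r)" by (simp add: card_cartesian_product card_Pow)
  also have "\<dots> \<le> 2 ^ (7 * r) * 2 ^ (10 * r)" by (rule mult_le_mono1[OF t])
  also have "\<dots> = 2 ^ (7 * r + 10 * r)" by (rule power_add[symmetric])
  also have "\<dots> \<le> 2 ^ (78 * r)" by (intro power_increasing) auto
  finally have A: "card (asg_roles ?t (10 * r)) \<le> 2 ^ (78 * r)" .
  have "card (chal_roles ?t) \<le> card (Pow {..<?t})"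
    unfolding chal_roles_def by (intro card_image_le) auto
  also have "\<dots> = 2 ^ (64 * r)" by (simp add: card_Pow)
  also have "\<dots> \<le> 2 ^ (78 * r)" by (intro power_increasing) auto
  finally have D: "card (chal_roles ?t) \<le> 2 ^ (78 * r)" .
  have "card (blk_roles ?t (2 ^ (8 * r))) \<le> card ({..<?t} \<times> {..<2 ^ (8 * r) :: nat} \<times> Pow {..<?t})"
    unfolding blk_roles_def by (intro card_image_le) auto
  also have "\<dots> = ?t * (2 ^ (8 * r) * 2 ^ (64 * r))" by (simp add: card_cartesian_product card_Pow)
  also have "\<dots> \<le> 2 ^ (7 * r) * (2 ^ (8 * r) * 2 ^ (64 * r))" by (rule mult_le_mono1[OF t])
  also have "\<dots> = 2 ^ (7 * r + (8 * r + 64 * r))" by (simp only: power_add)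
  also have "\<dots> = 2 ^ (79 * r)" by simp
  finally have B: "card (blk_roles ?t (2 ^ (8 * r))) \<le> 2 ^ (79 * r)" .
  have "(2::nat) ^ (78 * r) + 2 ^ (78 * r) = 2 ^ (78 * r + 1)" by simp
  also have "\<dots> \<le> 2 ^ (79 * r)" using assms by (intro power_increasing) auto
  finally have 1: "(2::nat) ^ (78 * r) + 2 ^ (78 * r) \<le> 2 ^ (79 * r)" .
  have "(2::nat) ^ (79 * r) + 2 ^ (79 * r) = 2 ^ (79 * r + 1)" by simp
  also have "\<dots> \<le> 2 ^ (80 * r)" using assms by (intro power_increasing) auto
  finally have 2: "(2::nat) ^ (79 * r) + 2 ^ (79 * r) \<le> 2 ^ (80 * r)" .
  have "card (roles ?t (10 * r) (2 ^ (8 * r))) \<le> card (asg_roles ?t (10 * r)) + card (chal_roles ?t) + card (blk_roles ?t (2 ^ (8 * r)))"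
    unfolding roles_def by (rule order_trans[OF card_Un_le]) (intro add_right_mono card_Un_le)
  thus ?thesis using A D B 1 2 by linarith
qed

lemma role_bimatrix_bounds:
  assumes "\<rho> ` {..<n} \<subseteq> roles t l Q"
  shows "role_bimatrix n \<rho> t a c f \<in> games n" "payoffs_in n {-1..1} (role_bimatrix n \<rho> t a c f)"
proof -
  have \<rho>: "\<rho> i \<in> roles t l Q" if "i < n" for i using assms that by auto
  show "role_bimatrix n \<rho> t a c f \<in> games n" by (simp add: role_bimatrix_def games_def)
  show "payoffs_in n {-1..1} (role_bimatrix n \<rho> t a c f)"
    using pay_bounds[OF \<rho> \<rho>] by (simp add: role_bimatrix_def payoffs_in_def)
qed

lemma ex_hard_family:
  assumes r: "r > 0" and n: "2 ^ (80 * r) \<le> n" and d: "4 * d + 4 \<le> r" and \<epsilon>: "0 \<le> \<epsilon>" "\<epsilon> \<le> 1 / 20000"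
  shows "\<exists>(F :: (nat \<Rightarrow> nat) set) G \<mu>. finite F \<and> card F = 2 ^ (512 * r\<^sup>2) \<and>
    (\<forall>f\<in>F. G f \<in> games n \<and> payoffs_in n {-1..1} (G f) \<and> pseudo_equilibrium d n (G f) \<mu>) \<and>
    (\<forall>x. card {f\<in>F. \<exists>y. approx_NE \<epsilon> n (G f) (x, y)} \<le> 2 ^ (64 * r + 256 * r\<^sup>2)) \<and>
    (\<forall>y. card {f\<in>F. \<exists>x. approx_NE \<epsilon> n (G f) (x, y)} \<le> 2 ^ (64 * r + 256 * r\<^sup>2))"
proof -
  define t l Q where "t = 64 * r" and "l = 10 * r" and "Q = (2::nat) ^ (8 * r)"
  have pos: "t > 0" "Q > 0" using r by (simp_all add: t_def Q_def)
  obtain a c where a: "\<And>v. v < t \<Longrightarrow> a v \<subseteq> {..<l}"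
      "\<And>W. W \<subseteq> {..<t} \<Longrightarrow> W \<noteq> {} \<Longrightarrow> card W \<le> r \<Longrightarrow> xorsum a W \<noteq> {}"
    and c: "\<And>u v. c u v = 1 \<or> c u v = (-1::real)"
    and hard: "\<And>F G. 256 * r\<^sup>2 \<le> card {(u, v). u < t \<and> v < t \<and> mismatch a c u (F u) v (G v)}"
    using ex_unsatisfiable_constraints[OF r] unfolding t_def l_def by blast
  \<comment> \<open>With \<open>K = 2 * d + 2\<close> and \<open>D = r\<close>, the requirement
    \<open>2 * K \<le> D\<close> is the hypothesis on \<open>d\<close>.\<close>
  have game: "xor_game t l r (2 * d + 2) a c"
  proof
    show "xorsum a W \<noteq> {}" if "W \<subseteq> {..<t}" "W \<noteq> {}" "card W \<le> r" for W
      using a(2) that by blast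
  qed (use pos a(1) c d in auto)
  have "card (roles t l Q) \<le> n"
    using card_roles_le[OF r] n unfolding t_def l_def Q_def by (rule order_trans)
  then obtain \<rho> where \<rho>: "\<rho> ` {..<n} = roles t l Q"
      "\<And>i j u \<alpha>. i < n \<Longrightarrow> j < n \<Longrightarrow> \<rho> i = Asg u \<alpha> \<Longrightarrow> \<rho> j = Asg u \<alpha> \<Longrightarrow> i = j"
    using ex_role_assignment[OF pos, of l n] by blast
  have "\<exists>\<mu>. \<forall>f. pseudo_equilibrium d n (role_bimatrix n \<rho> t a c f) \<mu>"
    by (rule ex_shared_pseudo_equilibrium[OF game order_refl \<rho>(1)]) (rule \<rho>(2))
  then obtain \<mu> where \<mu>: "\<And>f. pseudo_equilibrium d n (role_bimatrix n \<rho> t a c f) \<mu>"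
    by blast
  define F where "F = {..<t} \<rightarrow>\<^sub>E {..<Q}"
  define G where "G f = role_bimatrix n \<rho> t a c f" for f
  have fin: "finite F" unfolding F_def by (intro finite_PiE) auto
  have B: "(2::nat) ^ t * Q ^ (t div 2) = 2 ^ (64 * r + 256 * r\<^sup>2)"
    by (simp add: t_def Q_def power_add power2_eq_square flip: power_mult)
  have near: "near_hidden t Q \<epsilon> f (role_mix n \<rho> x) \<and> near_hidden t Q \<epsilon> f (role_mix n \<rho> y)
      \<and> mix_on (roles t l Q) (role_mix n \<rho> x) \<and> mix_on (roles t l Q) (role_mix n \<rho> y)"
    if f: "f \<in> F" and NE: "approx_NE \<epsilon> n (G f) (x, y)" for f x y
  proof -
    interpret role_game t l Q a f
      by standard (use pos f in \<open>auto simp: F_def\<close>)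
    have h: "real (256 * r\<^sup>2) = real t ^ 2 / 16" by (simp add: t_def power_mult_distrib)
    have "hard c"
      unfolding hard_def h[symmetric] of_nat_le_iff using hard by blast
    moreover have "hard (\<lambda>u v. c v u)"
      unfolding hard_def h[symmetric] of_nat_le_iff
    proof (intro allI)
      fix F G
      have "{(u, v). u < t \<and> v < t \<and> mismatch a (\<lambda>u v. c v u) u (F u) v (G v)}
         = (\<lambda>(u, v). (v, u)) ` {(u, v). u < t \<and> v < t \<and> mismatch a c u (G u) v (F v)}"
        by (auto simp: mismatch_def mult.commute)
      hence "card {(u, v). u < t \<and> v < t \<and> mismatch a (\<lambda>u v. c v u) u (F u) v (G v)}
         = card {(u, v). u < t \<and> v < t \<and> mismatch a c u (G u) v (F v)}"
        by (simp add: card_image inj_on_def)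
      thus "256 * r\<^sup>2 \<le> card {(u, v). u < t \<and> v < t \<and> mismatch a (\<lambda>u v. c v u) u (F u) v (G v)}"
        using hard[of G F] by simp
    qed
    ultimately show ?thesis
      using approx_NE_near_hidden[OF \<rho>(1) NE[unfolded G_def] \<epsilon>] approx_NE_best_response(1,2)[OF \<rho>(1) NE[unfolded G_def]]
      by simp
  qed
  have count: "card {f\<in>F. P f} \<le> 2 ^ (64 * r + 256 * r\<^sup>2)"
    if P: "\<And>f. f \<in> F \<Longrightarrow> P f \<Longrightarrow> near_hidden t Q \<epsilon> f X \<and> mix_on (roles t l Q) X" for P X
  proof (cases "\<exists>f\<in>F. P f")
    case True
    hence X: "mix_on (roles t l Q) X" using P by blast
    have "card {f\<in>F. P f} \<le> card {f\<in>F. near_hidden t Q \<epsilon> f X}"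
      using fin P by (intro card_mono) auto
    also have "\<dots> \<le> 2 ^ t * Q ^ (t div 2)"
      unfolding F_def by (rule card_near_hidden_le[OF pos(2,1) X \<epsilon>(2)])
    finally show ?thesis unfolding B .
  next
    case False
    hence "{f\<in>F. P f} = {}" by blast
    thus ?thesis by (simp only: card.empty)
  qed
  show ?thesis
  proof (intro exI[of _ F] exI[of _ G] exI[of _ \<mu>] conjI ballI allI fin)
    have "card F = Q ^ t" by (simp add: F_def card_PiE)
    also have "\<dots> = 2 ^ (512 * r\<^sup>2)"
      by (simp add: t_def Q_def power2_eq_square flip: power_mult)
    finally show "card F = 2 ^ (512 * r\<^sup>2)" .
    show "G f \<in> games n" "payoffs_in n {-1..1} (G f)" "pseudo_equilibrium d n (G f) \<mu>" for f
      using role_bimatrix_bounds[of \<rho> n t l Q a c f] \<rho>(1) \<mu> by (simp_all add: G_def)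
    show "card {f\<in>F. \<exists>y. approx_NE \<epsilon> n (G f) (x, y)} \<le> 2 ^ (64 * r + 256 * r\<^sup>2)" for x
      by (rule count[of _ "role_mix n \<rho> x"]) (use near in blast)
    show "card {f\<in>F. \<exists>x. approx_NE \<epsilon> n (G f) (x, y)} \<le> 2 ^ (64 * r + 256 * r\<^sup>2)" for y
      by (rule count[of _ "role_mix n \<rho> y"]) (use near in blast)
  qed
qed

text \<open>The exponents leave room: 100 + 2 + 64 + 256 < 512. The additional 2 provides a factor 4
  that absorbs both the success probability 2/3 and the output.\<close>

lemma query_bound_arith:
  assumes r: "r > 0" and "2 / 3 * real (2 ^ (512 * r\<^sup>2)) \<le> (real q + 1) * real (2 ^ (64 * r + 256 * r\<^sup>2))"
  shows "2 ^ (100 * r\<^sup>2) \<le> real q"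
proof -
  have rr: "r \<le> r\<^sup>2" "1 \<le> r\<^sup>2" using r by (simp_all add: power2_eq_square)
  define B where "B = (2::real) ^ (64 * r + 256 * r\<^sup>2)"
  have B: "B > 0" by (simp add: B_def)
  have hyp: "2 / 3 * 2 ^ (512 * r\<^sup>2) \<le> (real q + 1) * B"
    using assms(2) unfolding of_nat_power of_nat_numeral B_def .
  have "2 ^ (100 * r\<^sup>2 + 2) * B = (2::real) ^ (100 * r\<^sup>2 + 2 + (64 * r + 256 * r\<^sup>2))"
    unfolding B_def by (rule power_add[symmetric])
  also have "\<dots> \<le> 2 ^ (512 * r\<^sup>2)" using rr by (intro power_increasing) auto
  finally have "2 / 3 * (2 ^ (100 * r\<^sup>2 + 2) * B) \<le> 2 / 3 * 2 ^ (512 * r\<^sup>2)"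
    by (rule mult_left_mono) simp
  also note hyp
  finally have "(2 / 3 * 2 ^ (100 * r\<^sup>2 + 2)) * B \<le> (real q + 1) * B" by (simp only: mult.assoc)
  hence "2 / 3 * 2 ^ (100 * r\<^sup>2 + 2) \<le> real q + 1" using B by (rule mult_right_le_imp_le)
  moreover have "(2::real) ^ (100 * r\<^sup>2 + 2) = 4 * 2 ^ (100 * r\<^sup>2)" by (simp add: power_add)
  moreover have "(1::real) \<le> 2 ^ (100 * r\<^sup>2)" by simp
  moreover have "p \<le> s" if "2 / 3 * p' \<le> s + 1" "p' = 4 * p" "1 \<le> p" for p p' s :: real
    using that by (simp add: field_simps)
  ultimately show ?thesis by blast
qed

lemma OV_lower_bound:
  assumes "r > 0" "2 ^ (80 * r) \<le> n" "4 * d + 4 \<le> r" "0 \<le> \<epsilon>" "\<epsilon> \<le> 1 / 20000"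
    and "OV_solvable \<epsilon> d q n \<or> partial_OV_solvable \<epsilon> d q n"
  shows "2 ^ (100 * r\<^sup>2) \<le> real q"
proof -
  obtain F :: "(nat \<Rightarrow> nat) set" and G \<mu> where F: "finite F" "card F = 2 ^ (512 * r\<^sup>2)"
    and G: "\<And>f. f \<in> F \<Longrightarrow> G f \<in> games n \<and> payoffs_in n {-1..1} (G f) \<and> pseudo_equilibrium d n (G f) \<mu>"
    and row: "\<And>x. card {f\<in>F. \<exists>y. approx_NE \<epsilon> n (G f) (x, y)} \<le> 2 ^ (64 * r + 256 * r\<^sup>2)"
    and col: "\<And>y. card {f\<in>F. \<exists>x. approx_NE \<epsilon> n (G f) (x, y)} \<le> 2 ^ (64 * r + 256 * r\<^sup>2)"
    using ex_hard_family[OF assms(1-5)] by blast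
  have both: "card {f\<in>F. approx_NE \<epsilon> n (G f) p} \<le> 2 ^ (64 * r + 256 * r\<^sup>2)" for p
  proof -
    obtain x y where p: "p = (x, y)" by (cases p)
    have "card {f\<in>F. approx_NE \<epsilon> n (G f) p} \<le> card {f\<in>F. \<exists>y. approx_NE \<epsilon> n (G f) (x, y)}"
      using F(1) by (intro card_mono) (auto simp: p)
    thus ?thesis using row[of x] by simp
  qed
  have single: "card {f\<in>F. partial_verification_oracle \<epsilon> n (G f) s} \<le> 2 ^ (64 * r + 256 * r\<^sup>2)" for s
    using row col by (cases s) simp_all
  have "2 / 3 * real (card F) \<le> (real q + 1) * real (2 ^ (64 * r + 256 * r\<^sup>2))"
    using assms(6)
  proof
    assume "OV_solvable \<epsilon> d q n"
    then obtain A where A: "OV_algorithm (profiles n) n q A"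
      "computes_approx_NE (verification_oracle \<epsilon> n) \<epsilon> d n A" by (auto simp: OV_solvable_def)
    show ?thesis
      by (rule OV_counting_bound[OF F(1) _ both A G]) (simp add: verification_oracle_def both)
  next
    assume "partial_OV_solvable \<epsilon> d q n"
    then obtain A where A: "OV_algorithm (single_strategies n) n q A"
      "computes_approx_NE (partial_verification_oracle \<epsilon> n) \<epsilon> d n A" by (auto simp: partial_OV_solvable_def)
    show ?thesis
      by (rule OV_counting_bound[OF F(1) single both A G])
  qed
  thus ?thesis unfolding F(2) by (rule query_bound_arith[OF assms(1)])
qed

text \<open>With \<open>r\<close> about log2 n / 80, either \<open>4 * d + 4\<close> exceeds
  \<open>r\<close>, so \<open>d\<close> is of order log n, or the query bound applies and has an
  exponent of order (log n)^2. The threshold on n gives \<open>r \<ge> 20\<close>, which covers the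
  losses from rounding and from the additive 4.\<close>

lemma OV_lower_bound_asymptotic:
  fixes d q n :: nat
  assumes n: "n \<ge> 1" "1600 * ln 2 \<le> ln (real n)" and \<epsilon>: "0 \<le> \<epsilon>" "\<epsilon> \<le> 1 / 20000"
    and solv: "OV_solvable \<epsilon> d q n \<or> partial_OV_solvable \<epsilon> d q n"
  shows "real d \<ge> 1 / 1000 * ln (real n) \<or> real q \<ge> real n powr (1 / 1000 * ln (real n))"
proof -
  define L where "L = ln (real n) / ln 2"
  define r where "r = nat \<lfloor>L / 80\<rfloor>"
  have n0: "real n > 0" using n(1) by simp
  have ln2: "ln 2 > (0::real)" "ln 2 \<le> (1::real)" using ln_2_less_1 by auto
  have lnn: "ln (real n) = L * ln 2" using ln2 by (simp add: L_def)
  have "L \<ge> 1600" using n(2) ln2(1) by (simp add: L_def pos_le_divide_eq)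
  hence fl: "20 \<le> \<lfloor>L / 80\<rfloor>" by (simp add: le_floor_iff)
  hence rr: "real r = of_int \<lfloor>L / 80\<rfloor>" by (simp add: r_def)
  have r20: "real r \<ge> 20" unfolding rr using fl by simp
  have rL: "real r \<le> L / 80" "L / 80 < real r + 1" unfolding rr by linarith+
  have pow: "2 ^ (80 * r) \<le> n"
  proof -
    have "real (2 ^ (80 * r)) = exp (ln 2) ^ (80 * r)" by simp
    also have "\<dots> = exp (real (80 * r) * ln 2)" by (rule exp_of_nat_mult[symmetric])
    also have "\<dots> \<le> exp (L * ln 2)" using rL ln2 by simp
    also have "\<dots> = real n" using n0 by (simp add: lnn[symmetric])
    finally show ?thesis by (simp only: of_nat_le_iff)
  qed
  show ?thesis
  proof (cases "4 * d + 4 \<le> r")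
    case True
    have q: "2 ^ (100 * r\<^sup>2) \<le> real q"
      using OV_lower_bound[OF _ pow True \<epsilon> solv] r20 by simp
    have "real n powr (1 / 1000 * ln (real n)) = exp (1 / 1000 * (ln (real n))\<^sup>2)"
      using n0 by (simp add: powr_def power2_eq_square)
    also have "\<dots> \<le> exp (real (100 * r\<^sup>2) * ln 2)"
    proof -
      have "L \<le> 160 * real r" using rL r20 by linarith
      hence "L\<^sup>2 \<le> (160 * real r)\<^sup>2" using \<open>L \<ge> 1600\<close> by (intro power_mono) auto
      hence "L\<^sup>2 \<le> 25600 * (real r)\<^sup>2" by (simp add: power_mult_distrib)
      hence "1 / 1000 * L\<^sup>2 \<le> 100 * (real r)\<^sup>2"
        using zero_le_power2[of "real r"] by linarith
      moreover have "(ln 2)\<^sup>2 \<le> (ln 2 :: real)"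
        using ln2 by (simp add: power2_eq_square mult_left_le_one_le)
      ultimately have "1 / 1000 * L\<^sup>2 * (ln 2)\<^sup>2 \<le> 100 * (real r)\<^sup>2 * ln 2"
        by (rule mult_mono) simp_all
      thus ?thesis by (simp add: lnn power_mult_distrib)
    qed
    also have "\<dots> = 2 ^ (100 * r\<^sup>2)"
      by (simp only: exp_of_nat_mult exp_ln zero_less_numeral)
    finally show ?thesis using q by linarith
  next
    case False
    hence "real r < 4 * real d + 4" by linarith
    moreover have "1 / 1000 * ln (real n) \<le> 1 / 1000 * L"
      using ln2 \<open>L \<ge> 1600\<close> by (simp add: lnn mult_left_le)
    ultimately have "1 / 1000 * ln (real n) \<le> real d" using rL r20 by linarith
    thus ?thesis ..
  qed
qed

lemma eventually_ln_ge: "\<forall>\<^sub>F n in sequentially. (c :: real) \<le> ln (real n)"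
  using filterlim_compose[OF ln_at_top filterlim_real_sequentially] by (simp add: filterlim_at_top)

theorem mainTheorem4:
  shows "\<exists>\<epsilon>::real. \<epsilon> > 0 \<and>
    (\<forall>d q :: nat \<Rightarrow> nat.
       (\<forall>n\<ge>1. OV_solvable \<epsilon> (d n) (q n) n) \<longrightarrow>
       (\<exists>c::real. c > 0 \<and> (\<forall>\<^sub>F n in sequentially.
          real (d n) \<ge> c * ln (real n) \<or> real (q n) \<ge> real n powr (c * ln (real n))))) \<and>
    (\<forall>d q :: nat \<Rightarrow> nat.
       (\<forall>n\<ge>1. partial_OV_solvable \<epsilon> (d n) (q n) n) \<longrightarrow>
       (\<exists>c::real. c > 0 \<and> (\<forall>\<^sub>F n in sequentially.
          real (d n) \<ge> c * ln (real n) \<or> real (q n) \<ge> real n powr (c * ln (real n)))))"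
proof (rule exI[of _ "1 / 20000"], intro conjI allI impI)
  show "(1 / 20000 :: real) > 0" by simp
next
  fix d q :: "nat \<Rightarrow> nat"
  assume *: "\<forall>n\<ge>1. OV_solvable (1 / 20000) (d n) (q n) n"
  have "\<forall>\<^sub>F n in sequentially. 1 / 1000 * ln (real n) \<le> real (d n) \<or>
      real n powr (1 / 1000 * ln (real n)) \<le> real (q n)"
    using eventually_ln_ge[of "1600 * ln 2"] eventually_ge_at_top[of 1]
    by eventually_elim (rule OV_lower_bound_asymptotic[of _ "1 / 20000"], use * in simp_all)
  thus "\<exists>c>0. \<forall>\<^sub>F n in sequentially. c * ln (real n) \<le> real (d n) \<or> real n powr (c * ln (real n)) \<le> real (q n)"
    by (intro exI[of _ "1 / 1000"]) simp
next
  fix d q :: "nat \<Rightarrow> nat"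
  assume *: "\<forall>n\<ge>1. partial_OV_solvable (1 / 20000) (d n) (q n) n"
  have "\<forall>\<^sub>F n in sequentially. 1 / 1000 * ln (real n) \<le> real (d n) \<or>
      real n powr (1 / 1000 * ln (real n)) \<le> real (q n)"
    using eventually_ln_ge[of "1600 * ln 2"] eventually_ge_at_top[of 1]
    by eventually_elim (rule OV_lower_bound_asymptotic[of _ "1 / 20000"], use * in simp_all)
  thus "\<exists>c>0. \<forall>\<^sub>F n in sequentially. c * ln (real n) \<le> real (d n) \<or> real n powr (c * ln (real n)) \<le> real (q n)"
    by (intro exI[of _ "1 / 1000"]) simp
qed

end
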